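(* Let $k$, $\chi$, $U(\chi)$, $\tau$, $\mathbf c\in k^n$, $B_{\mathbf c}$, $\varphi$, $\psi$ be as in the context. If $\varphi:\operatorname{gr}(B_{\mathbf c})\to H_\theta\ltimes U^-$ is an algebra isomorphism, then the restriction $\psi:B_{\mathbf c}\to H_\theta\ltimes U^-$ is an algebra isomorphism onto $(H_\theta\ltimes U^-,* )$, where $*$ is the uniquely determined $0$-equivariant star product on $H_\theta\ltimes U^-$ such that $$F_i*u=F_iu+c_i\,q_{i\tau(i)}\,(K_{\tau(i)}K_i^{-1})\,\partial^L_{\tau(i)}(u)\qquad\text{for all } i\in I,\ u\in U^-.$$
   Context: Let $k$ be a field, $\mathbb N=\{0,1,2,\dots\}$, $I=\{1,\dots,n\}$, $\{\alpha_i\}_{i\in I}$ the standard basis of $\mathbb Z^n$. Let $\chi:\mathbb Z^n\times\mathbb Z^n\to k^\times$ be a bicharacter with $q_{ij}:=\chi(\alpha_i,\alpha_j)=q_{ji}$ for all $i,j$. $H=k[K_i^{\pm1}\mid i\in I]$ is the group algebra of $\mathbb Z^n$. $\widetilde U(\chi)$ is the Hopf algebra with generators $E_i,F_i,K_i^{\pm1}$, relations $K_iK_i^{-1}=1=K_i^{-1}K_i$, $K_iK_j=K_jK_i$, $K_iE_j=q_{ij}E_jK_i$, $K_iF_j=q_{ij}^{-1}F_jK_i$, $E_iF_j-F_jE_i=\delta_{ij}(K_i-K_i^{-1})$ and coproduct $\Delta(E_i)=E_i\otimes1+K_i\otimes E_i$, $\Delta(F_i)=F_i\otimes K_i^{-1}+1\otimes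 F_i$, $\Delta(K_i)=K_i\otimes K_i$. The subalgebras generated by the $E_i$, resp. the $F_i$, are the tensor algebras $T(V^+(\chi))$, $T(V^-(\chi))$ on $V^+(\chi)=\mathrm{span}\{E_i\}$, $V^-(\chi)=\mathrm{span}\{F_i\}$. $V^+(\chi)$ is a Yetter–Drinfeld module over $H$ with $K_i\cdot E_j=q_{ij}E_j$, $\delta(E_i)=K_i\otimes E_i$, so $T(V^+(\chi))$ is a $\mathbb Z^n$-graded braided Hopf algebra ($\deg E_i=\alpha_i$). $\omega$ is the algebra automorphism of $\widetilde U(\chi)$ with $\omega(E_i)=F_i$, $\omega(F_i)=E_i$, $\omega(K_i)=K_i^{-1}$. Fix a $\mathbb Z^n$-graded biideal $\mathcal I\subseteq\bigoplus_{m\ge2}T(V^+(\chi))_m$. Put $U(\chi)=\widetilde U(\chi)/(\mathcal I,\omega(\mathcal I))$, $U^+=T(V^+(\chi))/\mathcal I$ (a pre-Nichols algebra of diagonal type), $U^-=T(V^-(\chi))/\omega(\mathcal I)$. Multiplication $U^+\otimes H\otimes U^-\to U(\chi)$ is a linear isomorphism. Let $\tau:I\to I$ be a bijection with $\tau^2=\mathrm{id}$, $q_{\tau(i)\tau(j)}=q_{ij}$, and assume $\tau(\mathcal I)=\mathcal I$ for the automorphism $E_i\mapsto E_{\tau(i)}$. $H_\theta\subset H$ is the subalgebra generated by all $K_iK_{\tau(i)}^{-1}$, and $H_\theta\ltimes U^-$ is the subalgebra of $U(\chi)$ generated by $H_\theta$ and $U^-$ (as a vector space $H_\theta\otimes U^-$).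 For $\mathbf c=(c_1,\dots,c_n)\in k^n$, $B_{\mathbf c}$ is the subalgebra of $U(\chi)$ generated by $H_\theta$ and $B_i=F_i+c_iE_{\tau(i)}K_i^{-1}$, $i\in I$. It is filtered by $\deg(B_i)=1$, $\deg(h)=0$ for $h\in H_\theta$, and $\varphi:\operatorname{gr}(B_{\mathbf c})\to H_\theta\ltimes U^-$ is the surjective graded algebra homomorphism sending the class of $B_i$ to $F_i$ and $h\in H_\theta$ to $h$. $U(\chi)^{\mathrm{poly}}$ is the subalgebra of $U(\chi)$ generated by $F_i$, $\widetilde E_i=E_iK_i^{-1}$, $K_i^{-1}$, $K_iK_{\tau(i)}^{-1}$; it contains $B_{\mathbf c}$. There is a direct sum decomposition $U(\chi)^{\mathrm{poly}}=(H_\theta\ltimes U^-)\oplus U(\chi)^{\mathrm{poly}}\,\mathrm{span}_k\{\widetilde E_i,K_i^{-1}\mid i\in I\}$, and $\psi:U(\chi)^{\mathrm{poly}}\to H_\theta\ltimes U^-$ is the linear projection onto the first summand. The skew derivations $\partial_i^L,\partial_i^R:U^-\to U^-$ are the unique linear maps with $E_if-fE_i=K_i\partial_i^L(f)-\partial_i^R(f)K_i^{-1}$ for all $f\in U^-$. A star product on an $\mathbb N$-graded $k$-algebra $A=\bigoplus_jA_j$ is an associative bilinear operation $*$ on $A$ with $a*b-ab\in\bigoplus_{j<m+l}A_j$ for all $a\in A_m$, $b\in A_l$. It is $0$-equivariant if $a*h=ah$ and $h*a=ha$ for all $h\in A_0$, $a\in A$. Here $A=H_\theta\ltimes U^-$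 is graded by $\deg(h)=0$ ($h\in H_\theta$), $\deg(F_i)=1$. *)

theory Defs
  imports
    "HOL-Algebra.QuotRing"
    "HOL-Algebra.Generated_Rings"
    "HOL-Algebra.Algebraic_Closure_Type"
    "HOL-Library.Poly_Mapping"
    "HOL-Analysis.Finite_Cartesian_Product"
begin

section \<open>Free algebras\<close>

text \<open>
  With concatenation as the (additively written, noncommutative) addition on words, the
  convolution product makes \<open>'g list \<Rightarrow>\<^sub>0 'k\<close> the free unital \<open>'k\<close>-algebra on \<open>'g\<close>.
\<close>

instantiation list :: (type) monoid_add
begin

definition zero_list :: "'a list" where "zero_list = []"

definition plus_list :: "'a list \<Rightarrow> 'a list \<Rightarrow> 'a list" where "plus_list u v = u @ v"

instance by standard (simp_all add: zero_list_def plus_list_def)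

end

definition gen :: "'g \<Rightarrow> 'g list \<Rightarrow>\<^sub>0 'k::field"
  where "gen g = Poly_Mapping.single [g] 1"

definition scal :: "'k \<Rightarrow> 'g list \<Rightarrow>\<^sub>0 'k::field"
  where "scal a = Poly_Mapping.single [] a"

text \<open>The algebra homomorphism between free algebras induced by a map of generators.\<close>

definition map_gens :: "('g \<Rightarrow> 'h) \<Rightarrow> ('g list \<Rightarrow>\<^sub>0 'k) \<Rightarrow> ('h list \<Rightarrow>\<^sub>0 'k::field)"
  where "map_gens f x =
    (\<Sum>w\<in>Poly_Mapping.keys x. Poly_Mapping.single (map f w) (Poly_Mapping.lookup x w))"


section \<open>Algebras over a field as \<open>module\<close> records\<close>

definition alg_span :: "('k, 'a) module \<Rightarrow> 'a set \<Rightarrow> 'a set"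
  where "alg_span M S = generate (add_monoid M) {a \<odot>\<^bsub>M\<^esub> s | a s. s \<in> S}"

definition subalg :: "('k, 'a) module \<Rightarrow> 'a set \<Rightarrow> 'a set"
  where "subalg M S = generate_ring M (range (\<lambda>a. a \<odot>\<^bsub>M\<^esub> \<one>\<^bsub>M\<^esub>) \<union> S)"

definition linear_on :: "('k, 'a) module \<Rightarrow> 'a set \<Rightarrow> ('k, 'b) module \<Rightarrow> 'b set \<Rightarrow> ('a \<Rightarrow> 'b) \<Rightarrow> bool"
  where "linear_on M V N W f \<longleftrightarrow>
    f \<in> V \<rightarrow> W \<and>
    (\<forall>x\<in>V. \<forall>y\<in>V. f (x \<oplus>\<^bsub>M\<^esub> y) = f x \<oplus>\<^bsub>N\<^esub> f y) \<and>
    (\<forall>a. \<forall>x\<in>V. f (a \<odot>\<^bsub>M\<^esub> x) = a \<odot>\<^bsub>N\<^esub> f x)"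

definition alg_hom :: "('k, 'a) module \<Rightarrow> ('k, 'b) module \<Rightarrow> ('a \<Rightarrow> 'b) set"
  where "alg_hom M N = {f \<in> ring_hom M N. linear_on M (carrier M) N (carrier N) f}"

definition alg_iso :: "('k, 'a) module \<Rightarrow> ('k, 'b) module \<Rightarrow> ('a \<Rightarrow> 'b) set"
  where "alg_iso M N = {f \<in> alg_hom M N. bij_betw f (carrier M) (carrier N)}"

text \<open>
  \<open>monomials M D G m\<close> consists of the products \<open>d\<^sub>0 g\<^sub>1 d\<^sub>1 \<dots> g\<^sub>m d\<^sub>m\<close> with \<open>d\<^sub>j \<in> D\<close>, \<open>g\<^sub>j \<in> G\<close>.
  When \<open>D\<close> is a subalgebra, these are the products of generators from \<open>D \<union> G\<close> of total degree
  \<open>m\<close>, where \<open>D\<close> has degree 0 and \<open>G\<close> has degree 1.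
\<close>

primrec monomials :: "('k, 'a) module \<Rightarrow> 'a set \<Rightarrow> 'a set \<Rightarrow> nat \<Rightarrow> 'a set"
  where
    "monomials M D G 0 = D"
  | "monomials M D G (Suc m) =
      {x \<otimes>\<^bsub>M\<^esub> g \<otimes>\<^bsub>M\<^esub> d | x g d. x \<in> monomials M D G m \<and> g \<in> G \<and> d \<in> D}"

definition graded_part :: "('k, 'a) module \<Rightarrow> 'a set \<Rightarrow> 'a set \<Rightarrow> nat \<Rightarrow> 'a set"
  where "graded_part M D G m = alg_span M (monomials M D G m)"

definition filtered_part :: "('k, 'a) module \<Rightarrow> 'a set \<Rightarrow> 'a set \<Rightarrow> nat \<Rightarrow> 'a set"
  where "filtered_part M D G m = alg_span M (\<Union>r\<le>m. monomials M D G r)"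


section \<open>The associated graded algebra of a filtered algebra\<close>

text \<open>
  An element of \<open>\<Oplus>\<^sub>m Fil m / Fil (m - 1)\<close> is a finitely supported family of cosets.  As in
  \<^const>\<open>FactRing\<close>, products are formed over all representatives of the factors.
\<close>

definition fil_below :: "('k, 'a) module \<Rightarrow> (nat \<Rightarrow> 'a set) \<Rightarrow> nat \<Rightarrow> 'a set"
  where "fil_below M Fil m = (case m of 0 \<Rightarrow> {\<zero>\<^bsub>M\<^esub>} | Suc j \<Rightarrow> Fil j)"

definition gr_class :: "('k, 'a) module \<Rightarrow> (nat \<Rightarrow> 'a set) \<Rightarrow> nat \<Rightarrow> 'a \<Rightarrow> nat \<Rightarrow> 'a set"
  where "gr_class M Fil m x =
    (\<lambda>j. if j = m then fil_below M Fil m +>\<^bsub>M\<^esub> x else fil_below M Fil j)"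

definition gr :: "('k, 'a) module \<Rightarrow> (nat \<Rightarrow> 'a set) \<Rightarrow> ('k, nat \<Rightarrow> 'a set) module"
  where "gr M Fil =
    \<lparr>carrier = {g. (\<forall>m. \<exists>x\<in>Fil m. g m = fil_below M Fil m +>\<^bsub>M\<^esub> x) \<and>
        finite {m. g m \<noteq> fil_below M Fil m}},
     monoid.mult = (\<lambda>g h m. \<Union>{fil_below M Fil m +>\<^bsub>M\<^esub> (\<Oplus>\<^bsub>M\<^esub>j\<in>{..m}. x j \<otimes>\<^bsub>M\<^esub> y (m - j)) | x y.
        \<forall>j\<le>m. x j \<in> g j \<and> y j \<in> h j}),
     one = gr_class M Fil 0 \<one>\<^bsub>M\<^esub>,
     zero = fil_below M Fil,
     add = (\<lambda>g h m. g m <+>\<^bsub>M\<^esub> h m),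
     module.smult = (\<lambda>a g m. \<Union>x\<in>g m. fil_below M Fil m +>\<^bsub>M\<^esub> (a \<odot>\<^bsub>M\<^esub> x))\<rparr>"


section \<open>Star products\<close>

definition star_product ::
    "('k, 'a) module \<Rightarrow> 'a set \<Rightarrow> (nat \<Rightarrow> 'a set) \<Rightarrow> ('a \<Rightarrow> 'a \<Rightarrow> 'a) \<Rightarrow> bool"
  where "star_product M A Ad star \<longleftrightarrow>
    (\<forall>a\<in>A. linear_on M A M A (star a)) \<and>
    (\<forall>b\<in>A. linear_on M A M A (\<lambda>a. star a b)) \<and>
    (\<forall>a\<in>A. \<forall>b\<in>A. \<forall>d\<in>A. star (star a b) d = star a (star b d)) \<and>
    (\<forall>m l. \<forall>a\<in>Ad m. \<forall>b\<in>Ad l.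
      star a b \<ominus>\<^bsub>M\<^esub> a \<otimes>\<^bsub>M\<^esub> b \<in> alg_span M (\<Union>j\<in>{..<m + l}. Ad j))"

definition zero_equivariant ::
    "('k, 'a) module \<Rightarrow> 'a set \<Rightarrow> (nat \<Rightarrow> 'a set) \<Rightarrow> ('a \<Rightarrow> 'a \<Rightarrow> 'a) \<Rightarrow> bool"
  where "zero_equivariant M A Ad star \<longleftrightarrow>
    (\<forall>h\<in>Ad 0. \<forall>a\<in>A. star a h = a \<otimes>\<^bsub>M\<^esub> h \<and> star h a = h \<otimes>\<^bsub>M\<^esub> a)"


section \<open>Bicharacters and graded biideals of \<open>T(V\<^sup>+)\<close>\<close>

definition bicharacter :: "(int ^ 'i \<Rightarrow> int ^ 'i \<Rightarrow> 'k::field) \<Rightarrow> bool"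
  where "bicharacter chi \<longleftrightarrow>
    (\<forall>a b d. chi (a + b) d = chi a d * chi b d \<and> chi a (b + d) = chi a b * chi a d \<and> chi a b \<noteq> 0)"

definition qmat :: "(int ^ 'i \<Rightarrow> int ^ 'i \<Rightarrow> 'k::field) \<Rightarrow> 'i \<Rightarrow> 'i \<Rightarrow> 'k"
  where "qmat chi i j = chi (axis i 1) (axis j 1)"

text \<open>
  The tensor algebra \<open>T(V\<^sup>+)\<close> is the free algebra \<open>'i list \<Rightarrow>\<^sub>0 'k\<close>, the word \<open>[i]\<close> being \<open>E\<^sub>i\<close>, and
  \<open>T(V\<^sup>+) \<otimes> T(V\<^sup>+)\<close> has the pairs of words as basis.  \<open>braided_mult\<close> is the multiplication twisted
  by the Yetter-Drinfeld braiding: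
  \<open>(u \<otimes> v) (u' \<otimes> v') = chi (deg v) (deg u') (u u' \<otimes> v v')\<close>.
\<close>

definition word_deg :: "'i list \<Rightarrow> int ^ 'i"
  where "word_deg w = (\<Sum>i\<leftarrow>w. axis i 1)"

definition braided_mult ::
    "(int ^ 'i \<Rightarrow> int ^ 'i \<Rightarrow> 'k) \<Rightarrow> ('i list \<times> 'i list \<Rightarrow>\<^sub>0 'k) \<Rightarrow> ('i list \<times> 'i list \<Rightarrow>\<^sub>0 'k)
      \<Rightarrow> ('i list \<times> 'i list \<Rightarrow>\<^sub>0 'k::field)"
  where "braided_mult chi x y =
    (\<Sum>(u, v)\<in>Poly_Mapping.keys x. \<Sum>(u', v')\<in>Poly_Mapping.keys y.
      Poly_Mapping.single (u @ u', v @ v')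
        (chi (word_deg v) (word_deg u') *
          Poly_Mapping.lookup x (u, v) * Poly_Mapping.lookup y (u', v')))"

definition scale2 :: "'k \<Rightarrow> ('i list \<times> 'i list \<Rightarrow>\<^sub>0 'k) \<Rightarrow> ('i list \<times> 'i list \<Rightarrow>\<^sub>0 'k::field)"
  where "scale2 a = Poly_Mapping.map ((*) a)"

definition tensor :: "('i list \<Rightarrow>\<^sub>0 'k) \<Rightarrow> ('i list \<Rightarrow>\<^sub>0 'k) \<Rightarrow> ('i list \<times> 'i list \<Rightarrow>\<^sub>0 'k::field)"
  where "tensor x y =
    (\<Sum>u\<in>Poly_Mapping.keys x. \<Sum>v\<in>Poly_Mapping.keys y.
      Poly_Mapping.single (u, v) (Poly_Mapping.lookup x u * Poly_Mapping.lookup y v))"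

text \<open>
  The coproduct is the algebra homomorphism into the braided tensor square with
  \<open>E\<^sub>i \<mapsto> E\<^sub>i \<otimes> 1 + 1 \<otimes> E\<^sub>i\<close>.
\<close>

primrec coprod_word :: "(int ^ 'i \<Rightarrow> int ^ 'i \<Rightarrow> 'k) \<Rightarrow> 'i list \<Rightarrow> ('i list \<times> 'i list \<Rightarrow>\<^sub>0 'k::field)"
  where
    "coprod_word chi [] = tensor 1 1"
  | "coprod_word chi (i # w) =
      braided_mult chi (tensor (gen i) 1 + tensor 1 (gen i)) (coprod_word chi w)"

definition coprod ::
    "(int ^ 'i \<Rightarrow> int ^ 'i \<Rightarrow> 'k) \<Rightarrow> ('i list \<Rightarrow>\<^sub>0 'k) \<Rightarrow> ('i list \<times> 'i list \<Rightarrow>\<^sub>0 'k::field)"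
  where "coprod chi x =
    (\<Sum>w\<in>Poly_Mapping.keys x. scale2 (Poly_Mapping.lookup x w) (coprod_word chi w))"

definition biideal :: "(int ^ 'i \<Rightarrow> int ^ 'i \<Rightarrow> 'k::field) \<Rightarrow> ('i list \<Rightarrow>\<^sub>0 'k) set \<Rightarrow> bool"
  where "biideal chi J \<longleftrightarrow>
    ideal J ring_of_type_algebra \<and>
    (\<forall>x\<in>J. coprod chi x \<in> module.span scale2 {tensor y z | y z. y \<in> J \<or> z \<in> J}) \<and>
    (\<forall>x\<in>J. Poly_Mapping.lookup x [] = 0)"

definition homogeneous_component :: "int ^ 'i \<Rightarrow> ('i list \<Rightarrow>\<^sub>0 'k) \<Rightarrow> ('i list \<Rightarrow>\<^sub>0 'k::field)"
  where "homogeneous_component \<beta> x =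
    (\<Sum>w | w \<in> Poly_Mapping.keys x \<and> word_deg w = \<beta>.
      Poly_Mapping.single w (Poly_Mapping.lookup x w))"

definition graded_subset :: "('i::finite list \<Rightarrow>\<^sub>0 'k::field) set \<Rightarrow> bool"
  where "graded_subset J \<longleftrightarrow> (\<forall>x\<in>J. \<forall>\<beta>. homogeneous_component \<beta> x \<in> J)"


section \<open>The algebra \<open>U(\<chi>)\<close>\<close>

datatype 'i U_gen = Egen 'i | Fgen 'i | Kgen 'i | Kinvgen 'i

fun omega_gen :: "'i U_gen \<Rightarrow> 'i U_gen"
  where
    "omega_gen (Egen i) = Fgen i"
  | "omega_gen (Fgen i) = Egen i"
  | "omega_gen (Kgen i) = Kinvgen i"
  | "omega_gen (Kinvgen i) = Kgen i"

definition U_rels :: "(int ^ 'i \<Rightarrow> int ^ 'i \<Rightarrow> 'k) \<Rightarrow> ('i U_gen list \<Rightarrow>\<^sub>0 'k::field) set"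
  where "U_rels chi =
    (\<Union>i. {gen (Kgen i) * gen (Kinvgen i) - 1, gen (Kinvgen i) * gen (Kgen i) - 1}) \<union>
    (\<Union>i j.
      {gen (Kgen i) * gen (Kgen j) - gen (Kgen j) * gen (Kgen i),
       gen (Kgen i) * gen (Egen j) - scal (qmat chi i j) * gen (Egen j) * gen (Kgen i),
       gen (Kgen i) * gen (Fgen j) - scal (inverse (qmat chi i j)) * gen (Fgen j) * gen (Kgen i),
       gen (Egen i) * gen (Fgen j) - gen (Fgen j) * gen (Egen i) -
         (if i = j then gen (Kgen i) - gen (Kinvgen i) else 0)})"

text \<open>
  The two successive quotients, first by \<open>U_rels\<close> and then by \<open>J\<close> (written in the \<open>E\<^sub>i\<close>) and
  \<open>\<omega> J\<close>, are taken in one step; \<open>\<omega>\<close> is defined on the free algebra, where it acts on words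
  letter by letter.
\<close>

definition U_ideal ::
    "(int ^ 'i \<Rightarrow> int ^ 'i \<Rightarrow> 'k) \<Rightarrow> ('i list \<Rightarrow>\<^sub>0 'k) set \<Rightarrow> ('i U_gen list \<Rightarrow>\<^sub>0 'k::field) set"
  where "U_ideal chi J =
    Idl\<^bsub>ring_of_type_algebra\<^esub>
      (U_rels chi \<union> map_gens Egen ` J \<union> map_gens omega_gen ` map_gens Egen ` J)"

context
  fixes chi :: "int ^ 'i::finite \<Rightarrow> int ^ 'i \<Rightarrow> 'k::field"
    and J :: "('i list \<Rightarrow>\<^sub>0 'k) set"
begin

definition U_class :: "('i U_gen list \<Rightarrow>\<^sub>0 'k) \<Rightarrow> ('i U_gen list \<Rightarrow>\<^sub>0 'k) set"
  where "U_class x = U_ideal chi J +>\<^bsub>ring_of_type_algebra\<^esub> x"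

definition U :: "('k, ('i U_gen list \<Rightarrow>\<^sub>0 'k) set) module"
  where "U = ring.extend (ring_of_type_algebra Quot U_ideal chi J)
    (module.fields (\<lambda>a x. U_class (scal a) \<otimes>\<^bsub>ring_of_type_algebra Quot U_ideal chi J\<^esub> x))"

definition U_E :: "'i \<Rightarrow> ('i U_gen list \<Rightarrow>\<^sub>0 'k) set"
  where "U_E i = U_class (gen (Egen i))"

definition U_F :: "'i \<Rightarrow> ('i U_gen list \<Rightarrow>\<^sub>0 'k) set"
  where "U_F i = U_class (gen (Fgen i))"

definition U_K :: "'i \<Rightarrow> ('i U_gen list \<Rightarrow>\<^sub>0 'k) set"
  where "U_K i = U_class (gen (Kgen i))"

definition U_Kinv :: "'i \<Rightarrow> ('i U_gen list \<Rightarrow>\<^sub>0 'k) set"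
  where "U_Kinv i = U_class (gen (Kinvgen i))"

text \<open>
  \<open>U\<^sup>-\<close> is taken inside \<open>U(\<chi>)\<close>, where it is the isomorphic copy of \<open>T(V\<^sup>-) / \<omega> J\<close> given by the
  triangular decomposition.
\<close>

definition U_minus :: "('i U_gen list \<Rightarrow>\<^sub>0 'k) set set"
  where "U_minus = subalg U (range U_F)"

definition skew_derivations ::
    "'i \<Rightarrow> (('i U_gen list \<Rightarrow>\<^sub>0 'k) set \<Rightarrow> ('i U_gen list \<Rightarrow>\<^sub>0 'k) set)
      \<Rightarrow> (('i U_gen list \<Rightarrow>\<^sub>0 'k) set \<Rightarrow> ('i U_gen list \<Rightarrow>\<^sub>0 'k) set) \<Rightarrow> bool"
  where "skew_derivations i dL dR \<longleftrightarrow>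
    linear_on U U_minus U U_minus dL \<and> linear_on U U_minus U U_minus dR \<and>
    (\<forall>f\<in>U_minus. U_E i \<otimes>\<^bsub>U\<^esub> f \<ominus>\<^bsub>U\<^esub> f \<otimes>\<^bsub>U\<^esub> U_E i =
      U_K i \<otimes>\<^bsub>U\<^esub> dL f \<ominus>\<^bsub>U\<^esub> dR f \<otimes>\<^bsub>U\<^esub> U_Kinv i)"

text \<open>
  Restricting to \<^const>\<open>extensional\<close> functions makes the pair of maps on \<open>U\<^sup>-\<close> unique as HOL functions.
\<close>

definition dL :: "'i \<Rightarrow> ('i U_gen list \<Rightarrow>\<^sub>0 'k) set \<Rightarrow> ('i U_gen list \<Rightarrow>\<^sub>0 'k) set"
  where "dL i = fst (THE (l, r). l \<in> extensional U_minus \<and> r \<in> extensional U_minus \<and>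
    skew_derivations i l r)"

context
  fixes \<tau> :: "'i \<Rightarrow> 'i"
begin

definition H_theta :: "('i U_gen list \<Rightarrow>\<^sub>0 'k) set set"
  where "H_theta = subalg U (range (\<lambda>i. U_K i \<otimes>\<^bsub>U\<^esub> U_Kinv (\<tau> i)))"

text \<open>\<open>HU\<close> is \<open>H\<^sub>\<theta> \<ltimes> U\<^sup>-\<close>, graded by \<open>HU_deg\<close> with \<open>deg H\<^sub>\<theta> = 0\<close> and \<open>deg F\<^sub>i = 1\<close>.\<close>

definition HU :: "('i U_gen list \<Rightarrow>\<^sub>0 'k) set set"
  where "HU = subalg U (H_theta \<union> U_minus)"

definition HU_deg :: "nat \<Rightarrow> ('i U_gen list \<Rightarrow>\<^sub>0 'k) set set"
  where "HU_deg = graded_part U H_theta (range U_F)"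

definition U_poly :: "('i U_gen list \<Rightarrow>\<^sub>0 'k) set set"
  where "U_poly = subalg U
    (range U_F \<union> range (\<lambda>i. U_E i \<otimes>\<^bsub>U\<^esub> U_Kinv i) \<union> range U_Kinv \<union>
     range (\<lambda>i. U_K i \<otimes>\<^bsub>U\<^esub> U_Kinv (\<tau> i)))"

definition U_poly_compl :: "('i U_gen list \<Rightarrow>\<^sub>0 'k) set set"
  where "U_poly_compl = alg_span U
    {x \<otimes>\<^bsub>U\<^esub> y | x y. x \<in> U_poly \<and>
      y \<in> alg_span U (range (\<lambda>i. U_E i \<otimes>\<^bsub>U\<^esub> U_Kinv i) \<union> range U_Kinv)}"

text \<open>
  The projection of \<open>U_poly = HU \<oplus> U_poly_compl\<close> onto \<open>HU\<close>; only its values on \<open>U_poly\<close> are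
  meaningful.
\<close>

definition psi :: "('i U_gen list \<Rightarrow>\<^sub>0 'k) set \<Rightarrow> ('i U_gen list \<Rightarrow>\<^sub>0 'k) set"
  where "psi x = (THE a. a \<in> HU \<and> x \<ominus>\<^bsub>U\<^esub> a \<in> U_poly_compl)"

context
  fixes c :: "'i \<Rightarrow> 'k"
begin

definition B_gen :: "'i \<Rightarrow> ('i U_gen list \<Rightarrow>\<^sub>0 'k) set"
  where "B_gen i = U_F i \<oplus>\<^bsub>U\<^esub> c i \<odot>\<^bsub>U\<^esub> (U_E (\<tau> i) \<otimes>\<^bsub>U\<^esub> U_Kinv i)"

definition B :: "('i U_gen list \<Rightarrow>\<^sub>0 'k) set set"
  where "B = subalg U (H_theta \<union> range B_gen)"

definition B_fil :: "nat \<Rightarrow> ('i U_gen list \<Rightarrow>\<^sub>0 'k) set set"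
  where "B_fil = filtered_part U H_theta (range B_gen)"

definition gr_B :: "('k, nat \<Rightarrow> ('i U_gen list \<Rightarrow>\<^sub>0 'k) set set) module"
  where "gr_B = gr (U\<lparr>carrier := B\<rparr>) B_fil"

text \<open>
  Since \<open>gr_B\<close> is generated by the classes occurring here, at most one map on its carrier
  satisfies this; it is the homomorphism \<open>\<phi>\<close>.
\<close>

definition is_phi ::
    "((nat \<Rightarrow> ('i U_gen list \<Rightarrow>\<^sub>0 'k) set set) \<Rightarrow> ('i U_gen list \<Rightarrow>\<^sub>0 'k) set) \<Rightarrow> bool"
  where "is_phi \<phi> \<longleftrightarrow>
    \<phi> \<in> alg_hom gr_B (U\<lparr>carrier := HU\<rparr>) \<and>
    (\<forall>i. \<phi> (gr_class (U\<lparr>carrier := B\<rparr>) B_fil 1 (B_gen i)) = U_F i) \<and>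
    (\<forall>h\<in>H_theta. \<phi> (gr_class (U\<lparr>carrier := B\<rparr>) B_fil 0 h) = h)"

definition theta_star ::
    "(('i U_gen list \<Rightarrow>\<^sub>0 'k) set \<Rightarrow> ('i U_gen list \<Rightarrow>\<^sub>0 'k) set \<Rightarrow> ('i U_gen list \<Rightarrow>\<^sub>0 'k) set) \<Rightarrow> bool"
  where "theta_star star \<longleftrightarrow>
    star_product U HU HU_deg star \<and> zero_equivariant U HU HU_deg star \<and>
    (\<forall>i. \<forall>u\<in>U_minus. star (U_F i) u =
      U_F i \<otimes>\<^bsub>U\<^esub> u \<oplus>\<^bsub>U\<^esub>
        (c i * qmat chi i (\<tau> i)) \<odot>\<^bsub>U\<^esub> (U_K (\<tau> i) \<otimes>\<^bsub>U\<^esub> U_Kinv i \<otimes>\<^bsub>U\<^esub> dL (\<tau> i) u))"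

end

end

end

end

theory Submission
  imports Defs
begin

text \<open>
  \<open>U(\<chi>)\<close> acts on a universal Verma module, realised on functions from \<open>\<int>\<^sup>n\<close> to \<open>T(V\<^sup>-)\<close>.  A biideal \<open>J\<close> is
  stable under both skew derivations, so the functions with values in \<open>J\<close> form a submodule, and
  modulo this submodule both copies of \<open>J\<close> act by zero.  Hence applying an element of \<open>U(\<chi>)\<close> to the
  generator recovers the coefficients of \<open>\<Sum>\<^sub>a K\<^sup>a F\<^bsub>g(a)\<^esub>\<close> modulo \<open>J\<close>.  This is the part of the triangular
  decomposition that matters: it yields the uniqueness of the skew derivations, the grading of
  \<open>H\<^sub>\<theta> \<ltimes> U\<^sup>-\<close> and, comparing the heights of the torus degrees, the directness of the decomposition that
  defines \<open>\<psi>\<close>.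

  The complement in that decomposition is a left ideal of \<open>U\<^sup>p\<^sup>o\<^sup>l\<^sup>y\<close>, so \<open>\<psi>(x y) = \<psi>(x \<psi>(y))\<close>, and
  \<open>\<psi>(B\<^sub>i u)\<close> is \<open>F\<^sub>i u\<close> plus terms of lower degree.  Thus \<open>\<psi>\<close> is filtered on \<open>B\<^sub>c\<close> with leading term \<open>\<phi>\<close>,
  hence bijective when \<open>\<phi>\<close> is injective, and the star product is the transported multiplication.  A star
  product is determined by the operators \<open>F\<^sub>i * _\<close>, by induction on the degree of the left factor.
\<close>

section \<open>Algebras as module records\<close>

text \<open>The obstacle is that \<open>U\<close> is a bare quotient of a free algebra, so every
  directness statement needs a module on which both copies of J are seen to act harmlessly. For the
  copy in the F's this is the ideal property. For the copy in the E's the coproduct enters: its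
  components with a single generator in one leg are the skew derivations, and J has no part in
  degree one. The filtered half of the argument never looks inside \<open>U\<close>. It uses a
  subspace C that is stable under left multiplication by P and complementary to the graded algebra,
  together with a congruence \<open>G i\<close> b = \<open>F i\<close> b + lower terms modulo C; the
  locale \<open>deformation\<close> isolates this. The constant q_{i tau(i)} of the star product
  arises as follows. Moving K_i^{-1} to the right through u twists every letter of u by its degree
  against \<alpha>_i; the left derivation then removes one letter tau(i); moving K_i^{-1} back
  undoes the twist on the remaining letters only. The other two terms of the commutation end in
  K_i^{-1} or in E_{tau(i)} K_i^{-1} and are killed by \<open>psi\<close>.\<close>

locale k_algebra = ring M for M :: "('k::field, 'a) module" (structure) +
  assumes smult_closed [simp, intro]: "x \<in> carrier M \<Longrightarrow> a \<odot> x \<in> carrier M"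
    and smult_add: "\<lbrakk>x \<in> carrier M; y \<in> carrier M\<rbrakk> \<Longrightarrow> a \<odot> (x \<oplus> y) = a \<odot> x \<oplus> a \<odot> y"
    and add_smult: "x \<in> carrier M \<Longrightarrow> (a + b) \<odot> x = a \<odot> x \<oplus> b \<odot> x"
    and smult_smult: "x \<in> carrier M \<Longrightarrow> a \<odot> (b \<odot> x) = (a * b) \<odot> x"
    and one_smult [simp]: "x \<in> carrier M \<Longrightarrow> 1 \<odot> x = x"
    and smult_mult_left: "\<lbrakk>x \<in> carrier M; y \<in> carrier M\<rbrakk> \<Longrightarrow> (a \<odot> x) \<otimes> y = a \<odot> (x \<otimes> y)"
    and smult_mult_right: "\<lbrakk>x \<in> carrier M; y \<in> carrier M\<rbrakk> \<Longrightarrow> x \<otimes> (a \<odot> y) = a \<odot> (x \<otimes> y)"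
begin

lemma zero_smult [simp]:
  assumes "x \<in> carrier M" shows "0 \<odot> x = \<zero>"
proof -
  have "0 \<odot> x \<oplus> 0 \<odot> x = 0 \<odot> x \<oplus> \<zero>"
    using add_smult[OF assms, of 0 0] assms by simp
  then show ?thesis using assms by (metis add.l_cancel smult_closed zero_closed)
qed

lemma smult_zero [simp]: "a \<odot> \<zero> = \<zero>"
  using smult_smult[of \<zero> a 0] zero_smult[of \<zero>] by simp

lemma minus_smult:
  assumes "x \<in> carrier M" shows "(- a) \<odot> x = \<ominus> (a \<odot> x)"
proof -
  have "(- a) \<odot> x \<oplus> a \<odot> x = \<zero>"
    using add_smult[OF assms, of "- a" a] assms by simp
  then show ?thesis using assms by (simp add: minus_equality)
qed

lemma minus_one_smult: "x \<in> carrier M \<Longrightarrow> (- 1) \<odot> x = \<ominus> x"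
  using minus_smult[of x 1] by simp

lemma smult_minus: "x \<in> carrier M \<Longrightarrow> a \<odot> (\<ominus> x) = \<ominus> (a \<odot> x)"
  by (simp add: smult_smult flip: minus_smult minus_one_smult)

lemma smult_diff:
  "\<lbrakk>x \<in> carrier M; y \<in> carrier M\<rbrakk> \<Longrightarrow> a \<odot> (x \<ominus> y) = a \<odot> x \<ominus> a \<odot> y"
  by (simp add: minus_eq smult_add smult_minus)

lemma diff_diff_add:
  assumes "x \<in> carrier M" "y \<in> carrier M" "x' \<in> carrier M" "y' \<in> carrier M"
  shows "(x \<oplus> x') \<ominus> (y \<oplus> y') = (x \<ominus> y) \<oplus> (x' \<ominus> y')"
  using assms by (simp add: minus_eq minus_add a_ac)

lemma diff_trans_eq:
  assumes "x \<in> carrier M" "y \<in> carrier M" "z \<in> carrier M"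
  shows "x \<ominus> z = (x \<ominus> y) \<oplus> (y \<ominus> z)"
proof -
  have "(x \<ominus> y) \<oplus> (y \<ominus> z) = x \<oplus> (\<ominus> y \<oplus> y) \<oplus> \<ominus> z"
    using assms by (simp add: minus_eq a_assoc)
  then show ?thesis using assms by (simp add: l_neg minus_eq)
qed

lemma diff_distrib_left:
  "\<lbrakk>x \<in> carrier M; y \<in> carrier M; z \<in> carrier M\<rbrakk> \<Longrightarrow> (x \<ominus> y) \<otimes> z = x \<otimes> z \<ominus> y \<otimes> z"
  by (simp add: minus_eq l_distr l_minus)

lemma diff_distrib_right:
  "\<lbrakk>x \<in> carrier M; y \<in> carrier M; z \<in> carrier M\<rbrakk> \<Longrightarrow> z \<otimes> (x \<ominus> y) = z \<otimes> x \<ominus> z \<otimes> y"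
  by (simp add: minus_eq r_distr r_minus)

lemma diff_eq_zero_iff:
  assumes "x \<in> carrier M" "y \<in> carrier M" shows "x \<ominus> y = \<zero> \<longleftrightarrow> x = y"
proof
  assume "x \<ominus> y = \<zero>"
  then have "x = \<zero> \<oplus> y" using assms by (metis a_assoc l_neg minus_closed minus_eq r_zero a_inv_closed)
  then show "x = y" using assms by simp
qed (use assms in \<open>simp add: minus_eq r_neg\<close>)

subsection \<open>Subspaces\<close>

definition subsp :: "'a set \<Rightarrow> bool"
  where "subsp W \<longleftrightarrow> W \<subseteq> carrier M \<and> \<zero> \<in> W \<and> (\<forall>x\<in>W. \<forall>y\<in>W. x \<oplus> y \<in> W) \<and> (\<forall>a. \<forall>x\<in>W. a \<odot> x \<in> W)"

lemma subspI:
  "\<lbrakk>W \<subseteq> carrier M; \<zero> \<in> W; \<And>x y. \<lbrakk>x \<in> W; y \<in> W\<rbrakk> \<Longrightarrow> x \<oplus> y \<in> W; \<And>a x. x \<in> W \<Longrightarrow> a \<odot> x \<in> W\<rbrakk>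
    \<Longrightarrow> subsp W"
  by (simp add: subsp_def)

lemma subspD:
  assumes "subsp W"
  shows "W \<subseteq> carrier M" "\<zero> \<in> W" "\<And>x y. \<lbrakk>x \<in> W; y \<in> W\<rbrakk> \<Longrightarrow> x \<oplus> y \<in> W"
    "\<And>a x. x \<in> W \<Longrightarrow> a \<odot> x \<in> W"
  using assms by (simp_all add: subsp_def)

lemma subsp_carrier: "subsp W \<Longrightarrow> x \<in> W \<Longrightarrow> x \<in> carrier M"
  by (auto simp: subsp_def)

lemma subsp_neg: "subsp W \<Longrightarrow> x \<in> W \<Longrightarrow> \<ominus> x \<in> W"
  by (metis minus_one_smult subsp_carrier subspD(4))

lemma subsp_diff: "subsp W \<Longrightarrow> x \<in> W \<Longrightarrow> y \<in> W \<Longrightarrow> x \<ominus> y \<in> W"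
  by (simp add: minus_eq subsp_neg subspD(3))

lemma subsp_zero: "subsp {\<zero>}"
  by (rule subspI) auto

lemma alg_span_carrier:
  assumes "S \<subseteq> carrier M" shows "alg_span M S \<subseteq> carrier M"
proof
  fix x assume "x \<in> alg_span M S"
  then show "x \<in> carrier M"
    unfolding alg_span_def
    by (induction rule: generate.induct)
      (use assms in \<open>auto simp: a_inv_def[symmetric] dest!: subsetD\<close>)
qed

lemma alg_span_base: "S \<subseteq> carrier M \<Longrightarrow> x \<in> S \<Longrightarrow> x \<in> alg_span M S"
  unfolding alg_span_def
  by (rule generate.incl, rule CollectI, rule exI[of _ 1], rule exI[of _ x]) auto

lemma subsp_alg_span:
  assumes "S \<subseteq> carrier M" shows "subsp (alg_span M S)"
proof (rule subspI)
  show "alg_span M S \<subseteq> carrier M" by (rule alg_span_carrier[OF assms])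
  show "\<zero> \<in> alg_span M S"
    unfolding alg_span_def using generate.one[of "add_monoid M"] by simp
  show add: "x \<oplus> y \<in> alg_span M S" if "x \<in> alg_span M S" "y \<in> alg_span M S" for x y
    using that unfolding alg_span_def using generate.eng[of x "add_monoid M" _ y] by simp
  fix a x assume "x \<in> alg_span M S"
  then have "a \<odot> x \<in> generate (add_monoid M) {a \<odot>\<^bsub>M\<^esub> s | a s. s \<in> S}"
    unfolding alg_span_def
  proof (induction rule: generate.induct)
    case one
    then show ?case using generate.one[of "add_monoid M"] by simp
  next
    case (incl h)
    then obtain b s where s: "h = b \<odot> s" "s \<in> S" by blast
    then have "a \<odot> h = (a * b) \<odot> s" using assms by (auto simp: smult_smult)
    then show ?case using s by (auto intro!: generate.incl)
  next
    case (inv h)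
    then obtain b s where s: "h = b \<odot> s" "s \<in> S" by blast
    then have "a \<odot> (\<ominus> h) = (- a * b) \<odot> s"
      using assms by (metis (no_types) minus_smult mult_minus_left smult_closed smult_minus smult_smult subsetD)
    then show ?case unfolding a_inv_def using s by (auto intro!: generate.incl)
  next
    case (eng h1 h2)
    have "h1 \<in> carrier M" "h2 \<in> carrier M"
      using eng(1,2) alg_span_carrier[OF assms] unfolding alg_span_def by auto
    then show ?case using generate.eng[OF eng(3,4)] by (simp add: smult_add)
  qed
  then show "a \<odot> x \<in> alg_span M S" by (simp add: alg_span_def)
qed

lemma alg_span_least:
  assumes "subsp W" "S \<subseteq> W" shows "alg_span M S \<subseteq> W"
proof
  fix x assume "x \<in> alg_span M S"
  then show "x \<in> W"
    unfolding alg_span_def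
  proof (induction rule: generate.induct)
    case (inv h)
    then have "h \<in> W" using assms by (auto intro: subspD(4))
    then show ?case using subsp_neg[OF assms(1)] by (simp add: a_inv_def)
  qed (use assms in \<open>auto intro: subspD\<close>)
qed

lemma alg_span_mono: "S \<subseteq> S' \<Longrightarrow> S' \<subseteq> carrier M \<Longrightarrow> alg_span M S \<subseteq> alg_span M S'"
  by (meson alg_span_base alg_span_least order_trans subsetD subsetI subsp_alg_span)

lemma alg_span_induct [consumes 2, case_names zero add smult base]:
  assumes "x \<in> alg_span M S" "S \<subseteq> carrier M"
    and "P \<zero>"
    and "\<And>x y. \<lbrakk>x \<in> alg_span M S; y \<in> alg_span M S; P x; P y\<rbrakk> \<Longrightarrow> P (x \<oplus> y)"
    and "\<And>a x. \<lbrakk>x \<in> alg_span M S; P x\<rbrakk> \<Longrightarrow> P (a \<odot> x)"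
    and "\<And>x. x \<in> S \<Longrightarrow> P x"
  shows "P x"
proof -
  note s = subsp_alg_span[OF assms(2)]
  have "alg_span M S \<subseteq> {x \<in> alg_span M S. P x}"
    by (rule alg_span_least, rule subspI)
      (use assms(3-6) subspD[OF s] alg_span_base[OF assms(2)] in auto)
  then show ?thesis using assms(1) by blast
qed

lemma alg_span_subsp: "subsp W \<Longrightarrow> alg_span M W = W"
  using alg_span_least[of W W] alg_span_base[of W] subspD(1)[of W] by blast

subsection \<open>Subalgebras\<close>

definition subalgebra :: "'a set \<Rightarrow> bool"
  where "subalgebra W \<longleftrightarrow> subsp W \<and> \<one> \<in> W \<and> (\<forall>x\<in>W. \<forall>y\<in>W. x \<otimes> y \<in> W)"

lemma subalgebraI:
  "\<lbrakk>subsp W; \<one> \<in> W; \<And>x y. x \<in> W \<Longrightarrow> y \<in> W \<Longrightarrow> x \<otimes> y \<in> W\<rbrakk> \<Longrightarrow> subalgebra W"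
  by (simp add: subalgebra_def)

lemma subalgebraD:
  assumes "subalgebra W"
  shows "subsp W" "\<one> \<in> W" "\<And>x y. x \<in> W \<Longrightarrow> y \<in> W \<Longrightarrow> x \<otimes> y \<in> W"
  using assms by (simp_all add: subalgebra_def)

lemma subalg_carrier:
  assumes "S \<subseteq> carrier M" shows "subalg M S \<subseteq> carrier M"
  unfolding subalg_def using assms by (intro generate_ring_incl) auto

lemma subalg_base: "x \<in> S \<Longrightarrow> x \<in> subalg M S"
  by (simp add: generate_ring.incl subalg_def)

lemma subalgebra_subalg:
  assumes "S \<subseteq> carrier M" shows "subalgebra (subalg M S)"
proof (rule subalgebraI, rule subspI)
  note c = subalg_carrier[OF assms]
  show "subalg M S \<subseteq> carrier M" by (rule c)
  show "\<zero> \<in> subalg M S" "\<one> \<in> subalg M S"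
    unfolding subalg_def by (auto intro: zero_in_generate generate_ring.one)
  show "x \<oplus> y \<in> subalg M S" "x \<otimes> y \<in> subalg M S" if "x \<in> subalg M S" "y \<in> subalg M S" for x y
    using that unfolding subalg_def by (auto intro: generate_ring.intros)
  fix a x assume x: "x \<in> subalg M S"
  have "(a \<odot> \<one>) \<otimes> x \<in> subalg M S"
    using x unfolding subalg_def by (auto intro: generate_ring.intros)
  then show "a \<odot> x \<in> subalg M S" using x c by (auto simp: smult_mult_left)
qed

lemma subalg_least:
  assumes "subalgebra W" "S \<subseteq> W" shows "subalg M S \<subseteq> W"
proof
  note W = subalgebraD[OF assms(1)]
  fix x assume "x \<in> subalg M S"
  then show "x \<in> W"
    unfolding subalg_def
    by (induction rule: generate_ring.induct)
      (use assms(2) in \<open>auto intro: W subspD[OF W(1)] subsp_neg[OF W(1)]\<close>)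
qed

lemma subalg_mono: "S \<subseteq> S' \<Longrightarrow> S' \<subseteq> carrier M \<Longrightarrow> subalg M S \<subseteq> subalg M S'"
  by (meson order_trans subalg_base subalg_least subalgebra_subalg subsetI)

text \<open>The elements whose left multiplication preserves W form a subalgebra, so stability can
  be tested on generators. With W = \<open>HU\<close> + \<open>U_poly_compl\<close> and w = 1 this
  yields the decomposition of \<open>U_poly\<close>.\<close>

lemma subalg_mult_stable:
  assumes "subsp W" "S \<subseteq> carrier M" "\<And>s w. s \<in> S \<Longrightarrow> w \<in> W \<Longrightarrow> s \<otimes> w \<in> W"
    and "x \<in> subalg M S" "w \<in> W"
  shows "x \<otimes> w \<in> W"
proof -
  note Wc = subspD[OF assms(1)]
  let ?V = "{x \<in> carrier M. \<forall>w\<in>W. x \<otimes> w \<in> W}"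
  have "subalgebra ?V"
  proof (rule subalgebraI, rule subspI)
    show "\<zero> \<in> ?V" "\<one> \<in> ?V" using Wc by auto
    show "x \<oplus> y \<in> ?V" "x \<otimes> y \<in> ?V" if "x \<in> ?V" "y \<in> ?V" for x y
      using that Wc(1) by (auto simp: l_distr m_assoc subset_iff intro: Wc(3))
    show "a \<odot> x \<in> ?V" if "x \<in> ?V" for a x
      using that Wc(1) by (auto simp: smult_mult_left subset_iff intro: Wc(4))
  qed auto
  moreover have "S \<subseteq> ?V" using assms by auto
  ultimately show ?thesis using subalg_least assms(4,5) by blast
qed

lemma k_algebra_subalgebra:
  assumes "subalgebra W" shows "k_algebra (M\<lparr>carrier := W\<rparr>)"
proof -
  note W = subalgebraD[OF assms]
  note Ws = subspD[OF W(1)]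
  have "subring W M"
    by (rule subringI) (use W Ws subsp_neg[OF W(1)] in auto)
  then have "ring (M\<lparr>carrier := W\<rparr>)" using subring_is_ring by blast
  then show ?thesis
    unfolding k_algebra_def k_algebra_axioms_def
    using Ws(1,4) by (auto simp: smult_add add_smult smult_smult smult_mult_left smult_mult_right subset_iff)
qed

subsection \<open>Monomials\<close>

lemma monomials_carrier:
  "D \<subseteq> carrier M \<Longrightarrow> G \<subseteq> carrier M \<Longrightarrow> monomials M D G m \<subseteq> carrier M"
proof (induction m)
  case (Suc m)
  then show ?case by (auto intro!: m_closed dest!: subsetD)
qed simp

text \<open>A monomial ends in a factor from D, and that factor absorbs d.\<close>

lemma monomials_mult_right:
  assumes "D \<subseteq> carrier M" "G \<subseteq> carrier M" "\<And>x y. x \<in> D \<Longrightarrow> y \<in> D \<Longrightarrow> x \<otimes> y \<in> D"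
    and "x \<in> monomials M D G m" "d \<in> D"
  shows "x \<otimes> d \<in> monomials M D G m"
proof (cases m)
  case 0
  then show ?thesis using assms by simp
next
  case (Suc n)
  then obtain y g e where y: "x = y \<otimes> g \<otimes> e" "y \<in> monomials M D G n" "g \<in> G" "e \<in> D"
    using assms(4) by auto
  then have "x \<otimes> d = y \<otimes> g \<otimes> (e \<otimes> d)"
    using assms(1,2,5) monomials_carrier[OF assms(1,2), of n] by (auto simp: m_assoc subset_iff)
  moreover have "e \<otimes> d \<in> D" using y(4) assms(3,5) by blast
  ultimately show ?thesis using y(2,3) Suc by auto
qed

lemma monomials_mult:
  assumes "D \<subseteq> carrier M" "G \<subseteq> carrier M" "\<And>x y. x \<in> D \<Longrightarrow> y \<in> D \<Longrightarrow> x \<otimes> y \<in> D"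
    and "x \<in> monomials M D G m" "y \<in> monomials M D G l"
  shows "x \<otimes> y \<in> monomials M D G (m + l)"
  using assms(5)
proof (induction l arbitrary: y)
  case 0
  then show ?case using monomials_mult_right[OF assms(1-4)] by simp
next
  case (Suc l)
  then obtain z g e where y: "y = z \<otimes> g \<otimes> e" "z \<in> monomials M D G l" "g \<in> G" "e \<in> D"
    by auto
  have c: "x \<in> carrier M" "z \<in> carrier M" "g \<in> carrier M" "e \<in> carrier M"
    using assms(1,2,4) y monomials_carrier[OF assms(1,2)] by auto
  have "x \<otimes> y = (x \<otimes> z) \<otimes> g \<otimes> e" using c by (simp add: y(1) m_assoc)
  then show ?case using Suc.IH[OF y(2)] y(3,4) by auto
qed

end

section \<open>Filtered algebras\<close>

context k_algebra
begin

lemma coset_eq: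
  assumes "subsp W" "x \<in> carrier M"
  shows "W +> x = {y \<in> carrier M. y \<ominus> x \<in> W}"
proof -
  have "h \<oplus> x \<in> carrier M \<and> h \<oplus> x \<ominus> x \<in> W" if "h \<in> W" for h
    using that assms subsp_carrier[OF assms(1)] by (simp add: minus_eq a_assoc r_neg)
  moreover have "\<exists>h\<in>W. y = h \<oplus> x" if "y \<in> carrier M" "y \<ominus> x \<in> W" for y
    using that assms(2) by (intro bexI[of _ "y \<ominus> x"]) (simp_all add: minus_eq a_assoc l_neg)
  ultimately show ?thesis by (auto simp: a_r_coset_def')
qed

lemma coset_self: "subsp W \<Longrightarrow> x \<in> carrier M \<Longrightarrow> x \<in> W +> x"
  by (simp add: coset_eq minus_eq r_neg subspD(2))

lemma coset_eq_iff:
  assumes "subsp W" "x \<in> carrier M" "y \<in> carrier M"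
  shows "W +> x = W +> y \<longleftrightarrow> x \<ominus> y \<in> W"
proof
  assume "W +> x = W +> y"
  then show "x \<ominus> y \<in> W" using coset_self[OF assms(1,2)] assms by (simp add: coset_eq)
next
  have sub: "W +> x \<subseteq> W +> y" if "x \<ominus> y \<in> W" "x \<in> carrier M" "y \<in> carrier M" for x y
  proof
    fix z assume "z \<in> W +> x"
    then have "z \<in> carrier M" "z \<ominus> x \<in> W" using that assms(1) by (simp_all add: coset_eq)
    then show "z \<in> W +> y"
      using that assms(1) diff_trans_eq[of z x y] by (simp add: coset_eq subspD(3))
  qed
  assume xy: "x \<ominus> y \<in> W"
  then have "y \<ominus> x \<in> W" using subsp_neg[OF assms(1) xy] assms(2,3)
    by (simp add: minus_eq minus_add a_comm)
  then show "W +> x = W +> y" using sub xy assms(2,3) by blast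
qed

lemma coset_zero: "subsp W \<Longrightarrow> W +> \<zero> = W"
  by (auto simp: coset_eq subsp_carrier minus_eq)

lemma coset_add:
  assumes "subsp W" "x \<in> carrier M" "y \<in> carrier M"
  shows "(W +> x) <+> (W +> y) = W +> (x \<oplus> y)"
proof
  show "(W +> x) <+> (W +> y) \<subseteq> W +> (x \<oplus> y)"
    using assms by (auto simp: coset_eq set_add_def' diff_diff_add subspD(3))
  show "W +> (x \<oplus> y) \<subseteq> (W +> x) <+> (W +> y)"
  proof
    fix z assume "z \<in> W +> (x \<oplus> y)"
    then have z: "z \<in> carrier M" "z \<ominus> (x \<oplus> y) \<in> W" using assms by (simp_all add: coset_eq)
    have "z = (z \<ominus> y) \<oplus> y" using z assms by (simp add: minus_eq a_assoc l_neg)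
    moreover have "z \<ominus> y \<ominus> x = z \<ominus> (x \<oplus> y)"
      using z assms by (simp add: minus_eq minus_add a_ac)
    ultimately show "z \<in> (W +> x) <+> (W +> y)"
      using z assms coset_self[OF assms(1,3)] by (auto simp: coset_eq set_add_def')
  qed
qed

text \<open>Scalar multiplication in \<open>gr\<close> is a union over all representatives. They all
  give the same coset, because two of them differ by an element of W.\<close>

lemma coset_smult:
  assumes "subsp W" "x \<in> carrier M"
  shows "(\<Union>y\<in>W +> x. W +> a \<odot> y) = W +> a \<odot> x"
proof -
  have "W +> a \<odot> y = W +> a \<odot> x" if "y \<in> W +> x" for y
    using that assms by (auto simp: coset_eq_iff coset_eq[of W x] subspD(4) simp flip: smult_diff)
  then show ?thesis using coset_self[OF assms] by blast
qed

lemma finsum_subsp: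
  assumes "subsp W" "\<And>j. j \<in> S \<Longrightarrow> f j \<in> W" "finite S"
  shows "(\<Oplus>j\<in>S. f j) \<in> W"
  using assms(3,2)
proof (induction S)
  case (insert s S)
  then have "f \<in> S \<rightarrow> carrier M" "f s \<in> carrier M" using subsp_carrier[OF assms(1)] by auto
  then show ?case using insert by (simp add: subspD(3)[OF assms(1)])
qed (simp add: subspD(2)[OF assms(1)])

end

locale filtered_algebra = k_algebra +
  fixes Fil :: "nat \<Rightarrow> 'a set"
  assumes subsp_Fil: "subsp (Fil m)"
    and Fil_Suc: "Fil m \<subseteq> Fil (Suc m)"
    and Fil_mult: "\<lbrakk>x \<in> Fil m; y \<in> Fil l\<rbrakk> \<Longrightarrow> x \<otimes> y \<in> Fil (m + l)"
begin

abbreviation "Fb \<equiv> fil_below M Fil"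

lemma subsp_Fb: "subsp (Fb m)"
  by (cases m) (simp_all add: fil_below_def subsp_zero subsp_Fil)

lemma Fb_subset: "Fb m \<subseteq> Fil m"
  by (cases m) (auto simp: fil_below_def subspD(2)[OF subsp_Fil] subsetD[OF Fil_Suc])

lemma Fil_carrier: "x \<in> Fil m \<Longrightarrow> x \<in> carrier M"
  by (rule subsp_carrier[OF subsp_Fil])

lemma Fb_mult_left:
  assumes "x \<in> Fb m" "y \<in> Fil l" shows "x \<otimes> y \<in> Fb (m + l)"
proof (cases m)
  case 0
  then show ?thesis using assms Fil_carrier[OF assms(2)] subspD(2)[OF subsp_Fb]
    by (simp add: fil_below_def[of _ _ 0])
next
  case (Suc k)
  then show ?thesis using assms Fil_mult[of x k y l] by (simp add: fil_below_def)
qed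

lemma Fb_mult_right:
  assumes "x \<in> Fil m" "y \<in> Fb l" shows "x \<otimes> y \<in> Fb (m + l)"
proof (cases l)
  case 0
  then show ?thesis using assms Fil_carrier[OF assms(1)] subspD(2)[OF subsp_Fb]
    by (simp add: fil_below_def[of _ _ 0])
next
  case (Suc k)
  then show ?thesis using assms Fil_mult[of x m y k] by (simp add: fil_below_def)
qed

lemma gr_class_eq: "gr_class M Fil m x = (\<lambda>j. Fb j +> (if j = m then x else \<zero>))"
  by (rule ext) (simp add: gr_class_def coset_zero[OF subsp_Fb])

lemma gr_class_closed:
  assumes "x \<in> Fil m" shows "gr_class M Fil m x \<in> carrier (gr M Fil)"
proof -
  have "\<exists>y\<in>Fil j. gr_class M Fil m x j = Fb j +> y" for j
    using assms subspD(2)[OF subsp_Fil] by (cases "j = m") (auto simp: gr_class_eq)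
  moreover have "{j. gr_class M Fil m x j \<noteq> Fb j} \<subseteq> {m}"
    by (auto simp: gr_class_def)
  ultimately show ?thesis by (simp add: gr_def finite_subset)
qed

lemma gr_class_eq_zero_iff:
  assumes "x \<in> Fil m" shows "gr_class M Fil m x = \<zero>\<^bsub>gr M Fil\<^esub> \<longleftrightarrow> x \<in> Fb m"
proof -
  have "gr_class M Fil m x = \<zero>\<^bsub>gr M Fil\<^esub> \<longleftrightarrow> Fb m +> x = Fb m +> \<zero>"
    by (simp add: gr_def gr_class_def fun_eq_iff coset_zero[OF subsp_Fb])
  also have "\<dots> \<longleftrightarrow> x \<in> Fb m"
    using Fil_carrier[OF assms] by (simp add: coset_eq_iff[OF subsp_Fb] minus_eq)
  finally show ?thesis .
qed

lemma gr_class_add: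
  assumes "x \<in> Fil m" "y \<in> Fil m"
  shows "gr_class M Fil m x \<oplus>\<^bsub>gr M Fil\<^esub> gr_class M Fil m y = gr_class M Fil m (x \<oplus> y)"
  using assms[THEN Fil_carrier] by (simp add: gr_def gr_class_eq coset_add[OF subsp_Fb] fun_eq_iff)

lemma gr_zero_add: "\<zero>\<^bsub>gr M Fil\<^esub> \<oplus>\<^bsub>gr M Fil\<^esub> \<zero>\<^bsub>gr M Fil\<^esub> = \<zero>\<^bsub>gr M Fil\<^esub>"
  using gr_class_add[of \<zero> 0 \<zero>] gr_class_eq_zero_iff[of \<zero> 0] subspD(2)[OF subsp_Fil]
    subspD(2)[OF subsp_Fb] by simp

lemma gr_class_smult:
  assumes "x \<in> Fil m"
  shows "a \<odot>\<^bsub>gr M Fil\<^esub> gr_class M Fil m x = gr_class M Fil m (a \<odot> x)"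
  using Fil_carrier[OF assms] by (simp add: gr_def gr_class_eq coset_smult[OF subsp_Fb] fun_eq_iff)

text \<open>The product in \<open>gr\<close> runs through all families of representatives x and y.
  Every summand other than the one pairing index m with index l has a factor that lies one
  filtration step too low. Modulo \<open>Fb p\<close> only the product of a and b can therefore
  survive, and only if p = m + l.\<close>

lemma gr_mult_component:
  assumes a: "a \<in> Fil m" and b: "b \<in> Fil l"
    and x: "\<And>j. j \<le> p \<Longrightarrow> x j \<in> gr_class M Fil m a j"
    and y: "\<And>j. j \<le> p \<Longrightarrow> y j \<in> gr_class M Fil l b j"
  shows "Fb p +> (\<Oplus>j\<in>{..p}. x j \<otimes> y (p - j)) = Fb p +> (if p = m + l then a \<otimes> b else \<zero>)"
proof -
  note ca = Fil_carrier[OF a] and cb = Fil_carrier[OF b]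
  have x': "x j \<in> carrier M \<and> x j \<ominus> (if j = m then a else \<zero>) \<in> Fb j" if "j \<le> p" for j
    using x[OF that] ca by (auto simp: gr_class_eq coset_eq[OF subsp_Fb] split: if_splits)
  have y': "y j \<in> carrier M \<and> y j \<ominus> (if j = l then b else \<zero>) \<in> Fb j" if "j \<le> p" for j
    using y[OF that] cb by (auto simp: gr_class_eq coset_eq[OF subsp_Fb] split: if_splits)
  have xb: "x j \<in> Fb j" if "j \<le> p" "j \<noteq> m" for j using x'[OF that(1)] that(2) by (auto simp: minus_eq)
  have yb: "y j \<in> Fb j" if "j \<le> p" "j \<noteq> l" for j using y'[OF that(1)] that(2) by (auto simp: minus_eq)
  have split: "z = (z \<ominus> w) \<oplus> w" if "z \<in> carrier M" "w \<in> carrier M" for z w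
    using that by (simp add: minus_eq a_assoc l_neg)
  have xF: "x j \<in> Fil j" if "j \<le> p" for j
  proof (cases "j = m")
    case True
    then have "x j \<ominus> a \<in> Fil j" using x'[OF that] Fb_subset by auto
    then show ?thesis using split[of "x j" a] x'[OF that] True a ca subspD(3)[OF subsp_Fil] by metis
  qed (use xb that Fb_subset in blast)
  have yF: "y j \<in> Fil j" if "j \<le> p" for j
  proof (cases "j = l")
    case True
    then have "y j \<ominus> b \<in> Fil j" using y'[OF that] Fb_subset by auto
    then show ?thesis using split[of "y j" b] y'[OF that] True b cb subspD(3)[OF subsp_Fil] by metis
  qed (use yb that Fb_subset in blast)
  have low: "x j \<otimes> y (p - j) \<in> Fb p" if "j \<le> p" "j \<noteq> m \<or> p - j \<noteq> l" for j
  proof (cases "j = m")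
    case True
    then show ?thesis using Fb_mult_right[OF xF[OF that(1)] yb[of "p - j"]] that by simp
  next
    case False
    then show ?thesis using Fb_mult_left[OF xb[OF that(1) False] yF[of "p - j"]] that by simp
  qed
  have c: "x j \<otimes> y (p - j) \<in> carrier M" if "j \<le> p" for j
    using x'[OF that] y'[of "p - j"] by simp
  have "(\<Oplus>j\<in>{..p}. x j \<otimes> y (p - j)) \<ominus> (if p = m + l then a \<otimes> b else \<zero>) \<in> Fb p"
  proof (cases "p = m + l")
    case True
    have xm: "x m \<in> carrier M" "x m \<ominus> a \<in> Fb m" and yl: "y l \<in> carrier M" "y l \<ominus> b \<in> Fb l"
      using x'[of m] y'[of l] True by auto
    have "x m \<otimes> y l \<ominus> a \<otimes> b = (x m \<ominus> a) \<otimes> y l \<oplus> a \<otimes> (y l \<ominus> b)"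
      using xm yl ca cb diff_trans_eq[of "x m \<otimes> y l" "a \<otimes> y l" "a \<otimes> b"]
      by (simp add: diff_distrib_left diff_distrib_right)
    also have "\<dots> \<in> Fb p"
      using Fb_mult_left[OF xm(2) yF[of l]] Fb_mult_right[OF a yl(2)] True
      by (simp add: subspD(3)[OF subsp_Fb])
    finally have top: "x m \<otimes> y l \<ominus> a \<otimes> b \<in> Fb p" .
    have rest: "(\<Oplus>j\<in>{..p} - {m}. x j \<otimes> y (p - j)) \<in> Fb p"
      by (rule finsum_subsp[OF subsp_Fb]) (use low in auto)
    have ins: "{..p} = insert m ({..p} - {m})" using True by auto
    have "(\<Oplus>j\<in>{..p}. x j \<otimes> y (p - j)) = x m \<otimes> y l \<oplus> (\<Oplus>j\<in>{..p} - {m}. x j \<otimes> y (p - j))"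
      using c xm yl True by (subst ins, subst finsum_insert) auto
    then have "(\<Oplus>j\<in>{..p}. x j \<otimes> y (p - j)) \<ominus> a \<otimes> b
        = (x m \<otimes> y l \<ominus> a \<otimes> b) \<oplus> (\<Oplus>j\<in>{..p} - {m}. x j \<otimes> y (p - j))"
      using xm yl ca cb subsp_carrier[OF subsp_Fb rest] by (simp add: minus_eq a_ac)
    then show ?thesis using True top rest subspD(3)[OF subsp_Fb] by simp
  next
    case False
    have "(\<Oplus>j\<in>{..p}. x j \<otimes> y (p - j)) \<in> Fb p"
      by (rule finsum_subsp[OF subsp_Fb]) (use False in \<open>auto intro!: low\<close>)
    then show ?thesis using False subsp_carrier[OF subsp_Fb] by (simp add: minus_eq)
  qed
  moreover have "(\<Oplus>j\<in>{..p}. x j \<otimes> y (p - j)) \<in> carrier M"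
    using c by (intro finsum_closed) auto
  ultimately show ?thesis using ca cb by (subst coset_eq_iff[OF subsp_Fb]) auto
qed

lemma gr_class_mult:
  assumes "a \<in> Fil m" "b \<in> Fil l"
  shows "gr_class M Fil m a \<otimes>\<^bsub>gr M Fil\<^esub> gr_class M Fil l b = gr_class M Fil (m + l) (a \<otimes> b)"
proof
  fix p
  let ?S = "{Fb p +> (\<Oplus>j\<in>{..p}. x j \<otimes> y (p - j)) | x y.
    \<forall>j\<le>p. x j \<in> gr_class M Fil m a j \<and> y j \<in> gr_class M Fil l b j}"
  have ne: "(if j = m then a else \<zero>) \<in> gr_class M Fil m a j
      \<and> (if j = l then b else \<zero>) \<in> gr_class M Fil l b j" for j
    using assms[THEN Fil_carrier] by (auto simp: gr_class_eq intro!: coset_self subsp_Fb)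
  have sub: "?S \<subseteq> {Fb p +> (if p = m + l then a \<otimes> b else \<zero>)}"
    using gr_mult_component[OF assms] by auto
  \<comment> \<open>All members of the set are already known to be equal; it remains to see that
    there is one, since an empty set would make the union in the definition of the product empty.
    The representatives a and b, with zero in all other degrees, provide it.\<close>
  have "Fb p +> (\<Oplus>j\<in>{..p}. (if j = m then a else \<zero>) \<otimes> (if p - j = l then b else \<zero>)) \<in> ?S"
    by (rule CollectI, rule exI[of _ "\<lambda>j. if j = m then a else \<zero>"],
        rule exI[of _ "\<lambda>j. if j = l then b else \<zero>"]) (use ne in simp)
  then have "?S \<noteq> {}" by (metis emptyE)
  with subset_singletonD[OF sub] have "?S = {Fb p +> (if p = m + l then a \<otimes> b else \<zero>)}"
    by argo
  then show "(gr_class M Fil m a \<otimes>\<^bsub>gr M Fil\<^esub> gr_class M Fil l b) p = gr_class M Fil (m + l) (a \<otimes> b) p"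
    by (simp add: gr_def gr_class_eq[of "m + l"])
qed

end

section \<open>Deformations of graded algebras inside a larger algebra\<close>

context k_algebra
begin

lemma alg_span_mult:
  assumes "S \<subseteq> carrier M" "T \<subseteq> carrier M" "subsp W" "\<And>s t. s \<in> S \<Longrightarrow> t \<in> T \<Longrightarrow> s \<otimes> t \<in> W"
    and "x \<in> alg_span M S" "y \<in> alg_span M T"
  shows "x \<otimes> y \<in> W"
proof -
  note W = subspD[OF assms(3)]
  note T = alg_span_carrier[OF assms(2)]
  have s: "s \<otimes> y \<in> W" if "s \<in> S" for s
    using assms(6,2)
  proof (induction rule: alg_span_induct)
    case (smult a x)
    then show ?case using that assms(1) T W(4) by (auto simp: smult_mult_right subset_iff)
  qed (use that assms W T in \<open>auto simp: r_distr subset_iff\<close>)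
  show ?thesis
    using assms(5,1)
  proof (induction rule: alg_span_induct)
    case (add x x')
    then show ?case using alg_span_carrier[OF assms(1)] T W assms(6) by (auto simp: l_distr subset_iff)
  next
    case (smult a x)
    then show ?case using alg_span_carrier[OF assms(1)] T W assms(6) by (auto simp: smult_mult_left subset_iff)
  qed (use s W T assms(6) in \<open>auto simp: subset_iff\<close>)
qed

lemma alg_span_alg_span:
  assumes "\<And>i. i \<in> I \<Longrightarrow> S i \<subseteq> carrier M"
  shows "alg_span M (\<Union>i\<in>I. alg_span M (S i)) = alg_span M (\<Union>i\<in>I. S i)"
proof
  have c: "(\<Union>i\<in>I. S i) \<subseteq> carrier M" using assms by blast
  have "alg_span M (S i) \<subseteq> alg_span M (\<Union>i\<in>I. S i)" if "i \<in> I" for i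
    by (rule alg_span_mono) (use that c in auto)
  then show "alg_span M (\<Union>i\<in>I. alg_span M (S i)) \<subseteq> alg_span M (\<Union>i\<in>I. S i)"
    by (intro alg_span_least subsp_alg_span c) blast
  have "(\<Union>i\<in>I. S i) \<subseteq> (\<Union>i\<in>I. alg_span M (S i))"
    using alg_span_base assms by blast
  then show "alg_span M (\<Union>i\<in>I. S i) \<subseteq> alg_span M (\<Union>i\<in>I. alg_span M (S i))"
    using alg_span_carrier assms by (intro alg_span_mono) blast+
qed

end

context k_algebra
begin

lemma minus_diff:
  "\<lbrakk>x \<in> carrier M; y \<in> carrier M\<rbrakk> \<Longrightarrow> \<ominus> (x \<ominus> y) = y \<ominus> x"
  by (simp add: minus_eq minus_add a_comm)

lemma diff_diff_cancel:
  "\<lbrakk>x \<in> carrier M; y \<in> carrier M\<rbrakk> \<Longrightarrow> x \<ominus> (x \<ominus> y) = y"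
  by (simp add: minus_eq minus_add r_neg2)

lemma diff_diff_cancel_left:
  "\<lbrakk>x \<in> carrier M; y \<in> carrier M; z \<in> carrier M\<rbrakk> \<Longrightarrow> (x \<ominus> y) \<ominus> (x \<ominus> z) = z \<ominus> y"
  by (simp add: minus_eq[of "x \<ominus> y"] minus_diff a_comm[of "x \<ominus> y"] flip: diff_trans_eq)

lemma diff_diff_cancel_right:
  "\<lbrakk>x \<in> carrier M; y \<in> carrier M; z \<in> carrier M\<rbrakk> \<Longrightarrow> (x \<ominus> z) \<ominus> (y \<ominus> z) = x \<ominus> y"
  by (simp add: minus_eq[of "x \<ominus> z"] minus_diff flip: diff_trans_eq)

text \<open>A congruence u b = v b + (element of W) modulo C is linear in b, so it can be checked on
  a spanning set. It is applied with v a generator, to compare deformed and undeformed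
  multiplication, and with v = 0, to show that u b lies in W + C.\<close>

lemma subsp_mult_congruence:
  assumes W: "subsp W" and C: "subsp C" and u: "u \<in> carrier M" and v: "v \<in> carrier M"
  shows "subsp {b \<in> carrier M. \<exists>a\<in>W. (u \<otimes> b) \<ominus> (v \<otimes> b \<oplus> a) \<in> C}" (is "subsp ?V")
proof (rule subspI)
  note Wc = subsp_carrier[OF W]
  show "\<zero> \<in> ?V" using subspD(2)[OF W] subspD(2)[OF C] u v
    by (auto simp: minus_eq intro!: bexI[of _ \<zero>])
  show "x \<oplus> y \<in> ?V" if xy: "x \<in> ?V" "y \<in> ?V" for x y
  proof -
    have c: "x \<in> carrier M" "y \<in> carrier M" using xy by auto
    obtain a b where ab: "a \<in> W" "b \<in> W"
      "(u \<otimes> x) \<ominus> (v \<otimes> x \<oplus> a) \<in> C" "(u \<otimes> y) \<ominus> (v \<otimes> y \<oplus> b) \<in> C"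
      using xy by blast
    have "(u \<otimes> (x \<oplus> y)) \<ominus> (v \<otimes> (x \<oplus> y) \<oplus> (a \<oplus> b))
        = (u \<otimes> x \<oplus> u \<otimes> y) \<ominus> ((v \<otimes> x \<oplus> a) \<oplus> (v \<otimes> y \<oplus> b))"
      using c u v Wc ab by (simp add: r_distr a_ac)
    also have "\<dots> = ((u \<otimes> x) \<ominus> (v \<otimes> x \<oplus> a)) \<oplus> ((u \<otimes> y) \<ominus> (v \<otimes> y \<oplus> b))"
      using c u v Wc ab by (intro diff_diff_add) auto
    finally show ?thesis using ab c subspD(3)[OF C] subspD(3)[OF W]
      by (auto intro!: bexI[of _ "a \<oplus> b"])
  qed
  show "s \<odot> x \<in> ?V" if x: "x \<in> ?V" for s x
  proof -
    have c: "x \<in> carrier M" using x by auto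
    obtain a where a: "a \<in> W" "(u \<otimes> x) \<ominus> (v \<otimes> x \<oplus> a) \<in> C" using x by blast
    have "(u \<otimes> (s \<odot> x)) \<ominus> (v \<otimes> (s \<odot> x) \<oplus> s \<odot> a) = s \<odot> ((u \<otimes> x) \<ominus> (v \<otimes> x \<oplus> a))"
      using c u v Wc a by (simp add: smult_diff smult_add smult_mult_right)
    then show ?thesis using a c subspD(4)[OF C] subspD(4)[OF W] by (auto intro!: bexI[of _ "s \<odot> a"])
  qed
qed auto

lemma monomials_SucI:
  "\<lbrakk>x \<in> monomials M D G m; g \<in> G; d \<in> D\<rbrakk> \<Longrightarrow> x \<otimes> g \<otimes> d \<in> monomials M D G (Suc m)"
  by (simp, blast)

end

section \<open>Algebras generated by a subalgebra in degree zero and elements in degree one\<close>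

locale generated_algebra = k_algebra M for M :: "('k::field, 'a) module" (structure) +
  fixes H :: "'a set" and F :: "'i \<Rightarrow> 'a"
  assumes subalgebra_H: "subalgebra H" and F_closed [simp]: "F i \<in> carrier M"
begin

abbreviation "mons \<equiv> monomials M H (range F)"
abbreviation "gen_alg \<equiv> subalg M (H \<union> range F)"
abbreviation "gdeg \<equiv> graded_part M H (range F)"

text \<open>The bound is strict so that error terms "of degree less than m" can be expressed without
  subtraction: \<open>below 0\<close> is zero, and the m-th filtration step is
  \<open>below (Suc m)\<close>.\<close>

definition below :: "nat \<Rightarrow> 'a set"
  where "below m = alg_span M (\<Union>r\<in>{..<m}. mons r)"

lemmas subsp_H = subalgebraD(1)[OF subalgebra_H]
lemmas H_carrier = subspD(1)[OF subsp_H]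

lemma range_F: "range F \<subseteq> carrier M"
  by auto

lemma mons_carrier: "mons m \<subseteq> carrier M"
  by (rule monomials_carrier[OF H_carrier range_F])

lemma mons_mult: "x \<in> mons m \<Longrightarrow> y \<in> mons l \<Longrightarrow> x \<otimes> y \<in> mons (m + l)"
  by (rule monomials_mult[OF H_carrier range_F subalgebraD(3)[OF subalgebra_H]])

lemma below_graded: "below m = alg_span M (\<Union>r\<in>{..<m}. gdeg r)"
  unfolding below_def graded_part_def
  by (rule alg_span_alg_span[symmetric]) (use mons_carrier in auto)

lemma filtered_part_eq: "filtered_part M H (range F) m = below (Suc m)"
  by (simp add: below_def filtered_part_def lessThan_Suc_atMost)

lemma gdeg_0: "gdeg 0 = H"
  by (simp add: graded_part_def alg_span_subsp[OF subsp_H])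

lemma subsp_below: "subsp (below m)"
  unfolding below_def using mons_carrier by (intro subsp_alg_span) auto

lemma subsp_gdeg: "subsp (gdeg m)"
  unfolding graded_part_def using mons_carrier by (intro subsp_alg_span) auto

lemma below_carrier: "x \<in> below m \<Longrightarrow> x \<in> carrier M"
  by (rule subsp_carrier[OF subsp_below])

lemma below_0: "below 0 = {\<zero>}"
proof
  show "below 0 \<subseteq> {\<zero>}"
    unfolding below_def by (rule alg_span_least[OF subsp_zero]) simp
qed (use subspD(2)[OF subsp_below] in simp)

lemma mons_below: "m < l \<Longrightarrow> mons m \<subseteq> below l"
  unfolding below_def using mons_carrier by (intro subsetI alg_span_base) auto

lemma below_mono: "m \<le> l \<Longrightarrow> below m \<subseteq> below l"
  unfolding below_def by (rule alg_span_mono) (use mons_carrier in fastforce)+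

lemma gdeg_below: "m < l \<Longrightarrow> gdeg m \<subseteq> below l"
  unfolding graded_part_def by (rule alg_span_least[OF subsp_below mons_below])

lemma mons_mult_below: "x \<in> mons m \<Longrightarrow> y \<in> below l \<Longrightarrow> x \<otimes> y \<in> below (m + l)"
proof (rule alg_span_mult[of "{x}" "\<Union>r\<in>{..<l}. mons r"])
  assume x: "x \<in> mons m" and y: "y \<in> below l"
  show "{x} \<subseteq> carrier M" using x mons_carrier by auto
  then show "x \<in> alg_span M {x}" by (auto intro: alg_span_base)
  fix s t assume "s \<in> {x}" "t \<in> (\<Union>r\<in>{..<l}. mons r)"
  then obtain j where "j < l" "s = x" "t \<in> mons j" by blast
  then show "s \<otimes> t \<in> below (m + l)" using mons_mult[OF x] mons_below[of "m + j" "m + l"] by auto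
qed (use mons_carrier subsp_below in \<open>auto simp: below_def\<close>)

text \<open>The asymmetric indices keep the bound sharp: i < m and j \<le> l give i + j < m + l.
  Thus a factor of too low degree makes the whole product of too low degree.\<close>

lemma below_mult: "x \<in> below m \<Longrightarrow> y \<in> below (Suc l) \<Longrightarrow> x \<otimes> y \<in> below (m + l)"
proof (rule alg_span_mult[of "\<Union>r\<in>{..<m}. mons r" "\<Union>r\<in>{..<Suc l}. mons r"])
  fix s t assume "s \<in> (\<Union>r\<in>{..<m}. mons r)" "t \<in> (\<Union>r\<in>{..<Suc l}. mons r)"
  then obtain i j where "i < m" "j < Suc l" "s \<in> mons i" "t \<in> mons j" by blast
  then show "s \<otimes> t \<in> below (m + l)" using mons_mult mons_below[of "i + j" "m + l"] by auto
qed (use mons_carrier subsp_below in \<open>auto simp: below_def\<close>)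

lemma H_below: "x \<in> below m \<Longrightarrow> h \<in> H \<Longrightarrow> h \<otimes> x \<in> below m"
  using mons_mult_below[of h 0 x m] by auto

lemma H_gen_alg: "H \<subseteq> gen_alg"
  by (auto intro: subalg_base)

lemma F_gen_alg: "F i \<in> gen_alg"
  by (auto intro: subalg_base)

lemma subalgebra_gen_alg: "subalgebra gen_alg"
  using H_carrier by (intro subalgebra_subalg) auto

lemmas gen_alg_mult = subalgebraD(3)[OF subalgebra_gen_alg]
lemmas subsp_gen_alg = subalgebraD(1)[OF subalgebra_gen_alg]
lemmas gen_alg_carrier = subsp_carrier[OF subsp_gen_alg]

lemma one_mons: "\<one> \<in> mons 0"
  using subalgebraD(2)[OF subalgebra_H] by simp

lemma F_mons: "F i \<in> mons (Suc 0)"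
proof -
  have "\<one> \<otimes> F i \<otimes> \<one> \<in> mons (Suc 0)"
    by (rule monomials_SucI) (use subalgebraD(2)[OF subalgebra_H] in auto)
  then show ?thesis by simp
qed

lemma mons_gen_alg: "mons m \<subseteq> gen_alg"
  by (induction m) (use H_gen_alg F_gen_alg in \<open>auto intro!: gen_alg_mult\<close>)

lemma below_gen_alg: "below m \<subseteq> gen_alg"
  unfolding below_def using mons_gen_alg by (intro alg_span_least[OF subsp_gen_alg]) auto

lemma gdeg_gen_alg: "gdeg m \<subseteq> gen_alg"
  unfolding graded_part_def by (intro alg_span_least[OF subsp_gen_alg] mons_gen_alg)

lemma gen_alg_below: "gen_alg = (\<Union>m. below m)"
proof
  have "subalgebra (\<Union>m. below m)"
  proof (rule subalgebraI, rule subspI)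
    show "\<one> \<in> (\<Union>m. below m)" using mons_below[of 0 1] one_mons by auto
    show "\<zero> \<in> (\<Union>m. below m)" using below_0 by blast
    show "a \<odot> x \<in> (\<Union>m. below m)" if "x \<in> (\<Union>m. below m)" for a x
      using that by (auto intro: subspD(4)[OF subsp_below])
    show "x \<oplus> y \<in> (\<Union>m. below m)" if xy: "x \<in> (\<Union>m. below m)" "y \<in> (\<Union>m. below m)" for x y
    proof -
      obtain m l where "x \<in> below m" "y \<in> below l" using xy by blast
      then have "x \<in> below (max m l)" "y \<in> below (max m l)"
        using below_mono[of m "max m l"] below_mono[of l "max m l"] by auto
      then show ?thesis using subspD(3)[OF subsp_below] by blast
    qed
    show "x \<otimes> y \<in> (\<Union>m. below m)" if xy: "x \<in> (\<Union>m. below m)" "y \<in> (\<Union>m. below m)" for x y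
    proof -
      obtain m l where "x \<in> below m" "y \<in> below l" using xy by blast
      then have "x \<otimes> y \<in> below (m + l)" using below_mult below_mono[of l "Suc l"] by auto
      then show ?thesis by blast
    qed
  qed (use below_carrier in auto)
  moreover have "H \<subseteq> below 1" "F i \<in> below 2" for i
    using mons_below[of 0 1] mons_below[of "Suc 0" 2] F_mons by auto
  ultimately show "gen_alg \<subseteq> (\<Union>m. below m)" by (intro subalg_least) auto
qed (use below_gen_alg in blast)

text \<open>The filtration is placed on the subalgebra itself, because \<open>gr_B\<close> is formed
  from \<open>U\<close> with carrier \<open>B\<close>.\<close>

lemma filtered_algebra_below:
  "filtered_algebra (M\<lparr>carrier := gen_alg\<rparr>) (filtered_part M H (range F))"
proof -
  interpret N: k_algebra "M\<lparr>carrier := gen_alg\<rparr>"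
    by (rule k_algebra_subalgebra[OF subalgebra_gen_alg])
  show ?thesis
  proof (unfold_locales, unfold filtered_part_eq)
    show "N.subsp (below (Suc m))" for m
      using below_gen_alg subspD[OF subsp_below[of "Suc m"]] by (intro N.subspI) auto
    show "below (Suc m) \<subseteq> below (Suc (Suc m))" for m by (rule below_mono) simp
    fix x y m l assume "x \<in> below (Suc m)" "y \<in> below (Suc l)"
    then show "x \<otimes>\<^bsub>M\<lparr>carrier := gen_alg\<rparr>\<^esub> y \<in> below (Suc (m + l))"
      using below_mult[of x "Suc m" y l] by simp
  qed
qed

end

text \<open>F generates the undeformed algebra and G its deformation, over the same H. C is the
  kernel of the projection on P: its stability under P from the left makes the projection compatible
  with left multiplication, its stability under H from the right gives equivariance on the right.
  \<open>direct\<close> and \<open>graded\<close> are the two directness statements supplied by the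
  Verma module, and \<open>lower\<close> is the only information on how G differs from F.\<close>

locale deformation = F?: generated_algebra M H F + G: generated_algebra M H G
  for M :: "('k::field, 'a) module" (structure) and H and F G :: "'i \<Rightarrow> 'a" +
  fixes P C :: "'a set"
  assumes subalgebra_P: "subalgebra P" and H_P: "H \<subseteq> P" and F_P: "F i \<in> P" and G_P: "G i \<in> P"
    and subsp_C: "subsp C"
    and P_C: "\<lbrakk>x \<in> P; y \<in> C\<rbrakk> \<Longrightarrow> x \<otimes> y \<in> C"
    and C_H: "\<lbrakk>y \<in> C; h \<in> H\<rbrakk> \<Longrightarrow> y \<otimes> h \<in> C"
    and decomp: "x \<in> P \<Longrightarrow> \<exists>a\<in>subalg M (H \<union> range F). x \<ominus> a \<in> C"
    and direct: "\<lbrakk>a \<in> subalg M (H \<union> range F); a \<in> C\<rbrakk> \<Longrightarrow> a = \<zero>"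
    and graded: "\<lbrakk>a \<in> graded_part M H (range F) m; a \<in> F.below m\<rbrakk> \<Longrightarrow> a = \<zero>"
    and lower: "b \<in> graded_part M H (range F) l \<Longrightarrow>
      \<exists>a\<in>F.below l. (G i \<otimes> b) \<ominus> (F i \<otimes> b \<oplus> a) \<in> C"
begin

lemma P_carrier: "x \<in> P \<Longrightarrow> x \<in> carrier M"
  by (rule subsp_carrier[OF subalgebraD(1)[OF subalgebra_P]])

lemma C_carrier: "x \<in> C \<Longrightarrow> x \<in> carrier M"
  by (rule subsp_carrier[OF subsp_C])

lemma gen_alg_P: "gen_alg \<subseteq> P"
  using H_P F_P by (intro subalg_least[OF subalgebra_P]) auto

lemma G_gen_alg_P: "G.gen_alg \<subseteq> P"
  using H_P G_P by (intro subalg_least[OF subalgebra_P]) auto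

lemmas P_mult = subalgebraD(3)[OF subalgebra_P]

text \<open>This has the same shape as \<open>psi\<close>, so that the two agree by unfolding once
  the data are instantiated.\<close>

definition proj :: "'a \<Rightarrow> 'a"
  where "proj x = (THE a. a \<in> gen_alg \<and> x \<ominus> a \<in> C)"

lemma proj_eqI:
  assumes "x \<in> carrier M" "a \<in> gen_alg" "x \<ominus> a \<in> C"
  shows "proj x = a"
  unfolding proj_def
proof (rule the_equality)
  fix b assume b: "b \<in> gen_alg \<and> x \<ominus> b \<in> C"
  have "b \<ominus> a = (x \<ominus> a) \<ominus> (x \<ominus> b)"
    using assms b gen_alg_carrier by (simp add: diff_diff_cancel_left)
  then have "b \<ominus> a \<in> C" using assms b subsp_diff[OF subsp_C] by simp
  moreover have "b \<ominus> a \<in> gen_alg" using assms b subsp_diff[OF subsp_gen_alg] by simp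
  ultimately show "b = a" using direct assms b gen_alg_carrier diff_eq_zero_iff by blast
qed (use assms in simp)

lemma proj_in: "x \<in> P \<Longrightarrow> proj x \<in> gen_alg"
  and proj_diff: "x \<in> P \<Longrightarrow> x \<ominus> proj x \<in> C"
  using decomp proj_eqI P_carrier by metis+

lemma proj_carrier [simp]: "x \<in> P \<Longrightarrow> proj x \<in> carrier M"
  using proj_in gen_alg_carrier by blast

lemma proj_add:
  assumes "x \<in> P" "y \<in> P" shows "proj (x \<oplus> y) = proj x \<oplus> proj y"
  using assms P_carrier proj_in[OF assms(1)] proj_in[OF assms(2)] proj_diff
    subspD(3)[OF subsp_gen_alg] subspD(3)[OF subsp_C]
  by (intro proj_eqI) (simp_all add: diff_diff_add)

lemma proj_smult:
  assumes "x \<in> P" shows "proj (a \<odot> x) = a \<odot> proj x"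
  using assms P_carrier proj_in[OF assms] proj_diff subspD(4)[OF subsp_gen_alg] subspD(4)[OF subsp_C]
  by (intro proj_eqI) (simp_all flip: smult_diff)

lemma proj_neg: "x \<in> P \<Longrightarrow> proj (\<ominus> x) = \<ominus> proj x"
  using proj_smult[of x "- 1"] P_carrier by (simp add: minus_one_smult)

lemma proj_minus:
  assumes "x \<in> P" "y \<in> P" shows "proj (x \<ominus> y) = proj x \<ominus> proj y"
  using assms subsp_neg[OF subalgebraD(1)[OF subalgebra_P]] by (simp add: minus_eq proj_add proj_neg)

lemma proj_self: "a \<in> gen_alg \<Longrightarrow> proj a = a"
  using gen_alg_carrier subspD(2)[OF subsp_C] by (intro proj_eqI) (simp_all add: minus_eq r_neg)

lemma proj_mult:
  assumes "x \<in> P" "y \<in> P" shows "proj (x \<otimes> proj y) = proj (x \<otimes> y)"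
proof -
  have "proj y \<in> P" using proj_in[OF assms(2)] gen_alg_P by blast
  moreover have "proj (x \<otimes> (y \<ominus> proj y)) = \<zero>"
    using P_C[OF assms(1) proj_diff[OF assms(2)]] C_carrier subspD(2)[OF subsp_gen_alg]
    by (intro proj_eqI) (auto simp: minus_eq)
  ultimately have "proj (x \<otimes> y) \<ominus> proj (x \<otimes> proj y) = \<zero>"
    using assms P_carrier P_mult by (simp add: diff_distrib_right proj_minus)
  then show ?thesis using assms P_mult diff_eq_zero_iff \<open>proj y \<in> P\<close> proj_carrier by metis
qed

text \<open>Here C enters as a right H-module. This is what makes right star multiplication by H the
  ordinary one.\<close>

lemma proj_H_right:
  assumes "x \<in> P" "h \<in> H" shows "proj (x \<otimes> h) = proj x \<otimes> h"
  using assms proj_in[OF assms(1)] H_gen_alg gen_alg_mult C_H[OF proj_diff[OF assms(1)] assms(2)]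
    P_carrier H_carrier
  by (intro proj_eqI) (auto simp: diff_distrib_left subset_iff)

lemma below_P: "below m \<subseteq> P"
  using below_gen_alg gen_alg_P by blast

text \<open>Components of b of smaller degree produce errors of still smaller degree, so the
  homogeneous bound passes to the filtration: b of degree at most l has an error of degree less than
  l.\<close>

lemma lower_below:
  assumes "b \<in> below (Suc l)"
  shows "\<exists>a\<in>below l. (G i \<otimes> b) \<ominus> (F i \<otimes> b \<oplus> a) \<in> C"
proof -
  let ?V = "{b \<in> carrier M. \<exists>a\<in>below l. (G i \<otimes> b) \<ominus> (F i \<otimes> b \<oplus> a) \<in> C}"
  have "gdeg r \<subseteq> ?V" if "r < Suc l" for r
    using lower[of _ r i] below_mono[of r l] that subsp_carrier[OF subsp_gdeg] by fastforce
  then have "below (Suc l) \<subseteq> ?V"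
    unfolding below_graded[of "Suc l"]
    by (intro alg_span_least subsp_mult_congruence subsp_below subsp_C) auto
  then show ?thesis using assms by blast
qed

text \<open>Replacing each G by F in a monomial is not a function of the element, since an element
  may be written as a monomial in several ways. The relation records a deformed monomial together
  with the undeformed one of the same shape.\<close>

inductive matched :: "nat \<Rightarrow> 'a \<Rightarrow> 'a \<Rightarrow> bool" where
  matched_0: "h \<in> H \<Longrightarrow> matched 0 h h"
| matched_Suc: "\<lbrakk>matched m x y; h \<in> H\<rbrakk> \<Longrightarrow> matched (Suc m) (x \<otimes> G i \<otimes> h) (y \<otimes> F i \<otimes> h)"

lemma matched_mons: "matched m x y \<Longrightarrow> x \<in> G.mons m \<and> y \<in> mons m"
  by (induction rule: matched.induct) (auto simp del: monomials.simps(2) intro: monomials_SucI)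

lemma matched_left: "x \<in> G.mons m \<Longrightarrow> \<exists>y. matched m x y"
proof (induction m arbitrary: x)
  case (Suc m)
  then obtain z i h where "x = z \<otimes> G i \<otimes> h" "z \<in> G.mons m" "h \<in> H" by auto
  then show ?case using Suc.IH[of z] matched.intros(2) by metis
qed (auto intro: matched.intros)

lemma matched_right: "y \<in> mons m \<Longrightarrow> \<exists>x. matched m x y"
proof (induction m arbitrary: y)
  case (Suc m)
  then obtain z i h where "y = z \<otimes> F i \<otimes> h" "z \<in> mons m" "h \<in> H" by auto
  then show ?case using Suc.IH[of z] matched.intros(2) by metis
qed (auto intro: matched.intros)

text \<open>The letter of x next to b is peeled off: \<open>G i\<close> h b projects to
  \<open>F i\<close> h b + a with a of lower degree, and the projection may be taken inside the
  product with the rest of x. The induction hypothesis is then applied twice, to \<open>F i\<close>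
  h b and to a, which is why b and l are arbitrary.\<close>

lemma matched_proj:
  assumes "matched m x y" "b \<in> below (Suc l)"
  shows "proj (x \<otimes> b) \<ominus> y \<otimes> b \<in> below (m + l)"
  using assms
proof (induction arbitrary: b l rule: matched.induct)
  case (matched_0 h)
  have "h \<otimes> b \<in> gen_alg" using matched_0 H_gen_alg below_gen_alg by (intro gen_alg_mult) auto
  then show ?case using subspD(2)[OF subsp_below] gen_alg_carrier by (simp add: proj_self minus_eq r_neg)
next
  case (matched_Suc m x y h i)
  note xy = matched_mons[OF matched_Suc.hyps(1)]
  have xP: "x \<in> P" and yA: "y \<in> gen_alg" using xy G.mons_gen_alg G_gen_alg_P mons_gen_alg by blast+
  have hb: "h \<otimes> b \<in> below (Suc l)" using matched_Suc H_below by blast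
  obtain a where a: "a \<in> below l" "(G i \<otimes> (h \<otimes> b)) \<ominus> (F i \<otimes> (h \<otimes> b) \<oplus> a) \<in> C"
    using lower_below[OF hb] by blast
  have F: "F i \<otimes> (h \<otimes> b) \<in> below (Suc (Suc l))" using mons_mult_below[OF F_mons hb] by simp
  have aP: "F i \<otimes> (h \<otimes> b) \<in> P" "a \<in> P" "h \<otimes> b \<in> P" using F a hb below_P by auto
  have c: "x \<in> carrier M" "y \<in> carrier M" "h \<in> carrier M" "b \<in> carrier M" "a \<in> carrier M"
    using matched_Suc H_carrier below_carrier a xP yA P_carrier gen_alg_carrier by auto
  have "proj (G i \<otimes> (h \<otimes> b)) = F i \<otimes> (h \<otimes> b) \<oplus> a"
    using a F c subsetD[OF below_gen_alg] subspD(3)[OF subsp_gen_alg] by (intro proj_eqI) auto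
  then have "proj (x \<otimes> G i \<otimes> h \<otimes> b) = proj (x \<otimes> (F i \<otimes> (h \<otimes> b) \<oplus> a))"
    using proj_mult[OF xP, of "G i \<otimes> (h \<otimes> b)"] c P_mult[OF G_P aP(3)] by (simp add: m_assoc)
  also have "\<dots> = proj (x \<otimes> (F i \<otimes> (h \<otimes> b))) \<oplus> proj (x \<otimes> a)"
    using c aP xP P_mult by (simp add: r_distr proj_add)
  finally have eq: "proj (x \<otimes> G i \<otimes> h \<otimes> b) = proj (x \<otimes> (F i \<otimes> (h \<otimes> b))) \<oplus> proj (x \<otimes> a)" .
  have 1: "proj (x \<otimes> (F i \<otimes> (h \<otimes> b))) \<ominus> y \<otimes> (F i \<otimes> (h \<otimes> b)) \<in> below (Suc m + l)"
    using matched_Suc.IH[OF F] by simp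
  \<comment> \<open>If l = 0 then a vanishes. Otherwise a is a legitimate argument of the induction
    hypothesis one degree down, and y a is itself of degree less than m + l.\<close>
  have 2: "proj (x \<otimes> a) \<in> below (Suc m + l)"
  proof (cases l)
    case 0
    then have "x \<otimes> a = \<zero>" using a c by (simp add: below_0)
    then show ?thesis using proj_self[of \<zero>] subspD(2)[OF subsp_gen_alg] subspD(2)[OF subsp_below] by simp
  next
    case (Suc k)
    have "proj (x \<otimes> a) \<ominus> y \<otimes> a \<in> below (m + k)" using matched_Suc.IH a(1) Suc by blast
    then have "proj (x \<otimes> a) \<ominus> y \<otimes> a \<in> below (Suc m + l)"
      using below_mono[of "m + k" "Suc m + l"] Suc by auto
    moreover have "y \<otimes> a \<in> below (Suc m + l)"
      using mons_mult_below[of y m a l] xy a below_mono[of "m + l" "Suc m + l"] by auto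
    moreover have "proj (x \<otimes> a) = (proj (x \<otimes> a) \<ominus> y \<otimes> a) \<oplus> y \<otimes> a"
      using c aP xP P_mult by (simp add: minus_eq a_assoc l_neg)
    ultimately show ?thesis using subspD(3)[OF subsp_below] by metis
  qed
  have "proj (x \<otimes> G i \<otimes> h \<otimes> b) \<ominus> y \<otimes> F i \<otimes> h \<otimes> b
      = (proj (x \<otimes> (F i \<otimes> (h \<otimes> b))) \<ominus> y \<otimes> (F i \<otimes> (h \<otimes> b))) \<oplus> proj (x \<otimes> a)"
    unfolding eq using c xP aP P_mult by (simp add: minus_eq m_assoc a_ac)
  then show ?case using 1 2 subspD(3)[OF subsp_below] by metis
qed

lemma matched_proj_self:
  assumes "matched m x y" shows "proj x \<ominus> y \<in> below m"
proof -
  have "x \<in> carrier M" "y \<in> carrier M"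
    using matched_mons[OF assms] G.mons_carrier mons_carrier by auto
  then show ?thesis using matched_proj[OF assms, of \<one> 0] one_mons mons_below[of 0 1] by auto
qed

text \<open>Up to lower degree the projection commutes with right multiplication by undeformed
  elements. This becomes the defining estimate of a star product. Both sides are compared with y b,
  where y is matched with x.\<close>

lemma filtered_proj:
  assumes "x \<in> G.below (Suc m)" "b \<in> below (Suc l)"
  shows "proj (x \<otimes> b) \<ominus> proj x \<otimes> b \<in> below (m + l)"
proof -
  have c: "(\<Union>r\<in>{..<Suc m}. G.mons r) \<subseteq> carrier M" using G.mons_carrier by blast
  have b: "b \<in> P" "b \<in> carrier M" using assms below_P below_carrier by auto
  have xP: "x \<in> P" if "x \<in> G.below r" for x r using that G.below_gen_alg G_gen_alg_P by blast
  show ?thesis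
    using assms(1)[unfolded G.below_def] c
  proof (induction rule: alg_span_induct)
    case zero
    then show ?case using b subspD(2)[OF subsp_below] proj_self[OF subspD(2)[OF subsp_gen_alg]]
      by (simp add: minus_eq)
  next
    case (add x y)
    note xy = xP[unfolded G.below_def, OF add(1)] xP[unfolded G.below_def, OF add(2)]
    have "proj ((x \<oplus> y) \<otimes> b) \<ominus> proj (x \<oplus> y) \<otimes> b
      = (proj (x \<otimes> b) \<ominus> proj x \<otimes> b) \<oplus> (proj (y \<otimes> b) \<ominus> proj y \<otimes> b)"
      using xy b P_carrier P_mult by (simp add: l_distr proj_add diff_diff_add)
    then show ?case using add subspD(3)[OF subsp_below] by metis
  next
    case (smult a x)
    note x = xP[unfolded G.below_def, OF smult(1)]
    have "proj ((a \<odot> x) \<otimes> b) \<ominus> proj (a \<odot> x) \<otimes> b = a \<odot> (proj (x \<otimes> b) \<ominus> proj x \<otimes> b)"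
      using x b P_carrier P_mult by (simp add: smult_mult_left proj_smult smult_diff)
    then show ?case using smult subspD(4)[OF subsp_below] by metis
  next
    case (base x)
    then obtain r where r: "r \<le> m" "x \<in> G.mons r" using less_Suc_eq_le by blast
    then obtain y where y: "matched r x y" using matched_left by blast
    have x: "x \<in> P" using r G.mons_gen_alg G_gen_alg_P by blast
    have cy: "y \<in> carrier M" using matched_mons[OF y] mons_carrier by auto
    have "(proj x \<ominus> y) \<otimes> b \<in> below (r + l)"
      by (rule below_mult[OF matched_proj_self[OF y] assms(2)])
    moreover have "proj (x \<otimes> b) \<ominus> y \<otimes> b \<in> below (r + l)" by (rule matched_proj[OF y assms(2)])
    moreover have "proj (x \<otimes> b) \<ominus> proj x \<otimes> b = (proj (x \<otimes> b) \<ominus> y \<otimes> b) \<ominus> (proj x \<ominus> y) \<otimes> b"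
      using x b P_carrier P_mult cy
      by (simp add: diff_distrib_left diff_diff_cancel_right)
    ultimately show ?case using subsp_diff[OF subsp_below] below_mono[of "r + l" "m + l"] r(1) by auto
  qed
qed

text \<open>The preimage stays in the same filtration step, which is more than surjectivity and is
  used for the degree estimate of the star product.\<close>

lemma proj_surj: "a \<in> below k \<Longrightarrow> \<exists>x\<in>G.below k. proj x = a"
proof (induction k arbitrary: a)
  case 0
  then show ?case using below_0 G.below_0 proj_self[OF subspD(2)[OF subsp_gen_alg]] by auto
next
  case (Suc k)
  have GP: "G.below r \<subseteq> P" for r using G.below_gen_alg G_gen_alg_P by blast
  let ?W = "proj ` G.below (Suc k)"
  have W: "subsp ?W"
  proof (rule subspI)
    show "?W \<subseteq> carrier M" using GP by (blast intro: proj_carrier)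
    show "\<zero> \<in> ?W"
      using subspD(2)[OF G.subsp_below] proj_self[OF subspD(2)[OF subsp_gen_alg]] by (metis imageI)
    show "x \<oplus> y \<in> ?W" if xy: "x \<in> ?W" "y \<in> ?W" for x y
    proof -
      obtain u v where uv: "x = proj u" "y = proj v" "u \<in> G.below (Suc k)" "v \<in> G.below (Suc k)"
        using xy by blast
      then have "x \<oplus> y = proj (u \<oplus> v)" by (simp add: proj_add subsetD[OF GP])
      then show ?thesis using subspD(3)[OF G.subsp_below uv(3,4)] by blast
    qed
    show "s \<odot> x \<in> ?W" if xW: "x \<in> ?W" for s x
    proof -
      obtain u where u: "x = proj u" "u \<in> G.below (Suc k)" using xW by blast
      then have "s \<odot> x = proj (s \<odot> u)" by (simp add: proj_smult subsetD[OF GP])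
      then show ?thesis using subspD(4)[OF G.subsp_below u(2)] by blast
    qed
  qed
  have "y \<in> ?W" if y: "y \<in> mons r" "r < Suc k" for y r
  proof (cases "r = k")
    case True
    then obtain x where x: "matched k x y" using y matched_right by blast
    have xm: "x \<in> G.mons k" and ym: "y \<in> carrier M" using matched_mons[OF x] mons_carrier by auto
    \<comment> \<open>The matched deformed monomial x hits y up to an error of lower degree. By
      induction that error is the projection of some z, so x minus z hits y exactly.\<close>
    obtain z where z: "z \<in> G.below k" "proj z = proj x \<ominus> y"
      using Suc.IH[OF matched_proj_self[OF x]] by blast
    have "x \<in> G.below (Suc k)" "z \<in> G.below (Suc k)"
      using xm z G.mons_below[of k "Suc k"] G.below_mono[of k "Suc k"] by auto
    moreover have "proj (x \<ominus> z) = y"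
      using proj_minus[of x z] calculation GP z(2) diff_diff_cancel[of "proj x" y] ym by (simp add: subset_iff)
    ultimately show ?thesis using subsp_diff[OF G.subsp_below] by (metis imageI)
  next
    case False
    then have "y \<in> below k" using y mons_below[of r k] by auto
    then show ?thesis using Suc.IH[of y] G.below_mono[of k "Suc k"] by auto
  qed
  then have "below (Suc k) \<subseteq> ?W" unfolding below_def by (intro alg_span_least[OF W]) auto
  then show ?case using Suc.prems by blast
qed

end

section \<open>The graded isomorphism, bijectivity of the projection, and the transported
  product\<close>

locale pbw_deformation = deformation M H F G P C
  for M :: "('k::field, 'a) module" (structure) and H and F G :: "'i \<Rightarrow> 'a" and P C +
  fixes \<phi> :: "(nat \<Rightarrow> 'a set) \<Rightarrow> 'a"
  assumes phi_iso: "\<phi> \<in> alg_iso (gr (M\<lparr>carrier := subalg M (H \<union> range G)\<rparr>) (filtered_part M H (range G)))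
      (M\<lparr>carrier := subalg M (H \<union> range F)\<rparr>)"
    and phi_gen: "\<phi> (gr_class (M\<lparr>carrier := subalg M (H \<union> range G)\<rparr>) (filtered_part M H (range G)) 1 (G i)) = F i"
    and phi_H: "h \<in> H \<Longrightarrow>
      \<phi> (gr_class (M\<lparr>carrier := subalg M (H \<union> range G)\<rparr>) (filtered_part M H (range G)) 0 h) = h"
begin

abbreviation "N \<equiv> M\<lparr>carrier := G.gen_alg\<rparr>"
abbreviation "Fil \<equiv> filtered_part M H (range G)"

interpretation N: filtered_algebra N Fil
  by (rule G.filtered_algebra_below)

lemma phi_mult:
  "\<lbrakk>x \<in> carrier (gr N Fil); y \<in> carrier (gr N Fil)\<rbrakk> \<Longrightarrow> \<phi> (x \<otimes>\<^bsub>gr N Fil\<^esub> y) = \<phi> x \<otimes> \<phi> y"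
  and phi_add:
  "\<lbrakk>x \<in> carrier (gr N Fil); y \<in> carrier (gr N Fil)\<rbrakk> \<Longrightarrow> \<phi> (x \<oplus>\<^bsub>gr N Fil\<^esub> y) = \<phi> x \<oplus> \<phi> y"
  and phi_smult: "x \<in> carrier (gr N Fil) \<Longrightarrow> \<phi> (a \<odot>\<^bsub>gr N Fil\<^esub> x) = a \<odot> \<phi> x"
  and phi_closed: "x \<in> carrier (gr N Fil) \<Longrightarrow> \<phi> x \<in> gen_alg"
  and phi_inj: "inj_on \<phi> (carrier (gr N Fil))"
  using phi_iso by (auto simp: alg_iso_def alg_hom_def linear_on_def ring_hom_def bij_betw_def)

lemma gr_zero_closed: "\<zero>\<^bsub>gr N Fil\<^esub> \<in> carrier (gr N Fil)"
  using N.gr_class_closed[of \<zero> 0] N.gr_class_eq_zero_iff[of \<zero> 0] N.subspD(2)[OF N.subsp_Fil]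
    N.subspD(2)[OF N.subsp_Fb] by simp

text \<open>Ring laws for \<open>gr\<close> are not established, so this is derived from additivity
  and the fact that its zero is idempotent under addition.\<close>

lemma phi_zero: "\<phi> \<zero>\<^bsub>gr N Fil\<^esub> = \<zero>"
proof -
  have "\<phi> \<zero>\<^bsub>gr N Fil\<^esub> = \<phi> \<zero>\<^bsub>gr N Fil\<^esub> \<oplus> \<phi> \<zero>\<^bsub>gr N Fil\<^esub>"
    using phi_add[OF gr_zero_closed gr_zero_closed] by (simp add: N.gr_zero_add)
  moreover have "\<phi> \<zero>\<^bsub>gr N Fil\<^esub> \<in> carrier M"
    using phi_closed[OF gr_zero_closed] gen_alg_carrier by blast
  ultimately show ?thesis by (metis add.r_cancel_one')
qed

lemma Fil_eq: "Fil m = G.below (Suc m)"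
  by (rule G.filtered_part_eq)

lemma matched_phi: "matched m x y \<Longrightarrow> \<phi> (gr_class N Fil m x) = y"
proof (induction rule: matched.induct)
  case (matched_Suc m x y h i)
  have "x \<in> G.mons m" using matched_mons[OF matched_Suc.hyps(1)] by blast
  then have x: "x \<in> Fil m" using G.mons_below[of m "Suc m"] by (auto simp: Fil_eq)
  have g: "G i \<in> Fil 1" using G.F_mons G.mons_below[of 1 2] by (auto simp: Fil_eq numeral_2_eq_2)
  have h: "h \<in> Fil 0" using G.mons_below[of 0 1] matched_Suc.hyps by (auto simp: Fil_eq)
  have xg: "x \<otimes> G i \<in> Fil (m + 1)" using N.Fil_mult[OF x g] by simp
  have "gr_class N Fil (Suc m) (x \<otimes> G i \<otimes> h)
    = (gr_class N Fil m x \<otimes>\<^bsub>gr N Fil\<^esub> gr_class N Fil 1 (G i)) \<otimes>\<^bsub>gr N Fil\<^esub> gr_class N Fil 0 h"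
    using N.gr_class_mult[OF x g] N.gr_class_mult[OF xg h] by simp
  moreover have "gr_class N Fil m x \<otimes>\<^bsub>gr N Fil\<^esub> gr_class N Fil 1 (G i) \<in> carrier (gr N Fil)"
    using N.gr_class_mult[OF x g] N.gr_class_closed[OF xg] by simp
  ultimately show ?case
    using phi_mult N.gr_class_closed x g h phi_gen phi_H matched_Suc by (simp add: phi_mult)
qed (simp add: phi_H)

text \<open>On the m-th filtration step, \<open>\<phi>\<close> of the class is the leading term of
  the projection. Both are linear in x, so monomials suffice. For length m the matched monomial is
  the value of \<open>\<phi>\<close>; for smaller length the class is zero and the projection has
  degree less than m.\<close>

lemma phi_leading:
  assumes "x \<in> Fil m"
  shows "\<phi> (gr_class N Fil m x) \<in> gdeg m \<and> proj x \<ominus> \<phi> (gr_class N Fil m x) \<in> below m"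
proof -
  have c: "(\<Union>r\<in>{..<Suc m}. G.mons r) \<subseteq> carrier M" using G.mons_carrier by blast
  have PF: "x \<in> P" if "x \<in> Fil m" for x using that G.below_gen_alg G_gen_alg_P Fil_eq by blast
  have FE: "alg_span M (\<Union>r\<in>{..<Suc m}. G.mons r) = Fil m" by (simp add: Fil_eq G.below_def)
  show ?thesis
    using assms[folded FE] c
  proof (induction rule: alg_span_induct)
    case zero
    have "gr_class N Fil m \<zero> = \<zero>\<^bsub>gr N Fil\<^esub>"
      using N.gr_class_eq_zero_iff[of \<zero> m] N.subspD(2)[OF N.subsp_Fil] N.subspD(2)[OF N.subsp_Fb] by simp
    then show ?case
      using subspD(2)[OF subsp_gdeg] subspD(2)[OF subsp_below] proj_self[OF subspD(2)[OF subsp_gen_alg]]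
      by (simp add: phi_zero minus_eq)
  next
    case (add x y)
    note xy = add(1,2)[unfolded FE]
    have eq: "\<phi> (gr_class N Fil m (x \<oplus> y)) = \<phi> (gr_class N Fil m x) \<oplus> \<phi> (gr_class N Fil m y)"
      using N.gr_class_add[OF xy] phi_add[OF xy[THEN N.gr_class_closed]] by simp
    have "proj (x \<oplus> y) \<ominus> \<phi> (gr_class N Fil m (x \<oplus> y))
        = (proj x \<ominus> \<phi> (gr_class N Fil m x)) \<oplus> (proj y \<ominus> \<phi> (gr_class N Fil m y))"
      unfolding eq using PF[OF xy(1)] PF[OF xy(2)] gen_alg_carrier phi_closed N.gr_class_closed xy
      by (simp add: proj_add diff_diff_add)
    then show ?case using add(3,4) eq subspD(3)[OF subsp_gdeg] subspD(3)[OF subsp_below] by simp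
  next
    case (smult a x)
    note x = smult(1)[unfolded FE]
    have eq: "\<phi> (gr_class N Fil m (a \<odot> x)) = a \<odot> \<phi> (gr_class N Fil m x)"
      using N.gr_class_smult[OF x, of a] phi_smult[OF N.gr_class_closed[OF x], of a] by simp
    have "proj (a \<odot> x) \<ominus> \<phi> (gr_class N Fil m (a \<odot> x)) = a \<odot> (proj x \<ominus> \<phi> (gr_class N Fil m x))"
      unfolding eq using PF[OF x] gen_alg_carrier phi_closed N.gr_class_closed x
      by (simp add: proj_smult smult_diff)
    then show ?case using smult(2) eq subspD(4)[OF subsp_gdeg] subspD(4)[OF subsp_below] by simp
  next
    case (base x)
    then obtain r where r: "r \<le> m" "x \<in> G.mons r" using less_Suc_eq_le by blast
    then obtain y where y: "matched r x y" using matched_left by blast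
    show ?case
    proof (cases "r = m")
      case True
      then have "y \<in> gdeg m" unfolding graded_part_def
        using matched_mons[OF y] mons_carrier by (auto intro: alg_span_base)
      then show ?thesis using matched_phi[OF y] matched_proj_self[OF y] True by simp
    next
      case False
      then obtain k where k: "m = Suc k" "r \<le> k" using r(1) by (cases m) auto
      then have xk: "x \<in> Fil k" using r G.mons_below[of r "Suc k"] by (auto simp: Fil_eq)
      then have "x \<in> fil_below N Fil m" by (simp add: k fil_below_def)
      moreover have xm: "x \<in> Fil m" using xk N.Fil_Suc[of k] k by blast
      ultimately have z: "\<phi> (gr_class N Fil m x) = \<zero>"
        using N.gr_class_eq_zero_iff[OF xm] phi_zero by simp
      have yc: "y \<in> carrier M" using matched_mons[OF y] mons_carrier by auto
      have xP: "x \<in> P" using PF \<open>x \<in> Fil m\<close> by blast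
      have "proj x \<ominus> y \<in> below m" "y \<in> below m"
        using matched_proj_self[OF y] matched_mons[OF y] below_mono[of r m] mons_below[of r m] k by auto
      moreover have "proj x = (proj x \<ominus> y) \<oplus> y" using xP yc by (simp add: minus_eq a_assoc l_neg)
      ultimately have "proj x \<in> below m" using subspD(3)[OF subsp_below] by metis
      then show ?thesis using z subspD(2)[OF subsp_gdeg] xP by (simp add: minus_eq)
    qed
  qed
qed

text \<open>If the projection of x vanishes, the leading term \<open>\<phi>\<close> of its class is
  both homogeneous of degree m and of degree less than m, hence zero. Injectivity of
  \<open>\<phi>\<close> then puts x one filtration step lower, and the descent ends below step 0,
  which is zero.\<close>

lemma proj_kernel: "x \<in> Fil m \<Longrightarrow> proj x = \<zero> \<Longrightarrow> x = \<zero>"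
proof (induction m)
  have *: "x \<in> fil_below N Fil m" if x: "x \<in> Fil m" "proj x = \<zero>" for x m
  proof -
    let ?p = "\<phi> (gr_class N Fil m x)"
    have p: "?p \<in> gdeg m" "\<zero> \<ominus> ?p \<in> below m" using phi_leading[OF x(1)] x(2) by auto
    have pc: "?p \<in> carrier M" using p(1) subsp_carrier[OF subsp_gdeg] by blast
    then have "?p \<in> below m" using subsp_neg[OF subsp_below p(2)] by (simp add: minus_eq)
    then have "?p = \<zero>" using graded p(1) by blast
    then have "gr_class N Fil m x = \<zero>\<^bsub>gr N Fil\<^esub>"
      using phi_inj phi_zero gr_zero_closed N.gr_class_closed[OF x(1)] by (metis inj_onD)
    then show ?thesis using N.gr_class_eq_zero_iff[OF x(1)] by blast
  qed
  {
    case 0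
    then show ?case using *[of x 0] by (simp add: fil_below_def)
  next
    case (Suc m)
    then show ?case using *[of x "Suc m"] by (simp add: fil_below_def)
  }
qed

lemma proj_bij: "bij_betw proj G.gen_alg gen_alg"
proof -
  have GP: "x \<in> P" if "x \<in> G.gen_alg" for x using that G_gen_alg_P by blast
  have "inj_on proj G.gen_alg"
  proof (rule inj_onI)
    fix x y assume xy: "x \<in> G.gen_alg" "y \<in> G.gen_alg" "proj x = proj y"
    then have "proj (x \<ominus> y) = \<zero>" 
      using GP proj_minus[of x y] diff_eq_zero_iff[of "proj x" "proj y"] by simp
    moreover have "x \<ominus> y \<in> G.gen_alg" using xy subsp_diff[OF G.subsp_gen_alg] by blast
    then obtain m where "x \<ominus> y \<in> G.below m" using G.gen_alg_below by auto
    then have "x \<ominus> y \<in> Fil m" using G.below_mono[of m "Suc m"] by (auto simp: Fil_eq)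
    ultimately have "x \<ominus> y = \<zero>" using proj_kernel by blast
    then show "x = y" using xy G.gen_alg_carrier diff_eq_zero_iff by blast
  qed
  moreover have "proj ` G.gen_alg = gen_alg"
  proof
    show "proj ` G.gen_alg \<subseteq> gen_alg" using GP proj_in by blast
    show "gen_alg \<subseteq> proj ` G.gen_alg"
      using proj_surj gen_alg_below G.gen_alg_below by (auto simp: image_iff) metis
  qed
  ultimately show ?thesis by (simp add: bij_betw_def)
qed

definition lift :: "'a \<Rightarrow> 'a"
  where "lift = inv_into G.gen_alg proj"

definition star :: "'a \<Rightarrow> 'a \<Rightarrow> 'a"
  where "star a b = proj (lift a \<otimes> lift b)"

lemma lift_in: "a \<in> gen_alg \<Longrightarrow> lift a \<in> G.gen_alg"
  and proj_lift: "a \<in> gen_alg \<Longrightarrow> proj (lift a) = a"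
  using proj_bij unfolding lift_def bij_betw_def by (auto intro: inv_into_into f_inv_into_f)

lemma lift_proj: "x \<in> G.gen_alg \<Longrightarrow> lift (proj x) = x"
  using proj_bij unfolding lift_def bij_betw_def by (simp add: inv_into_f_f)

lemma lift_P: "a \<in> gen_alg \<Longrightarrow> lift a \<in> P"
  using lift_in G_gen_alg_P by blast

lemma lift_add:
  assumes "a \<in> gen_alg" "b \<in> gen_alg" shows "lift (a \<oplus> b) = lift a \<oplus> lift b"
proof -
  have "proj (lift a \<oplus> lift b) = a \<oplus> b" using assms by (simp add: proj_add lift_P proj_lift)
  then show ?thesis using lift_proj[of "lift a \<oplus> lift b"] assms lift_in subspD(3)[OF G.subsp_gen_alg] by simp
qed

lemma lift_smult:
  assumes "a \<in> gen_alg" shows "lift (s \<odot> a) = s \<odot> lift a"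
proof -
  have "proj (s \<odot> lift a) = s \<odot> a" using assms by (simp add: proj_smult lift_P proj_lift)
  then show ?thesis using lift_proj[of "s \<odot> lift a"] assms lift_in subspD(4)[OF G.subsp_gen_alg] by simp
qed

text \<open>Only the left factor has to be lifted, because the projection of the right factor may be
  taken inside the product. This asymmetry makes the operators of left star multiplication
  computable.\<close>

lemma star_eq: "\<lbrakk>a \<in> gen_alg; b \<in> gen_alg\<rbrakk> \<Longrightarrow> star a b = proj (lift a \<otimes> b)"
  using proj_mult[of "lift a" "lift b"] by (simp add: star_def lift_P proj_lift)

lemma star_proj: "\<lbrakk>x \<in> G.gen_alg; b \<in> gen_alg\<rbrakk> \<Longrightarrow> star (proj x) b = proj (x \<otimes> b)"
  using star_eq[of "proj x" b] proj_in[of x] G_gen_alg_P lift_proj by auto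

lemma proj_star:
  "\<lbrakk>x \<in> G.gen_alg; y \<in> G.gen_alg\<rbrakk> \<Longrightarrow> proj (x \<otimes> y) = star (proj x) (proj y)"
  by (simp add: star_def lift_proj)

lemma star_in: "\<lbrakk>a \<in> gen_alg; b \<in> gen_alg\<rbrakk> \<Longrightarrow> star a b \<in> gen_alg"
  unfolding star_def by (intro proj_in P_mult lift_P)

lemma star_assoc:
  assumes "a \<in> gen_alg" "b \<in> gen_alg" "d \<in> gen_alg"
  shows "star (star a b) d = star a (star b d)"
proof -
  have l: "lift (star x y) = lift x \<otimes> lift y" if "x \<in> gen_alg" "y \<in> gen_alg" for x y
    unfolding star_def using that lift_in by (intro lift_proj G.gen_alg_mult)
  show ?thesis
    unfolding star_def[of "star a b" d] star_def[of a "star b d"] l[OF assms(1,2)] l[OF assms(2,3)]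
    using assms lift_P P_carrier by (simp add: m_assoc)
qed

lemma star_gen:
  assumes "u \<in> gen_alg" shows "star (F i) u = proj (G i \<otimes> u)"
proof -
  \<comment> \<open>In degree zero the error term lies in \<open>below 0\<close> and vanishes, so
    \<open>G i\<close> projects exactly to \<open>F i\<close>.\<close>
  have "\<one> \<in> gdeg 0" using one_mons gdeg_0 by simp
  from lower[OF this, of i] obtain a where "a \<in> below 0" "(G i \<otimes> \<one>) \<ominus> (F i \<otimes> \<one> \<oplus> a) \<in> C" by blast
  then have "G i \<ominus> F i \<in> C" using below_0 by simp
  then have "proj (G i) = F i" by (intro proj_eqI F_gen_alg) auto
  then show ?thesis using star_proj[OF G.F_gen_alg[of i] assms] by simp
qed

lemma star_product_star: "star_product M gen_alg gdeg star"
  unfolding star_product_def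
proof (intro conjI ballI allI)
  note lc = lift_P[THEN P_carrier]
  fix a assume a: "a \<in> gen_alg"
  show "linear_on M gen_alg M gen_alg (star a)"
    unfolding linear_on_def
    by (intro conjI ballI allI funcsetI star_in[OF a])
      (use a lc in \<open>simp_all add: star_def lift_add lift_smult r_distr smult_mult_right proj_add
        proj_smult P_mult lift_P\<close>)
  show "linear_on M gen_alg M gen_alg (\<lambda>b. star b a)"
    unfolding linear_on_def
    by (intro conjI ballI allI funcsetI star_in a)
      (use a lc in \<open>simp_all add: star_def lift_add lift_smult l_distr smult_mult_left proj_add
        proj_smult P_mult lift_P\<close>)
next
  fix m l a b assume ab: "a \<in> gdeg m" "b \<in> gdeg l"
  then have "a \<in> below (Suc m)" "b \<in> below (Suc l)" using gdeg_below by blast+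
  \<comment> \<open>The preimage comes from \<open>proj_surj\<close>, which places it in filtration
    step m, as \<open>filtered_proj\<close> requires.\<close>
  then obtain x where x: "x \<in> G.below (Suc m)" "proj x = a" using proj_surj by blast
  have "proj (x \<otimes> b) \<ominus> a \<otimes> b \<in> below (m + l)"
    using filtered_proj[OF x(1) \<open>b \<in> below (Suc l)\<close>] x(2) by simp
  then show "star a b \<ominus> a \<otimes> b \<in> alg_span M (\<Union>j\<in>{..<m + l}. gdeg j)"
    using star_proj[OF subsetD[OF G.below_gen_alg x(1)] subsetD[OF gdeg_gen_alg ab(2)]] x(2)
    by (simp flip: below_graded)
qed (rule star_assoc)

lemma proj_H: "h \<in> H \<Longrightarrow> lift h = h"
  using lift_proj[OF subsetD[OF G.H_gen_alg]] proj_self[OF subsetD[OF H_gen_alg]] by simp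

lemma zero_equivariant_star: "zero_equivariant M gen_alg gdeg star"
  unfolding zero_equivariant_def gdeg_0
proof (intro ballI conjI)
  fix h a assume h: "h \<in> H" and a: "a \<in> gen_alg"
  show "star a h = a \<otimes> h" "star h a = h \<otimes> a"
    using star_eq[of a h] star_eq[of h a] h a H_gen_alg proj_H_right[OF lift_P[OF a] h] proj_lift[OF a]
      proj_H[OF h] proj_self[of "h \<otimes> a"] gen_alg_mult by auto
qed

lemma proj_alg_iso:
  "proj \<in> alg_iso (M\<lparr>carrier := G.gen_alg\<rparr>) (M\<lparr>carrier := gen_alg, monoid.mult := star\<rparr>)"
proof -
  have GP: "x \<in> P" if "x \<in> G.gen_alg" for x using that G_gen_alg_P by blast
  have "proj \<one> = \<one>" using proj_self subalgebraD(2)[OF subalgebra_gen_alg] by simp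
  then show ?thesis
    using proj_bij GP
    by (auto simp: alg_iso_def alg_hom_def ring_hom_def linear_on_def proj_star proj_add proj_smult proj_in)
qed

end

section \<open>Uniqueness of the star product\<close>

context generated_algebra
begin

text \<open>V stands for \<open>U_minus\<close>, on which the operators of the \<open>F i\<close>
  are prescribed; together with right multiplication by H it spans the algebra. For a left factor z
  \<open>F i\<close> h, the ordinary product of z and \<open>F i\<close> differs from their star
  product by an element of smaller degree. Associativity then reduces the star multiplication by
  this factor to that by z, by \<open>F i\<close> and by the error.\<close>

lemma star_product_unique:
  assumes s: "star_product M gen_alg gdeg s" "zero_equivariant M gen_alg gdeg s"
    and t: "star_product M gen_alg gdeg t" "zero_equivariant M gen_alg gdeg t"
    and V: "V \<subseteq> gen_alg" "gen_alg \<subseteq> alg_span M {u \<otimes> h | u h. u \<in> V \<and> h \<in> H}"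
    and eq: "\<And>i u. u \<in> V \<Longrightarrow> s (F i) u = t (F i) u"
    and ab: "a \<in> gen_alg" "b \<in> gen_alg"
  shows "s a b = t a b"
proof -
  let ?star = "\<lambda>s. star_product M gen_alg gdeg s \<and> zero_equivariant M gen_alg gdeg s"
  have st: "?star s" "?star t" using s t by auto
  \<comment> \<open>These facts share one list of membership assumptions. An instance must also fill
    the variables that it does not mention, and \<open>zero\<close> serves as the filler.\<close>
  have closed: "r a b \<in> gen_alg" and rad: "r a (b \<oplus> b') = r a b \<oplus> r a b'"
    and rsm: "r a (k \<odot> b) = k \<odot> r a b"
    and lad: "r (a \<oplus> a') b = r a b \<oplus> r a' b" and lsm: "r (k \<odot> a) b = k \<odot> r a b"
    and assoc: "r (r a b) d = r a (r b d)"
    and low: "x \<in> gdeg m \<Longrightarrow> y \<in> gdeg l \<Longrightarrow> r x y \<ominus> x \<otimes> y \<in> below (m + l)"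
    if "?star r" "a \<in> gen_alg" "a' \<in> gen_alg" "b \<in> gen_alg" "b' \<in> gen_alg" "d \<in> gen_alg"
    for r a a' b b' d k x y m l
    using that by (auto simp: star_product_def linear_on_def below_graded)
  have H: "r a h = a \<otimes> h" "r h a = h \<otimes> a" if "?star r" "h \<in> H" "a \<in> gen_alg" for r a h
    using that by (auto simp: zero_equivariant_def gdeg_0)
  have zero: "\<zero> \<in> gen_alg" by (rule subspD(2)[OF subsp_gen_alg])
  have lz: "r \<zero> b = \<zero>" and rz: "r b \<zero> = \<zero>" if "?star r" "b \<in> gen_alg" for r b
    using that lsm[OF that(1) zero zero that(2) zero zero, of 0]
      rsm[OF that(1) that(2) zero zero zero zero, of 0] closed[OF that(1), of \<zero> _ b]
      closed[OF that(1), of b _ \<zero>] zero gen_alg_carrier by auto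
  have VH: "{u \<otimes> h | u h. u \<in> V \<and> h \<in> H} \<subseteq> carrier M"
    using V(1) H_carrier gen_alg_carrier by auto
  have VHg: "alg_span M {u \<otimes> h | u h. u \<in> V \<and> h \<in> H} \<subseteq> gen_alg"
    using V(1) H_gen_alg gen_alg_mult by (intro alg_span_least[OF subsp_gen_alg]) auto
  \<comment> \<open>The agreement extends from V to all b: for h in H the product u h is also the
    star product of u and h, so by associativity h can be moved out of the argument of
    \<open>F i\<close>.\<close>
  have gen: "s (F i) b = t (F i) b" if "b \<in> gen_alg" for i b
    using subsetD[OF V(2) that] VH
  proof (induction rule: alg_span_induct)
    case zero
    show ?case using rz[OF st(1) F_gen_alg[of i]] rz[OF st(2) F_gen_alg[of i]] by simp
  next
    case (add x y)
    then have xy: "x \<in> gen_alg" "y \<in> gen_alg" using VHg by auto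
    show ?case
      using rad[OF st(1) F_gen_alg zero xy zero, of i] rad[OF st(2) F_gen_alg zero xy zero, of i] add
      by simp
  next
    case (smult k x)
    then have x: "x \<in> gen_alg" using VHg by auto
    show ?case
      using rsm[OF st(1) F_gen_alg zero x zero zero, of i k] rsm[OF st(2) F_gen_alg zero x zero zero, of i k]
        smult by simp
  next
    case (base x)
    then obtain u h where x: "x = u \<otimes> h" "u \<in> V" "h \<in> H" by blast
    have "r (F i) x = r (F i) u \<otimes> h" if "?star r" for r
    proof -
      have u: "u \<in> gen_alg" "h \<in> gen_alg" using x V H_gen_alg by auto
      have "r (F i) x = r (F i) (r u h)" using H[OF that x(3) u(1)] x(1) by simp
      also have "\<dots> = r (r (F i) u) h" using assoc[OF that F_gen_alg zero u(1) zero u(2)] by simp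
      finally show ?thesis
        using H(1)[OF that x(3) closed[OF that F_gen_alg zero u(1) zero zero]] by simp
    qed
    from this[OF st(1)] this[OF st(2)] show ?case using eq[OF x(2)] by simp
  qed
  have "\<forall>a\<in>below m. \<forall>b\<in>gen_alg. s a b = t a b" for m
  proof (induction m)
    case 0
    then show ?case using lz[OF st(1)] lz[OF st(2)] by (simp add: below_0)
  next
    case (Suc m)
    let ?W = "{a \<in> gen_alg. \<forall>b\<in>gen_alg. s a b = t a b}"
    have W: "subsp ?W"
    proof (rule subspI)
      show "\<zero> \<in> ?W" using lz[OF st(1)] lz[OF st(2)] zero by simp
      show "x \<oplus> y \<in> ?W" if "x \<in> ?W" "y \<in> ?W" for x y
        using that lad[OF st(1), of x y] lad[OF st(2), of x y] subspD(3)[OF subsp_gen_alg] by auto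
      show "k \<odot> x \<in> ?W" if "x \<in> ?W" for k x
        using that lsm[OF st(1), of x] lsm[OF st(2), of x] subspD(4)[OF subsp_gen_alg] by auto
    qed (use gen_alg_carrier in auto)
    have "y \<in> ?W" if y: "y \<in> mons m" for y
    proof (cases m)
      case 0
      then show ?thesis using y H(2)[OF st(1)] H(2)[OF st(2)] H_gen_alg by auto
    next
      case (Suc n)
      then obtain z i h where z: "y = z \<otimes> F i \<otimes> h" "z \<in> mons n" "h \<in> H" using y by auto
      have zg: "z \<in> gen_alg" "h \<in> gen_alg" "z \<otimes> F i \<in> gen_alg"
        using z mons_gen_alg H_gen_alg F_gen_alg gen_alg_mult by blast+
      have zb: "z \<in> below m" using z mons_below[of n m] Suc by auto
      \<comment> \<open>Since z has smaller degree, both products agree here, and the correction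
        term \<open>?l\<close> below is the same for both.\<close>
      have zF: "s z (F i) = t z (F i)" using Suc.IH zb F_gen_alg by blast
      have "z \<in> gdeg n" "F i \<in> gdeg 1"
        unfolding graded_part_def
        using alg_span_base[OF mons_carrier z(2)] alg_span_base[OF mons_carrier F_mons] by simp_all
      then have l: "s z (F i) \<ominus> z \<otimes> F i \<in> below m"
        using low[OF st(1) zero zero zero zero zero, of z n "F i" 1] Suc by simp
      let ?l = "s z (F i) \<ominus> z \<otimes> F i"
      have sg: "s z (F i) \<in> gen_alg" using closed[OF st(1)] zg F_gen_alg zero by blast
      have lg: "\<ominus> ?l \<in> gen_alg" "\<ominus> ?l \<in> below m"
        using l below_gen_alg subsp_neg[OF subsp_below] by auto
      have eq1: "z \<otimes> F i = s z (F i) \<oplus> \<ominus> ?l"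
        using zg sg gen_alg_carrier diff_diff_cancel[of "s z (F i)" "z \<otimes> F i"] by (simp add: minus_eq)
      have "r y b = r z (r (F i) (h \<otimes> b)) \<oplus> r (\<ominus> ?l) (h \<otimes> b)"
        if r: "?star r" "r z (F i) = s z (F i)" and b: "b \<in> gen_alg" for r b
      proof -
        have hb: "h \<otimes> b \<in> gen_alg" using zg b gen_alg_mult by blast
        have "r y b = r (r (z \<otimes> F i) h) b" using H(1)[OF r(1) z(3) zg(3)] z(1) by simp
        also have "\<dots> = r (z \<otimes> F i) (h \<otimes> b)"
          using assoc[OF r(1) zg(3) zero zg(2) zero b] H(2)[OF r(1) z(3) b] by simp
        also have "\<dots> = r (s z (F i)) (h \<otimes> b) \<oplus> r (\<ominus> ?l) (h \<otimes> b)"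
          using lad[OF r(1) sg lg(1) hb zero zero] eq1 by metis
        also have "r (s z (F i)) (h \<otimes> b) = r z (r (F i) (h \<otimes> b))"
          using assoc[OF r(1) zg(1) zero F_gen_alg zero hb] r(2) by metis
        finally show ?thesis .
      qed
      moreover have "s z (s (F i) (h \<otimes> b)) = t z (t (F i) (h \<otimes> b))" if "b \<in> gen_alg" for b
        using gen[OF gen_alg_mult[OF zg(2) that]] Suc.IH zb closed[OF st(1)] F_gen_alg zg zero
          gen_alg_mult[OF zg(2) that] by metis
      moreover have "s (\<ominus> ?l) (h \<otimes> b) = t (\<ominus> ?l) (h \<otimes> b)" if "b \<in> gen_alg" for b
        using Suc.IH lg(2) gen_alg_mult[OF zg(2) that] by blast
      ultimately have "s y b = t y b" if "b \<in> gen_alg" for b using st zF that by metis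
      then show ?thesis using y mons_gen_alg by blast
    qed
    moreover have "mons r \<subseteq> ?W" if "r < m" for r
      using mons_below[OF that] mons_gen_alg Suc.IH by blast
    ultimately have "mons r \<subseteq> ?W" if "r < Suc m" for r
      using that less_antisym by blast
    then have "(\<Union>r\<in>{..<Suc m}. mons r) \<subseteq> ?W" by blast
    then have "below (Suc m) \<subseteq> ?W"
      unfolding below_def[of "Suc m"] by (intro alg_span_least[OF W])
    then show ?case by blast
  qed
  then show ?thesis using ab gen_alg_below by auto
qed

end

section \<open>Free algebras\<close>

lemma ring_ring_of_type_algebra: "ring (ring_of_type_algebra :: 'a::ring_1 ring)"
proof -
  have "\<exists>y. x + y = 0" for x :: 'a
    using add.right_inverse by blast
  then show ?thesis
    unfolding ring_of_type_algebra_def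
    by unfold_locales (auto simp: algebra_simps Units_def add_eq_0_iff)
qed

lemma type_algebra_simps [simp]:
  "carrier ring_of_type_algebra = UNIV"
  "monoid.mult ring_of_type_algebra x y = x * y"
  "one ring_of_type_algebra = 1"
  "ring.zero ring_of_type_algebra = 0"
  "add ring_of_type_algebra x y = x + y"
  for x y :: "'a::ring_1"
  by (simp_all add: ring_of_type_algebra_def)

lemma single_mult_single [simp]:
  "Poly_Mapping.single u a * Poly_Mapping.single v b = Poly_Mapping.single (u @ v) (a * b :: 'k::field)"
  by (simp add: mult_single plus_list_def)

lemma one_eq_single: "1 = Poly_Mapping.single [] (1::'k::field)"
  by (metis single_one zero_list_def)

lemma scal_one [simp]: "scal 1 = 1"
  by (simp add: scal_def one_eq_single)

lemma scal_zero [simp]: "scal 0 = 0"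
  by (simp add: scal_def)

lemma scal_add: "scal (a + b) = scal a + scal b"
  by (simp add: scal_def single_add)

lemma scal_minus: "scal (- a) = - scal a"
  by (simp add: scal_def single_uminus)

lemma scal_mult_scal [simp]: "scal a * scal b = scal (a * b)"
  by (simp add: scal_def)

lemma scal_mult_scal_left [simp]: "scal a * (scal b * x) = scal (a * b) * x"
  by (simp flip: mult.assoc)

lemma scal_mult_single [simp]: "scal a * Poly_Mapping.single w b = Poly_Mapping.single w (a * b)"
  by (simp add: scal_def)

lemma lookup_scal_mult [simp]: "Poly_Mapping.lookup (scal a * x) w = a * Poly_Mapping.lookup x w"
  by (simp add: scal_def Poly_Mapping.map.rep_eq when_def
      flip: zero_list_def mult_map_scale_conv_mult)

lemma single_eq_scal: "Poly_Mapping.single w a = scal a * Poly_Mapping.single w 1"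
  by simp

lemma free_induct [case_names zero add single]:
  assumes "P 0" "\<And>x y. P x \<Longrightarrow> P y \<Longrightarrow> P (x + y)"
    and "\<And>w a. P (Poly_Mapping.single w a)"
  shows "P (x :: 'w \<Rightarrow>\<^sub>0 'k::ab_group_add)"
proof -
  have "P (\<Sum>w\<in>S. Poly_Mapping.single w (Poly_Mapping.lookup x w))" if "finite S" for S
    using that by (induction S) (use assms in auto)
  moreover have "x = (\<Sum>w\<in>Poly_Mapping.keys x. Poly_Mapping.single w (Poly_Mapping.lookup x w))"
    by (rule poly_mapping_eqI)
      (auto simp: lookup_sum lookup_single when_def in_keys_iff)
  ultimately show ?thesis by (metis finite_keys)
qed

lemma scal_commute: "x * scal a = scal a * (x :: 'g list \<Rightarrow>\<^sub>0 'k::field)"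
  by (induction x rule: free_induct) (simp_all add: algebra_simps, simp add: scal_def)

lemma scal_commute_left: "x * (scal a * y) = scal a * (x * (y :: 'g list \<Rightarrow>\<^sub>0 'k::field))"
  by (metis mult.assoc scal_commute)

subsection \<open>Linear maps between free algebras\<close>

definition lin :: "('w \<Rightarrow> ('g list \<Rightarrow>\<^sub>0 'k)) \<Rightarrow> ('w \<Rightarrow>\<^sub>0 'k) \<Rightarrow> ('g list \<Rightarrow>\<^sub>0 'k::field)"
  where "lin f x = (\<Sum>w\<in>Poly_Mapping.keys x. scal (Poly_Mapping.lookup x w) * f w)"

lemma lin_superset:
  assumes "finite S" "Poly_Mapping.keys x \<subseteq> S"
  shows "lin f x = (\<Sum>w\<in>S. scal (Poly_Mapping.lookup x w) * f w)"
  unfolding lin_def by (rule sum.mono_neutral_left) (use assms in \<open>auto simp: in_keys_iff\<close>)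

lemma lin_add: "lin f (x + y) = lin f x + lin f y"
proof -
  let ?S = "Poly_Mapping.keys x \<union> Poly_Mapping.keys y"
  have "lin f z = (\<Sum>w\<in>?S. scal (Poly_Mapping.lookup z w) * f w)" if "z \<in> {x, y, x + y}" for z
    by (rule lin_superset) (use that keys_add[of x y] in auto)
  then show ?thesis by (simp add: lookup_add scal_add distrib_right sum.distrib)
qed

lemma lin_zero [simp]: "lin f 0 = 0"
  by (simp add: lin_def)

lemma lin_single [simp]: "lin f (Poly_Mapping.single w a) = scal a * f w"
  by (cases "a = 0") (simp_all add: lin_def)

lemma lin_scal: "lin f (scal a * x) = scal a * lin f x"
  by (induction x rule: free_induct) (simp_all add: lin_add distrib_left)

lemma lin_minus: "lin f (- x) = - lin f x"
  using lin_add[of f x "- x"] by (simp add: add_eq_0_iff)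

lemma lin_diff: "lin f (x - y) = lin f x - lin f y"
  using lin_add[of f x "- y"] by (simp add: lin_minus)

lemma map_gens_eq_lin: "map_gens f x = lin (\<lambda>w. Poly_Mapping.single (map f w) 1) x"
  by (simp add: map_gens_def lin_def)

lemma map_gens_single [simp]: "map_gens f (Poly_Mapping.single w a) = Poly_Mapping.single (map f w) a"
  by (simp add: map_gens_eq_lin)

lemma map_gens_add: "map_gens f (x + y) = map_gens f x + map_gens f y"
  by (simp add: map_gens_eq_lin lin_add)

lemma map_gens_zero [simp]: "map_gens f 0 = 0"
  by (simp add: map_gens_eq_lin)

lemma map_gens_scal: "map_gens f (scal a * x) = scal a * map_gens f x"
  by (simp add: map_gens_eq_lin lin_scal)

lemma map_gens_scal_const [simp]: "map_gens f (scal a) = scal a"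
  by (simp add: scal_def)

lemma map_gens_diff: "map_gens f (x - y) = map_gens f x - map_gens f y"
  by (simp add: map_gens_eq_lin lin_diff)

lemma map_gens_mult: "map_gens f (x * y) = map_gens f x * map_gens f y"
proof (induction x rule: free_induct)
  case (single w a)
  show ?case by (induction y rule: free_induct) (simp_all add: map_gens_add distrib_left)
qed (simp_all add: map_gens_add distrib_right)

lemma map_gens_comp: "map_gens f (map_gens g x) = map_gens (f \<circ> g) x"
  by (induction x rule: free_induct) (simp_all add: map_gens_add comp_def)

lemma map_gens_one [simp]: "map_gens f 1 = 1"
  by (simp add: one_eq_single)

subsection \<open>Twists and skew derivations\<close>

definition tw :: "('i \<Rightarrow> 'k) \<Rightarrow> ('i list \<Rightarrow>\<^sub>0 'k) \<Rightarrow> ('i list \<Rightarrow>\<^sub>0 'k::field)"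
  where "tw s = lin (\<lambda>w. Poly_Mapping.single w (prod_list (map s w)))"

lemma tw_single [simp]: "tw s (Poly_Mapping.single w a) = Poly_Mapping.single w (a * prod_list (map s w))"
  by (simp add: tw_def)

lemmas tw_add = lin_add[of "\<lambda>w. Poly_Mapping.single w (prod_list (map s w))" for s, folded tw_def]
lemmas tw_scal = lin_scal[of "\<lambda>w. Poly_Mapping.single w (prod_list (map s w))" for s, folded tw_def]
lemmas tw_diff = lin_diff[of "\<lambda>w. Poly_Mapping.single w (prod_list (map s w))" for s, folded tw_def]

lemma tw_zero [simp]: "tw s 0 = 0"
  by (simp add: tw_def)

lemma tw_scal_const [simp]: "tw s (scal a) = scal a"
  by (simp add: scal_def)

lemma tw_one [simp]: "tw s 1 = 1"
  by (simp add: one_eq_single)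

lemma tw_mult: "tw s (x * y) = tw s x * tw s y"
proof (induction x rule: free_induct)
  case (single w a)
  show ?case by (induction y rule: free_induct) (simp_all add: tw_add distrib_left mult_ac)
qed (simp_all add: tw_add distrib_right)

lemma tw_gen: "tw s (gen i) = scal (s i) * gen i"
  by (simp add: gen_def)

lemma tw_tw: "tw s (tw t x) = tw (\<lambda>i. s i * t i) x"
proof -
  have "prod_list (map (\<lambda>i. s i * t i) w) = prod_list (map s w) * prod_list (map t w)" for w
    by (induction w) (simp_all add: mult_ac)
  then show ?thesis by (induction x rule: free_induct) (simp_all add: tw_add mult_ac)
qed

lemma tw_const_one: "tw (\<lambda>i. 1) x = x"
proof -
  have "prod_list (map (\<lambda>i. 1) w) = (1::'b)" for w :: "'a list" by (induction w) auto
  then show ?thesis by (induction x rule: free_induct) (simp_all add: tw_add)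
qed

text \<open>Each occurrence of i in the word is deleted in turn, with weight the product of s over
  the letters to its left.\<close>

primrec skew_word :: "('i \<Rightarrow> 'k) \<Rightarrow> 'i \<Rightarrow> 'i list \<Rightarrow> ('i list \<Rightarrow>\<^sub>0 'k::field)"
  where
    "skew_word s i [] = 0"
  | "skew_word s i (j # w) =
      scal (s j) * (gen j * skew_word s i w) + (if i = j then Poly_Mapping.single w 1 else 0)"

definition skew :: "('i \<Rightarrow> 'k) \<Rightarrow> 'i \<Rightarrow> ('i list \<Rightarrow>\<^sub>0 'k) \<Rightarrow> ('i list \<Rightarrow>\<^sub>0 'k::field)"
  where "skew s i = lin (skew_word s i)"

lemma skew_single [simp]: "skew s i (Poly_Mapping.single w a) = scal a * skew_word s i w"
  by (simp add: skew_def)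

lemmas skew_add = lin_add[of "skew_word s i" for s i, folded skew_def]
lemmas skew_scal = lin_scal[of "skew_word s i" for s i, folded skew_def]
lemmas skew_diff = lin_diff[of "skew_word s i" for s i, folded skew_def]

lemma skew_zero [simp]: "skew s i 0 = 0"
  by (simp add: skew_def)

lemma skew_one [simp]: "skew s i 1 = 0"
  by (simp add: one_eq_single)

lemma skew_gen_mult:
  "skew s i (gen j * x) = scal (s j) * (gen j * skew s i x) + (if i = j then x else 0)"
proof (induction x rule: free_induct)
  case (single w a)
  have "gen j * Poly_Mapping.single w a = Poly_Mapping.single (j # w) a" by (simp add: gen_def)
  then show ?case by (simp add: distrib_left scal_commute_left[of "gen j"] mult.commute)
qed (simp_all add: skew_add distrib_left)

lemma skew_word_length:
  "v \<in> Poly_Mapping.keys (skew_word s i w) \<Longrightarrow> Suc (length v) = length w"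
proof (induction w arbitrary: v)
  case (Cons j w)
  have "v \<in> Poly_Mapping.keys (scal (s j) * (gen j * skew_word s i w)) \<union> {w}"
    using subsetD[OF keys_add Cons.prems[unfolded skew_word.simps]] by (auto split: if_splits)
  moreover have "Suc (length v) = length (j # w)"
    if "v \<in> Poly_Mapping.keys (scal (s j) * (gen j * skew_word s i w))"
  proof -
    have "v \<in> Poly_Mapping.keys (gen j * skew_word s i w)"
      using that by (simp add: in_keys_iff)
    then obtain u where "v = [j] @ u" "u \<in> Poly_Mapping.keys (skew_word s i w)"
      using keys_mult[of "gen j" "skew_word s i w"] by (auto simp: gen_def plus_list_def split: if_splits)
    then show ?thesis using Cons.IH by auto
  qed
  ultimately show ?case by auto
qed simp

section \<open>Pre-Nichols ideals\<close>

lemma lookup_lin_diag: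
  "Poly_Mapping.lookup (lin (\<lambda>w. Poly_Mapping.single w (g w)) x) w = g w * Poly_Mapping.lookup x w"
  by (induction x rule: free_induct)
    (auto simp: lin_add lookup_add distrib_left lookup_single when_def)

lemma lookup_tensor:
  "Poly_Mapping.lookup (tensor x y) (u, v) = Poly_Mapping.lookup x u * Poly_Mapping.lookup y v"
proof -
  have "Poly_Mapping.lookup (tensor x y) (u, v) =
    (\<Sum>u'\<in>Poly_Mapping.keys x. \<Sum>v'\<in>Poly_Mapping.keys y.
      if u' = u \<and> v' = v then Poly_Mapping.lookup x u * Poly_Mapping.lookup y v else 0)"
    by (auto simp: tensor_def lookup_sum lookup_single when_def intro!: sum.cong)
  also have "\<dots> = (\<Sum>u'\<in>Poly_Mapping.keys x. if u' = u then
      (if v \<in> Poly_Mapping.keys y then Poly_Mapping.lookup x u * Poly_Mapping.lookup y v else 0) else 0)"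
    by (intro sum.cong) (auto simp: sum.delta')
  also have "\<dots> = Poly_Mapping.lookup x u * Poly_Mapping.lookup y v"
    by (auto simp: sum.delta' in_keys_iff)
  finally show ?thesis .
qed

lemma lookup_scale2: "Poly_Mapping.lookup (scale2 a x) p = a * Poly_Mapping.lookup x p"
  by (simp add: scale2_def Poly_Mapping.map.rep_eq when_def)

lemma vector_space_scale2: "vector_space scale2"
  by unfold_locales (auto intro!: poly_mapping_eqI simp: lookup_scale2 lookup_add algebra_simps)

text \<open>The functional dual to the word [i] is applied to the left leg;
  \<open>contract_right\<close> does the same on the right leg.\<close>

definition contract_left :: "'i \<Rightarrow> ('i list \<times> 'i list \<Rightarrow>\<^sub>0 'k) \<Rightarrow> ('i list \<Rightarrow>\<^sub>0 'k::field)"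
  where "contract_left i = Poly_Mapping.map_key (\<lambda>v. ([i], v))"

definition contract_right :: "'i \<Rightarrow> ('i list \<times> 'i list \<Rightarrow>\<^sub>0 'k) \<Rightarrow> ('i list \<Rightarrow>\<^sub>0 'k::field)"
  where "contract_right i = Poly_Mapping.map_key (\<lambda>u. (u, [i]))"

lemma lookup_contract_left [simp]:
  "Poly_Mapping.lookup (contract_left i x) v = Poly_Mapping.lookup x ([i], v)"
  by (simp add: contract_left_def map_key.rep_eq inj_def)

lemma lookup_contract_right [simp]:
  "Poly_Mapping.lookup (contract_right i x) u = Poly_Mapping.lookup x (u, [i])"
  by (simp add: contract_right_def map_key.rep_eq inj_def)

locale pre_nichols =
  fixes chi :: "int ^ 'i::finite \<Rightarrow> int ^ 'i \<Rightarrow> 'k::field"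
    and J :: "('i list \<Rightarrow>\<^sub>0 'k) set"
  assumes bicharacter_chi: "bicharacter chi"
    and qmat_sym: "qmat chi i j = qmat chi j i"
    and biideal_J: "biideal chi J"
    and graded_J: "graded_subset J"
    and J_length: "\<lbrakk>x \<in> J; w \<in> Poly_Mapping.keys x\<rbrakk> \<Longrightarrow> 2 \<le> length w"
begin

abbreviation \<alpha> :: "'i \<Rightarrow> int ^ 'i" where "\<alpha> i \<equiv> axis i 1"
abbreviation q :: "'i \<Rightarrow> 'i \<Rightarrow> 'k" where "q \<equiv> qmat chi"

lemma chi_add_left: "chi (a + b) d = chi a d * chi b d"
  and chi_add_right: "chi a (b + d) = chi a b * chi a d"
  and chi_nz [simp]: "chi a b \<noteq> 0"
  using bicharacter_chi by (auto simp: bicharacter_def)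

lemma chi_0 [simp]: "chi 0 d = 1" "chi d 0 = 1"
  using chi_add_left[of 0 0 d] chi_add_right[of d 0 0] by auto

lemma chi_diff_left: "chi (a - b) d = chi a d / chi b d"
  using chi_add_left[of "a - b" b d] by (simp add: field_simps)

lemma chi_alpha: "chi (\<alpha> i) (\<alpha> j) = q i j"
  by (simp add: qmat_def)

lemma q_nz [simp]: "q i j \<noteq> 0"
  by (simp add: qmat_def)

lemma prod_list_chi: "prod_list (map (\<lambda>i. chi a (\<alpha> i)) w) = chi a (word_deg w)"
  by (induction w) (auto simp: word_deg_def chi_add_right)

lemma word_deg_Cons [simp]: "word_deg (i # w) = \<alpha> i + word_deg w"
  and word_deg_Nil [simp]: "word_deg [] = (0 :: int ^ 'i)"
  by (simp_all add: word_deg_def)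

lemma J_ideal: "ideal J ring_of_type_algebra"
  using biideal_J by (simp add: biideal_def)

lemma J_0 [simp]: "0 \<in> J"
  using additive_subgroup.zero_closed[OF ideal.axioms(1)[OF J_ideal]] by simp

lemma J_add: "x \<in> J \<Longrightarrow> y \<in> J \<Longrightarrow> x + y \<in> J"
  using additive_subgroup.a_closed[OF ideal.axioms(1)[OF J_ideal]] by simp

lemma J_left: "x \<in> J \<Longrightarrow> y * x \<in> J"
  using ideal.I_l_closed[OF J_ideal] by simp

lemma J_right: "x \<in> J \<Longrightarrow> x * y \<in> J"
  using ideal.I_r_closed[OF J_ideal] by simp

lemma J_minus: "x \<in> J \<Longrightarrow> - x \<in> J"
  using J_left[of x "- 1"] by simp

lemma J_diff: "x \<in> J \<Longrightarrow> y \<in> J \<Longrightarrow> x - y \<in> J"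
  using J_add[of x "- y"] J_minus[of y] by simp

lemma J_sum: "(\<And>i. i \<in> S \<Longrightarrow> f i \<in> J) \<Longrightarrow> sum f S \<in> J"
  by (induction S rule: infinite_finite_induct) (auto intro: J_add)

text \<open>The map multiplies each homogeneous component by a scalar, so its value is a finite
  combination of components of x. It is applied with a character, giving stability under the torus,
  and with an indicator, giving projection to words of one length.\<close>

lemma J_weight:
  assumes "x \<in> J"
  shows "lin (\<lambda>w. Poly_Mapping.single w (f (word_deg w))) x \<in> J"
proof -
  have hom: "Poly_Mapping.lookup (homogeneous_component \<beta> x) w
      = (if word_deg w = \<beta> then Poly_Mapping.lookup x w else 0)" for \<beta> w
    unfolding homogeneous_component_def lookup_sum
    by (auto simp: lookup_single when_def sum.delta in_keys_iff)
  have "lin (\<lambda>w. Poly_Mapping.single w (f (word_deg w))) x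
      = (\<Sum>\<beta>\<in>word_deg ` Poly_Mapping.keys x. scal (f \<beta>) * homogeneous_component \<beta> x)"
  proof (rule poly_mapping_eqI)
    fix w
    have "Poly_Mapping.lookup (\<Sum>\<beta>\<in>word_deg ` Poly_Mapping.keys x. scal (f \<beta>) * homogeneous_component \<beta> x) w
      = (\<Sum>\<beta>\<in>word_deg ` Poly_Mapping.keys x.
          if \<beta> = word_deg w then f (word_deg w) * Poly_Mapping.lookup x w else 0)"
      unfolding lookup_sum by (rule sum.cong) (auto simp: hom)
    also have "\<dots> = f (word_deg w) * Poly_Mapping.lookup x w"
      by (auto simp: sum.delta in_keys_iff)
    finally show "Poly_Mapping.lookup (lin (\<lambda>w. Poly_Mapping.single w (f (word_deg w))) x) w
      = Poly_Mapping.lookup (\<Sum>\<beta>\<in>word_deg ` Poly_Mapping.keys x. scal (f \<beta>) * homogeneous_component \<beta> x) w"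
      by (simp add: lookup_lin_diag)
  qed
  also have "\<dots> \<in> J"
    using graded_J assms by (intro J_sum J_left) (auto simp: graded_subset_def)
  finally show ?thesis .
qed

text \<open>This is the action of K^a on the tensor algebra: conjugation by K^a on words in the E's,
  and conjugation by the inverse of K^a on words in the F's.\<close>

definition chi_tw :: "int ^ 'i \<Rightarrow> ('i list \<Rightarrow>\<^sub>0 'k) \<Rightarrow> ('i list \<Rightarrow>\<^sub>0 'k)"
  where "chi_tw a = tw (\<lambda>i. chi a (\<alpha> i))"

lemma J_chi_tw: "x \<in> J \<Longrightarrow> chi_tw a x \<in> J"
  using J_weight[of x "chi a"] by (simp add: chi_tw_def tw_def prod_list_chi)

lemma chi_tw_chi_tw: "chi_tw a (chi_tw b x) = chi_tw (a + b) x"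
  by (simp add: chi_tw_def tw_tw chi_add_left)

lemma chi_tw_0: "chi_tw 0 x = x"
  by (simp add: chi_tw_def tw_const_one)

lemma J_chi_tw_iff: "chi_tw a x \<in> J \<longleftrightarrow> x \<in> J"
  using J_chi_tw[of "chi_tw a x" "- a"] J_chi_tw[of x a] by (auto simp: chi_tw_chi_tw chi_tw_0)

text \<open>The derivation \<open>dp i\<close> corresponds to the left and \<open>dm i\<close>, up to a twist, to the right skew
  derivation.  They are the components \<open>E\<^sub>i \<otimes> _\<close> and \<open>_ \<otimes> E\<^sub>i\<close> of the coproduct, hence preserve the
  coideal \<open>J\<close>, which has no part of degree one.\<close>

definition dp :: "'i \<Rightarrow> ('i list \<Rightarrow>\<^sub>0 'k) \<Rightarrow> ('i list \<Rightarrow>\<^sub>0 'k)"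
  where "dp i = skew (\<lambda>j. q i j) i"

definition dm :: "'i \<Rightarrow> ('i list \<Rightarrow>\<^sub>0 'k) \<Rightarrow> ('i list \<Rightarrow>\<^sub>0 'k)"
  where "dm i = skew (\<lambda>j. inverse (q i j)) i"

text \<open>The summand with the new letter on the left puts j in front of the left leg at no cost.
  The other summand has to braid j past the left leg u, which contributes the factor chi (\<alpha>
  j) (word_deg u).\<close>

lemma lookup_coprod_word_Cons:
  "Poly_Mapping.lookup (coprod_word chi (j # w)) (u, v) =
    (case u of [] \<Rightarrow> 0 | i # u' \<Rightarrow> if i = j then Poly_Mapping.lookup (coprod_word chi w) (u', v) else 0) +
    (case v of [] \<Rightarrow> 0 | i # v' \<Rightarrow> if i = j then
      chi (\<alpha> j) (word_deg u) * Poly_Mapping.lookup (coprod_word chi w) (u, v') else 0)"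
proof -
  let ?Y = "coprod_word chi w" and ?X = "tensor (gen j) 1 + tensor 1 (gen j) :: 'i list \<times> 'i list \<Rightarrow>\<^sub>0 'k"
  have X: "?X = Poly_Mapping.single ([j], []) 1 + Poly_Mapping.single ([], [j]) 1"
    by (rule poly_mapping_eqI, rename_tac p, case_tac p)
      (auto simp: lookup_add lookup_tensor lookup_single gen_def one_eq_single when_def)
  have k: "Poly_Mapping.keys ?X = {([j], []), ([], [j])}"
    unfolding X by (auto simp: set_eq_iff in_keys_iff lookup_add lookup_single when_def)
  have l: "Poly_Mapping.lookup ?X ([j], []) = 1" "Poly_Mapping.lookup ?X ([], [j]) = 1"
    unfolding X by (auto simp: lookup_add lookup_single when_def)
  have "coprod_word chi (j # w) =
    (\<Sum>(u, v)\<in>Poly_Mapping.keys ?Y. Poly_Mapping.single (j # u, v) (Poly_Mapping.lookup ?Y (u, v))) +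
    (\<Sum>(u, v)\<in>Poly_Mapping.keys ?Y.
      Poly_Mapping.single (u, j # v) (chi (\<alpha> j) (word_deg u) * Poly_Mapping.lookup ?Y (u, v)))"
    by (simp add: braided_mult_def k l)
  moreover have "Poly_Mapping.lookup
      (\<Sum>(u, v)\<in>Poly_Mapping.keys ?Y. Poly_Mapping.single (j # u, v) (Poly_Mapping.lookup ?Y (u, v))) (u, v)
    = (case u of [] \<Rightarrow> 0 | i # u' \<Rightarrow> if i = j then Poly_Mapping.lookup ?Y (u', v) else 0)"
  proof (cases u)
    case (Cons i u')
    have "Poly_Mapping.lookup
      (\<Sum>(u, v)\<in>Poly_Mapping.keys ?Y. Poly_Mapping.single (j # u, v) (Poly_Mapping.lookup ?Y (u, v))) (u, v)
      = (\<Sum>p\<in>Poly_Mapping.keys ?Y. if p = (u', v) then (if i = j then Poly_Mapping.lookup ?Y (u', v) else 0) else 0)"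
      unfolding lookup_sum Cons by (rule sum.cong) (auto simp: lookup_single when_def split: if_splits)
    then show ?thesis by (auto simp: Cons sum.delta' in_keys_iff)
  qed (auto simp: lookup_sum lookup_single when_def intro!: sum.neutral)
  moreover have "Poly_Mapping.lookup
      (\<Sum>(u, v)\<in>Poly_Mapping.keys ?Y.
        Poly_Mapping.single (u, j # v) (chi (\<alpha> j) (word_deg u) * Poly_Mapping.lookup ?Y (u, v))) (u, v)
    = (case v of [] \<Rightarrow> 0 | i # v' \<Rightarrow> if i = j then
      chi (\<alpha> j) (word_deg u) * Poly_Mapping.lookup ?Y (u, v') else 0)"
  proof (cases v)
    case (Cons i v')
    have "Poly_Mapping.lookup
      (\<Sum>(u, v)\<in>Poly_Mapping.keys ?Y.
        Poly_Mapping.single (u, j # v) (chi (\<alpha> j) (word_deg u) * Poly_Mapping.lookup ?Y (u, v))) (u, v)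
      = (\<Sum>p\<in>Poly_Mapping.keys ?Y. if p = (u, v') then (if i = j then
          chi (\<alpha> j) (word_deg u) * Poly_Mapping.lookup ?Y (u, v') else 0) else 0)"
      unfolding lookup_sum Cons by (rule sum.cong) (auto simp: lookup_single when_def split: if_splits)
    then show ?thesis by (auto simp: Cons sum.delta' in_keys_iff)
  qed (auto simp: lookup_sum lookup_single when_def intro!: sum.neutral)
  ultimately show ?thesis by (simp only: lookup_add)
qed

lemma lookup_coprod_word_Nil:
  "Poly_Mapping.lookup (coprod_word chi []) (u, v) = (if u = [] \<and> v = [] then 1 else 0)"
  by (simp add: lookup_tensor one_eq_single lookup_single when_def)

lemma lookup_coprod_word_left:
  "Poly_Mapping.lookup (coprod_word chi w) ([], v) = (if v = w then 1 else 0)"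
  by (induction w arbitrary: v)
    (auto simp: lookup_coprod_word_Nil lookup_coprod_word_Cons simp del: coprod_word.simps split: list.splits)

lemma lookup_coprod_word_right:
  "Poly_Mapping.lookup (coprod_word chi w) (u, []) = (if u = w then 1 else 0)"
  by (induction w arbitrary: u)
    (auto simp: lookup_coprod_word_Nil lookup_coprod_word_Cons simp del: coprod_word.simps split: list.splits)

lemma lookup_gen_mult:
  "Poly_Mapping.lookup (gen j * x) v =
    (case v of [] \<Rightarrow> 0 | i # v' \<Rightarrow> if i = j then Poly_Mapping.lookup x v' else (0::'k))"
  by (induction x rule: free_induct)
    (auto simp: distrib_left lookup_add gen_def lookup_single when_def split: list.splits)

text \<open>With left leg [i] the braiding factor of a passing letter j is q j i, which equals q i j
  by symmetry. The coefficients thus satisfy the recursion of \<open>skew_word\<close>.\<close>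

lemma contract_left_coprod_word: "contract_left i (coprod_word chi w) = skew_word (\<lambda>j. q i j) i w"
proof (induction w)
  case (Cons j w)
  then have IH: "Poly_Mapping.lookup (coprod_word chi w) ([i], v) =
      Poly_Mapping.lookup (skew_word (\<lambda>j. q i j) i w) v" for v
    by (metis lookup_contract_left)
  show ?case
    using IH
    by (intro poly_mapping_eqI)
      (auto simp: lookup_coprod_word_Cons lookup_add lookup_gen_mult lookup_coprod_word_left chi_alpha
        qmat_sym[of j i] lookup_single when_def simp del: coprod_word.simps split: list.splits)
qed (auto intro!: poly_mapping_eqI simp: lookup_coprod_word_Nil simp del: coprod_word.simps)

text \<open>In the right contraction a deleted letter i carries the factors q i j of the letters to
  its right. \<open>skew_word\<close> with inverse weights puts the inverse factors on the letters
  to its left. The twist by \<alpha> i multiplies by all remaining letters, which cancels the left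
  ones and supplies the right ones.\<close>

lemma contract_right_coprod_word:
  "contract_right i (coprod_word chi w) = chi_tw (\<alpha> i) (skew_word (\<lambda>j. inverse (q i j)) i w)"
proof (induction w)
  case (Cons j w)
  then have IH: "Poly_Mapping.lookup (coprod_word chi w) (u, [i]) =
      Poly_Mapping.lookup (chi_tw (\<alpha> i) (skew_word (\<lambda>j. inverse (q i j)) i w)) u" for u
    by (metis lookup_contract_right)
  have "chi_tw (\<alpha> i) (skew_word (\<lambda>j. inverse (q i j)) i (j # w)) =
      gen j * chi_tw (\<alpha> i) (skew_word (\<lambda>j. inverse (q i j)) i w) +
      (if i = j then Poly_Mapping.single w (chi (\<alpha> i) (word_deg w)) else 0)"
    by (simp add: chi_tw_def tw_add tw_scal tw_mult tw_gen qmat_def prod_list_chi mult.assoc)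
  then show ?case
    by (intro poly_mapping_eqI)
      (auto simp: lookup_coprod_word_Cons lookup_add lookup_gen_mult lookup_coprod_word_right IH
        lookup_single when_def simp del: coprod_word.simps split: list.splits)
qed (auto intro!: poly_mapping_eqI simp: lookup_coprod_word_Nil chi_tw_def simp del: coprod_word.simps)

lemma contract_coprod:
  "contract_left i (coprod chi x) = dp i x" "contract_right i (coprod chi x) = chi_tw (\<alpha> i) (dm i x)"
proof -
  have lk: "Poly_Mapping.lookup (coprod chi x) p =
    (\<Sum>w\<in>Poly_Mapping.keys x. Poly_Mapping.lookup x w * Poly_Mapping.lookup (coprod_word chi w) p)" for p
    by (simp add: coprod_def lookup_sum lookup_scale2)
  show "contract_left i (coprod chi x) = dp i x"
    by (rule poly_mapping_eqI)
      (simp add: lk dp_def skew_def lin_def lookup_sum flip: contract_left_coprod_word)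
  have "chi_tw (\<alpha> i) (dm i x) = lin (\<lambda>w. chi_tw (\<alpha> i) (skew_word (\<lambda>j. inverse (q i j)) i w)) x"
    by (induction x rule: free_induct) (simp_all add: dm_def chi_tw_def skew_add tw_add lin_add tw_scal)
  then show "contract_right i (coprod chi x) = chi_tw (\<alpha> i) (dm i x)"
    by (intro poly_mapping_eqI) (simp add: lk lin_def lookup_sum flip: contract_right_coprod_word)
qed

lemma J_lookup_singleton: "x \<in> J \<Longrightarrow> Poly_Mapping.lookup x [i] = 0"
  using J_length[of x "[i]"] by (force simp: in_keys_iff)

text \<open>Contracting a pure tensor leaves one leg, scaled by the coefficient of [i] in the other.
  If the remaining leg is in J nothing is to be shown; if the contracted one is, its coefficient
  vanishes because J begins in degree two.\<close>

lemma J_contract: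
  fixes t :: "'i list \<times> 'i list \<Rightarrow>\<^sub>0 'k"
  assumes "t \<in> module.span scale2 {tensor y z | y z. y \<in> J \<or> z \<in> J}"
  shows "contract_left i t \<in> J \<and> contract_right i t \<in> J"
proof -
  interpret S: vector_space "scale2 :: 'k \<Rightarrow> ('i list \<times> 'i list \<Rightarrow>\<^sub>0 'k) \<Rightarrow> _" by (rule vector_space_scale2)
  have 0: "contract_left i 0 = 0" "contract_right i 0 = 0"
    by (auto intro!: poly_mapping_eqI)
  have add: "contract_left i (t + t') = contract_left i t + contract_left i t'"
    "contract_right i (t + t') = contract_right i t + contract_right i t'" for t t'
    by (auto intro!: poly_mapping_eqI simp: lookup_add)
  have sc: "contract_left i (scale2 a t) = scal a * contract_left i t"
    "contract_right i (scale2 a t) = scal a * contract_right i t" for a t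
    by (auto intro!: poly_mapping_eqI simp: lookup_scale2)
  have tens: "contract_left i (tensor y z) = scal (Poly_Mapping.lookup y [i]) * z"
    "contract_right i (tensor y z) = scal (Poly_Mapping.lookup z [i]) * y" for y z
    by (auto intro!: poly_mapping_eqI simp: lookup_tensor mult.commute)
  show ?thesis
    by (rule S.span_induct[OF assms])
      (auto intro!: S.subspaceI simp: 0 add sc tens J_add J_left J_lookup_singleton)
qed

lemma J_dp: "x \<in> J \<Longrightarrow> dp i x \<in> J" and J_dm: "x \<in> J \<Longrightarrow> dm i x \<in> J"
  using biideal_J J_contract[of "coprod chi x" i]
  by (auto simp: biideal_def contract_coprod J_chi_tw_iff)

lemmas dp_add = skew_add[of "\<lambda>j. q i j" i for i, folded dp_def]
lemmas dm_add = skew_add[of "\<lambda>j. inverse (q i j)" i for i, folded dm_def]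
lemmas dp_diff = skew_diff[of "\<lambda>j. q i j" i for i, folded dp_def]
lemmas dm_diff = skew_diff[of "\<lambda>j. inverse (q i j)" i for i, folded dm_def]
lemmas dp_scal = skew_scal[of "\<lambda>j. q i j" i for i, folded dp_def]
lemmas dm_scal = skew_scal[of "\<lambda>j. inverse (q i j)" i for i, folded dm_def]
lemmas dp_gen = skew_gen_mult[of "\<lambda>j. q i j" i for i, folded dp_def]
lemmas dm_gen = skew_gen_mult[of "\<lambda>j. inverse (q i j)" i for i, folded dm_def]

lemma dpm_zero_one [simp]: "dp i 0 = 0" "dm i 0 = 0" "dp i 1 = 0" "dm i 1 = 0"
  by (simp_all add: dp_def dm_def)

end

section \<open>The universal Verma module\<close>

context pre_nichols
begin

text \<open>A function \<open>f\<close> stands for the formal sum \<open>\<Sum>\<^sub>b K\<^sup>b f(b) v\<close>, where \<open>v\<close> is the generator, annihilated by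
  all \<open>E\<^sub>i\<close>, and the letter \<open>i\<close> of a word in \<open>f(b)\<close> stands for \<open>F\<^sub>i\<close>.  Infinite sums are allowed only in
  order to avoid finite-support conditions.\<close>

primrec act :: "'i U_gen \<Rightarrow> (int ^ 'i \<Rightarrow> 'i list \<Rightarrow>\<^sub>0 'k) \<Rightarrow> (int ^ 'i \<Rightarrow> 'i list \<Rightarrow>\<^sub>0 'k)"
  where
    "act (Kgen i) f = (\<lambda>b. f (b - \<alpha> i))"
  | "act (Kinvgen i) f = (\<lambda>b. f (b + \<alpha> i))"
  | "act (Fgen i) f = (\<lambda>b. scal (chi b (\<alpha> i)) * (gen i * f b))"
  | "act (Egen i) f = (\<lambda>b. scal (inverse (chi (b - \<alpha> i) (\<alpha> i))) * dp i (f (b - \<alpha> i)) -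
      scal (inverse (chi (b + \<alpha> i) (\<alpha> i))) * dm i (f (b + \<alpha> i)))"

definition rho :: "('i U_gen list \<Rightarrow>\<^sub>0 'k) \<Rightarrow> (int ^ 'i \<Rightarrow> 'i list \<Rightarrow>\<^sub>0 'k) \<Rightarrow> (int ^ 'i \<Rightarrow> 'i list \<Rightarrow>\<^sub>0 'k)"
  where "rho x f = (\<lambda>b. lin (\<lambda>w. foldr act w f b) x)"

lemma act_add: "act g (\<lambda>b. f b + f' b) = (\<lambda>b. act g f b + act g f' b)"
  by (cases g) (simp_all add: fun_eq_iff dp_add dm_add distrib_left algebra_simps)

lemma act_scal: "act g (\<lambda>b. scal a * f b) = (\<lambda>b. scal a * act g f b)"
  by (cases g) (simp_all add: fun_eq_iff dp_scal dm_scal right_diff_distrib mult.commute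
      scal_commute_left[of "gen _"])

lemma act_zero [simp]: "act g (\<lambda>b. 0) = (\<lambda>b. 0)"
  by (cases g) simp_all

lemma act_minus: "act g (\<lambda>b. - f b) = (\<lambda>b. - act g f b)"
  using act_scal[of g "- 1" f] by (simp add: scal_minus)

lemma act_diff: "act g (\<lambda>b. f b - f' b) = (\<lambda>b. act g f b - act g f' b)"
  using act_add[of g f "\<lambda>b. - f' b"] by (simp add: act_minus)

lemma foldr_act_zero: "foldr act w (\<lambda>b. 0) = (\<lambda>b. 0)"
  by (induction w) simp_all

lemma rho_single [simp]: "rho (Poly_Mapping.single w a) f = (\<lambda>b. scal a * foldr act w f b)"
  by (simp add: rho_def)

lemma rho_add: "rho (x + y) f = (\<lambda>b. rho x f b + rho y f b)"
  by (simp add: rho_def lin_add)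

lemma rho_diff: "rho (x - y) f = (\<lambda>b. rho x f b - rho y f b)"
  by (simp add: rho_def lin_diff)

lemma rho_scal: "rho (scal a * x) f = (\<lambda>b. scal a * rho x f b)"
  by (simp add: rho_def lin_scal)

lemma rho_zero [simp]: "rho 0 f = (\<lambda>b. 0)"
  by (simp add: rho_def)

lemma rho_one [simp]: "rho 1 f = f"
  using rho_single[of "[]" 1 f] by (simp flip: one_eq_single)

lemma rho_gen [simp]: "rho (gen g) f = act g f"
  by (simp add: gen_def)

lemma rho_gen_mult: "rho (gen g * x) f = act g (rho x f)"
proof (induction x rule: free_induct)
  case (single w a)
  show ?case by (simp add: gen_def act_scal)
qed (simp_all add: distrib_left rho_add act_add)

lemma rho_mult: "rho (x * y) f = rho x (rho y f)"
proof (induction x rule: free_induct)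
  case (single w a)
  have "rho (Poly_Mapping.single w 1 * y) f = foldr act w (rho y f)"
  proof (induction w)
    case (Cons g w)
    have "Poly_Mapping.single (g # w) 1 * y = gen g * (Poly_Mapping.single w 1 * y)"
      by (simp add: gen_def flip: mult.assoc)
    then show ?case using Cons by (simp add: rho_gen_mult)
  qed (simp flip: one_eq_single)
  moreover have "Poly_Mapping.single w a * y = scal a * (Poly_Mapping.single w 1 * y)"
    by (simp flip: mult.assoc)
  ultimately show ?case by (simp add: rho_scal)
qed (simp_all add: distrib_right rho_add)

text \<open>The scalars in \<open>act\<close> come from F_i K^b = chi(b, \<alpha>_i) K^b F_i and E_i
  K^b = chi(b, \<alpha>_i)^{-1} K^b E_i, and E_i f v = K_i \<open>dp i\<close> f v - K_i^{-1}
  \<open>dm i\<close> f v. In the commutator the terms that differentiate f cancel, by the two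
  scalar identities below, and the inhomogeneous terms of the skew Leibniz rules leave K_j -
  K_j^{-1} when i = j.\<close>

lemma act_EF:
  "act (Egen i) (act (Fgen j) f) = (\<lambda>b. act (Fgen j) (act (Egen i) f) b +
    (if i = j then act (Kgen j) f b - act (Kinvgen j) f b else 0))"
proof
  fix b
  have 1: "inverse (chi (b - \<alpha> i) (\<alpha> i)) * chi (b - \<alpha> i) (\<alpha> j) * q i j
      = chi b (\<alpha> j) * inverse (chi (b - \<alpha> i) (\<alpha> i))"
    by (simp add: chi_diff_left qmat_def)
  have 2: "inverse (chi (b + \<alpha> i) (\<alpha> i)) * chi (b + \<alpha> i) (\<alpha> j) * inverse (q i j)
      = chi b (\<alpha> j) * inverse (chi (b + \<alpha> i) (\<alpha> i))"
    by (simp add: chi_add_left qmat_def)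
  show "act (Egen i) (act (Fgen j) f) b = act (Fgen j) (act (Egen i) f) b +
    (if i = j then act (Kgen j) f b - act (Kinvgen j) f b else 0)"
    using 1 2 by (simp add: dp_scal dm_scal dp_gen dm_gen distrib_left right_diff_distrib
        scal_commute_left[of "gen _"] mult.commute[of "chi b (\<alpha> j)"])
qed

lemma act_EK:
  "act (Egen i) (act (Kgen j) f) = (\<lambda>b. scal (inverse (q i j)) * act (Kgen j) (act (Egen i) f) b)"
proof
  fix b
  have e: "b - \<alpha> i - \<alpha> j = b - \<alpha> j - \<alpha> i" "b + \<alpha> i - \<alpha> j = b - \<alpha> j + \<alpha> i" by simp_all
  show "act (Egen i) (act (Kgen j) f) b = scal (inverse (q i j)) * act (Kgen j) (act (Egen i) f) b"
    by (simp add: right_diff_distrib e, simp add: chi_diff_left chi_add_left qmat_def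
        qmat_sym[of i j, unfolded qmat_def] field_simps)
qed

lemma act_EKinv:
  "act (Egen i) (act (Kinvgen j) f) = (\<lambda>b. scal (q i j) * act (Kinvgen j) (act (Egen i) f) b)"
proof
  fix b
  have e: "b - \<alpha> i + \<alpha> j = b + \<alpha> j - \<alpha> i" "b + \<alpha> i + \<alpha> j = b + \<alpha> j + \<alpha> i" by (simp_all add: add_ac)
  show "act (Egen i) (act (Kinvgen j) f) b = scal (q i j) * act (Kinvgen j) (act (Egen i) f) b"
    by (simp add: right_diff_distrib e, simp add: chi_diff_left chi_add_left qmat_def
        qmat_sym[of i j, unfolded qmat_def] field_simps)
qed

lemma rho_U_rels:
  assumes "r \<in> U_rels chi" shows "rho r f = (\<lambda>b. 0)"
proof -
  consider i where "r = gen (Kgen i) * gen (Kinvgen i) - 1" | i where "r = gen (Kinvgen i) * gen (Kgen i) - 1"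
    | i j where "r = gen (Kgen i) * gen (Kgen j) - gen (Kgen j) * gen (Kgen i)"
    | i j where "r = gen (Kgen i) * gen (Egen j) - scal (q i j) * gen (Egen j) * gen (Kgen i)"
    | i j where "r = gen (Kgen i) * gen (Fgen j) - scal (inverse (q i j)) * gen (Fgen j) * gen (Kgen i)"
    | i j where "r = gen (Egen i) * gen (Fgen j) - gen (Fgen j) * gen (Egen i) -
         (if i = j then gen (Kgen i) - gen (Kinvgen i) else 0)"
    using assms unfolding U_rels_def by blast
  then show ?thesis
  proof cases
    case (3 i j)
    have "b - \<alpha> i - \<alpha> j = b - \<alpha> j - \<alpha> i" for b :: "int ^ 'i" by simp
    then have "f (b - \<alpha> i - \<alpha> j) = f (b - \<alpha> j - \<alpha> i)" for b by metis
    then show ?thesis by (simp add: 3 rho_diff rho_gen_mult del: diff_diff_add)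
  next
    case (4 i j)
    then show ?thesis
      by (simp add: rho_diff rho_gen_mult rho_scal mult.assoc act_EK act_scal qmat_sym[of j i] del: act.simps)
  next
    case (5 i j)
    then show ?thesis
      by (simp add: rho_diff rho_gen_mult rho_scal mult.assoc chi_diff_left qmat_def divide_inverse
          mult.commute[of "inverse _"])
  next
    case (6 i j)
    then show ?thesis
      by (auto simp: rho_diff rho_gen_mult act_EF simp del: act.simps)
  qed (simp_all add: rho_diff rho_gen_mult)
qed

lemma act_J: "(\<And>b. f b \<in> J) \<Longrightarrow> act g f b \<in> J"
  by (cases g) (auto intro!: J_left J_diff J_dp J_dm)

lemma rho_J: "(\<And>b. f b \<in> J) \<Longrightarrow> rho x f b \<in> J"
proof (induction x arbitrary: b rule: free_induct)
  case (single w a)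
  have "foldr act w f b \<in> J" for b
    by (induction w arbitrary: b) (use single in \<open>auto intro: act_J\<close>)
  then show ?case by (simp add: J_left)
qed (auto simp: rho_add intro: J_add)

abbreviation iE :: "('i list \<Rightarrow>\<^sub>0 'k) \<Rightarrow> ('i U_gen list \<Rightarrow>\<^sub>0 'k)" where "iE \<equiv> map_gens Egen"
abbreviation iF :: "('i list \<Rightarrow>\<^sub>0 'k) \<Rightarrow> ('i U_gen list \<Rightarrow>\<^sub>0 'k)" where "iF \<equiv> map_gens Fgen"

text \<open>Passing K^b only twists x, so words in the F's act by twisted left multiplication. As J
  is stable under twists and is a right ideal, its copy in the F's maps every function into
  J.\<close>

lemma rho_iF: "rho (iF x) f b = chi_tw b x * f b"
proof (induction x rule: free_induct)
  case (single w a)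
  have "foldr act (map Fgen w) f b = chi_tw b (Poly_Mapping.single w 1) * f b"
  proof (induction w)
    case (Cons i w)
    have "chi_tw b (Poly_Mapping.single (i # w) 1)
        = scal (chi b (\<alpha> i)) * (gen i * chi_tw b (Poly_Mapping.single w 1))"
      by (simp add: chi_tw_def gen_def)
    then show ?case using Cons by (simp add: mult.assoc)
  qed (simp add: chi_tw_def flip: one_eq_single)
  then show ?case by (simp add: chi_tw_def flip: mult.assoc)
qed (simp_all add: map_gens_add rho_add distrib_right chi_tw_def tw_add)

definition vac :: "int ^ 'i \<Rightarrow> ('i list \<Rightarrow>\<^sub>0 'k)"
  where "vac b = (if b = 0 then 1 else 0)"

lemma act_E_vac: "act (Egen i) vac = (\<lambda>b. 0)"
  by (auto simp: vac_def)

lemma rho_iE_vac: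
  assumes "x \<in> J" shows "rho (iE x) vac = (\<lambda>b. 0)"
proof
  fix b
  have "foldr act (map Egen w) vac b = 0" if w: "w \<in> Poly_Mapping.keys x" for w
  proof -
    have "w \<noteq> []" using J_length[OF assms w] by auto
    then obtain v i where "w = v @ [i]" by (metis rev_exhaust)
    then show ?thesis by (simp add: act_E_vac foldr_act_zero del: act.simps)
  qed
  moreover have "rho (iE x) f b = lin (\<lambda>w. foldr act (map Egen w) f b) x" for f
    by (induction x rule: free_induct) (simp_all add: map_gens_add rho_add lin_add)
  ultimately show "rho (iE x) vac b = 0" by (simp add: lin_def)
qed

text \<open>This mirrors \<open>E_cF\<close>, with the roles of the two derivations exchanged:
  \<open>dm\<close> accompanies K_j and \<open>dp\<close> accompanies K_j^{-1}. Its purpose is that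
  both derivatives of an element of J are again in J.\<close>

lemma rho_iE_F:
  "rho (iE x) (act (Fgen j) f) = (\<lambda>b. act (Fgen j) (rho (iE x) f) b +
    act (Kgen j) (rho (iE (dm j x)) f) b - act (Kinvgen j) (rho (iE (dp j x)) f) b)"
proof (induction x rule: free_induct)
  case zero
  show ?case by (simp del: act.simps)
next
  case (add x y)
  then show ?case
    by (simp add: map_gens_add rho_add act_add dp_add dm_add algebra_simps fun_eq_iff del: act.simps)
next
  case (single w a)
  have "rho (iE (Poly_Mapping.single w 1)) (act (Fgen j) f) = (\<lambda>b.
    act (Fgen j) (rho (iE (Poly_Mapping.single w 1)) f) b +
    act (Kgen j) (rho (iE (dm j (Poly_Mapping.single w 1))) f) b -
    act (Kinvgen j) (rho (iE (dp j (Poly_Mapping.single w 1))) f) b)"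
  proof (induction w)
    case Nil
    show ?case by (simp flip: one_eq_single del: act.simps)
  next
    case (Cons i w)
    let ?w = "Poly_Mapping.single w 1 :: 'i list \<Rightarrow>\<^sub>0 'k"
    have w: "Poly_Mapping.single (i # w) 1 = gen i * ?w" by (simp add: gen_def)
    have g: "iE (gen i) = gen (Egen i)" by (simp add: gen_def)
    show ?case
      unfolding w map_gens_mult g rho_gen_mult Cons dp_gen dm_gen
      by (auto simp: act_add act_diff act_EF act_EK act_EKinv map_gens_add map_gens_scal map_gens_mult g
          rho_add rho_scal rho_gen_mult act_scal qmat_sym[of j i] algebra_simps fun_eq_iff
          simp del: act.simps)
  qed
  moreover have "rho (iE (scal a * x)) f = (\<lambda>b. scal a * rho (iE x) f b)" for x f
    by (simp add: map_gens_scal rho_scal)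
  ultimately show ?case
    by (subst (1 2 3 4) single_eq_scal)
      (simp add: dp_scal dm_scal act_scal right_diff_distrib distrib_left del: act.simps scal_mult_single)
qed

lemma rho_iE_K:
  "rho (iE x) (act (Kgen j) f) = act (Kgen j) (rho (iE (chi_tw (- \<alpha> j) x)) f)"
  "rho (iE x) (act (Kinvgen j) f) = act (Kinvgen j) (rho (iE (chi_tw (\<alpha> j) x)) f)"
proof -
  have inv: "chi (- \<alpha> j) (\<alpha> i) = inverse (q i j)" for i
    using chi_diff_left[of 0 "\<alpha> j" "\<alpha> i"] qmat_sym[of i j] by (simp add: qmat_def divide_inverse)
  have w: "foldr act (map Egen w) (act (Kgen j) f) =
      (\<lambda>b. scal (prod_list (map (\<lambda>i. chi (- \<alpha> j) (\<alpha> i)) w)) * act (Kgen j) (foldr act (map Egen w) f) b)"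
    "foldr act (map Egen w) (act (Kinvgen j) f) =
      (\<lambda>b. scal (prod_list (map (\<lambda>i. chi (\<alpha> j) (\<alpha> i)) w)) * act (Kinvgen j) (foldr act (map Egen w) f) b)" for w
    by (induction w) (simp_all add: act_scal act_EK act_EKinv inv chi_alpha qmat_sym[of j] mult.commute del: act.simps)
  show "rho (iE x) (act (Kgen j) f) = act (Kgen j) (rho (iE (chi_tw (- \<alpha> j) x)) f)"
    by (induction x rule: free_induct)
      (simp_all add: map_gens_add rho_add act_add chi_tw_def tw_add w act_scal del: act.simps)
  show "rho (iE x) (act (Kinvgen j) f) = act (Kinvgen j) (rho (iE (chi_tw (\<alpha> j) x)) f)"
    by (induction x rule: free_induct)
      (simp_all add: map_gens_add rho_add act_add chi_tw_def tw_add w act_scal del: act.simps)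
qed

text \<open>Moving \<open>F\<^sub>j\<close> to the left past \<open>x \<in> J\<close>, written in the \<open>E\<^sub>i\<close>, produces only further elements of \<open>J\<close>.\<close>

lemma rho_iE_J:
  assumes "x \<in> J" shows "rho (iE x) (rho z vac) b \<in> J"
proof (induction z arbitrary: b rule: free_induct)
  case zero
  have "rho (iE x) (\<lambda>b. 0) b \<in> J" for b by (rule rho_J) simp
  then show ?case by simp
next
  case (add y z)
  have "rho (iE x) (rho (y + z) vac) = rho (iE x * (y + z)) vac" by (simp only: rho_mult)
  also have "\<dots> = (\<lambda>b. rho (iE x) (rho y vac) b + rho (iE x) (rho z vac) b)"
    by (simp only: distrib_left rho_add rho_mult)
  finally have "rho (iE x) (rho (y + z) vac) = \<dots>" .
  then show ?case using add J_add by simp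
next
  case (single w a)
  have "rho (iE x) (foldr act w vac) b \<in> J"
    using assms
  \<comment> \<open>x has to vary: a letter E is absorbed into x on the right, a letter K twists x,
    and a letter F differentiates it. J is closed under all three operations.\<close>
  proof (induction w arbitrary: x b)
    case Nil
    then show ?case using rho_iE_vac by simp
  next
    case (Cons g w)
    show ?case
    proof (cases g)
      case (Egen i)
      have "rho (iE x) (act (Egen i) f) = rho (iE (x * gen i)) f" for f
        by (simp add: map_gens_mult gen_def rho_mult)
      then show ?thesis using Cons.IH[OF J_right[OF Cons.prems]] Egen by simp
    next
      case (Fgen i)
      then show ?thesis using Cons.IH Cons.prems
        by (auto simp: rho_iE_F simp del: act.simps intro!: J_diff J_add act_J J_dp J_dm)
    next
      case (Kgen i)
      then show ?thesis using Cons.IH Cons.prems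
        by (auto simp: rho_iE_K J_chi_tw simp del: act.simps intro!: act_J)
    next
      case (Kinvgen i)
      then show ?thesis using Cons.IH Cons.prems
        by (auto simp: rho_iE_K J_chi_tw simp del: act.simps intro!: act_J)
    qed
  qed
  moreover have "rho (iE x) (rho (Poly_Mapping.single w a) vac) =
      (\<lambda>b. scal a * rho (iE x) (foldr act w vac) b)"
  proof -
    have "Poly_Mapping.single w a = scal a * Poly_Mapping.single w 1" by simp
    moreover have "rho (Poly_Mapping.single w 1) vac = foldr act w vac" by simp
    ultimately show ?thesis by (metis rho_mult rho_scal scal_commute_left)
  qed
  ultimately show ?case by (simp add: J_left)
qed

text \<open>This is the annihilator, modulo J, of the submodule generated by \<open>vac\<close>.
  Quantifying over z makes it two-sided, and restricts the test to vectors obtained from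
  \<open>vac\<close>, for which \<open>rho_iE_J\<close> controls the copy of J in the E's.\<close>

lemma ideal_rho_vac: "ideal {x. \<forall>z b. rho (x * z) vac b \<in> J} ring_of_type_algebra"
proof (rule idealI)
  interpret R: ring "ring_of_type_algebra :: ('i U_gen list \<Rightarrow>\<^sub>0 'k) ring"
    by (rule ring_ring_of_type_algebra)
  show "ring (ring_of_type_algebra :: ('i U_gen list \<Rightarrow>\<^sub>0 'k) ring)" by (rule R.ring_axioms)
  have inv: "inv\<^bsub>add_monoid ring_of_type_algebra\<^esub> x = - x" for x :: "'i U_gen list \<Rightarrow>\<^sub>0 'k"
    using R.minus_equality[of "- x" x] by (simp add: a_inv_def)
  show "subgroup {x. \<forall>z b. rho (x * z) vac b \<in> J} (add_monoid (ring_of_type_algebra :: ('i U_gen list \<Rightarrow>\<^sub>0 'k) ring))"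
  proof
    fix x :: "'i U_gen list \<Rightarrow>\<^sub>0 'k"
    assume "x \<in> {x. \<forall>z b. rho (x * z) vac b \<in> J}"
    then show "inv\<^bsub>add_monoid ring_of_type_algebra\<^esub> x \<in> {x. \<forall>z b. rho (x * z) vac b \<in> J}"
      unfolding inv using rho_diff[of 0] J_minus by simp
  qed (auto simp: distrib_right rho_add intro: J_add)
next
  fix a x :: "'i U_gen list \<Rightarrow>\<^sub>0 'k"
  assume a: "a \<in> {x. \<forall>z b. rho (x * z) vac b \<in> J}"
  then have "rho (x * (a * z)) vac b \<in> J" for z b by (auto simp: rho_mult[of x] intro: rho_J)
  with a show "x \<otimes>\<^bsub>ring_of_type_algebra\<^esub> a \<in> {x. \<forall>z b. rho (x * z) vac b \<in> J}"
    "a \<otimes>\<^bsub>ring_of_type_algebra\<^esub> x \<in> {x. \<forall>z b. rho (x * z) vac b \<in> J}"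
    by (auto simp: mult.assoc)
qed

lemma U_ideal_rho_vac:
  assumes "x \<in> U_ideal chi J" shows "rho x vac b \<in> J"
proof -
  interpret R: ring "ring_of_type_algebra :: ('i U_gen list \<Rightarrow>\<^sub>0 'k) ring"
    by (rule ring_ring_of_type_algebra)
  have "map_gens omega_gen (iE x) = iF x" for x
    by (simp add: map_gens_comp comp_def)
  then have "rho (map_gens omega_gen (iE x) * z) vac b \<in> J" if "x \<in> J" for x z b
    using that by (simp add: rho_mult rho_iF J_chi_tw J_right)
  then have "U_ideal chi J \<subseteq> {x. \<forall>z b. rho (x * z) vac b \<in> J}"
    unfolding U_ideal_def
    by (intro R.genideal_minimal ideal_rho_vac) (auto simp: rho_mult rho_U_rels rho_iE_J)
  then show ?thesis using assms by (force dest: spec[of _ 1])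
qed

end

section \<open>The algebra \<open>U(\<chi>)\<close>\<close>

context pre_nichols
begin

abbreviation "UU \<equiv> U chi J"
abbreviation "cl \<equiv> U_class chi J"
abbreviation "I \<equiv> U_ideal chi J"

lemma ideal_I: "ideal I ring_of_type_algebra"
proof -
  interpret R: ring "ring_of_type_algebra :: ('i U_gen list \<Rightarrow>\<^sub>0 'k) ring"
    by (rule ring_ring_of_type_algebra)
  show ?thesis unfolding U_ideal_def by (rule R.genideal_ideal) simp
qed

lemma I_rels: "r \<in> U_rels chi \<Longrightarrow> r \<in> I" and I_iF: "x \<in> J \<Longrightarrow> iF x \<in> I"
proof -
  interpret R: ring "ring_of_type_algebra :: ('i U_gen list \<Rightarrow>\<^sub>0 'k) ring"
    by (rule ring_ring_of_type_algebra)
  have sub: "U_rels chi \<union> iE ` J \<union> map_gens omega_gen ` iE ` J \<subseteq> I"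
    unfolding U_ideal_def by (rule R.genideal_self) simp
  then show "r \<in> U_rels chi \<Longrightarrow> r \<in> I" by blast
  have "map_gens omega_gen (iE x) = iF x" for x
    by (simp add: map_gens_comp comp_def)
  then show "x \<in> J \<Longrightarrow> iF x \<in> I" using sub by (metis UnI2 imageI subsetD)
qed

lemma cl_eq_iff: "cl x = cl y \<longleftrightarrow> x - y \<in> I"
proof -
  interpret I: ideal I "ring_of_type_algebra :: ('i U_gen list \<Rightarrow>\<^sub>0 'k) ring" by (rule ideal_I)
  have neg: "\<ominus>\<^bsub>ring_of_type_algebra\<^esub> y = - y" for y :: "'i U_gen list \<Rightarrow>\<^sub>0 'k"
    using I.minus_equality[of "- y" y] by simp
  have "cl x = cl y \<longleftrightarrow> x \<ominus>\<^bsub>ring_of_type_algebra\<^esub> y \<in> I"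
    unfolding U_class_def using I.quotient_eq_iff_same_a_r_cos[OF ideal_I, of x y] by simp
  then show ?thesis by (simp add: a_minus_def neg)
qed

lemma U_simps:
  "carrier UU = range cl" "cl x \<otimes>\<^bsub>UU\<^esub> cl y = cl (x * y)" "cl x \<oplus>\<^bsub>UU\<^esub> cl y = cl (x + y)"
  "\<one>\<^bsub>UU\<^esub> = cl 1" "\<zero>\<^bsub>UU\<^esub> = cl 0" "a \<odot>\<^bsub>UU\<^esub> cl x = cl (scal a * x)"
proof -
  interpret I: ideal I "ring_of_type_algebra :: ('i U_gen list \<Rightarrow>\<^sub>0 'k) ring" by (rule ideal_I)
  let ?Q = "ring_of_type_algebra Quot I"
  have eq: "carrier UU = carrier ?Q" "monoid.mult UU = monoid.mult ?Q" "add UU = add ?Q" "\<one>\<^bsub>UU\<^esub> = \<one>\<^bsub>?Q\<^esub>"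
    "\<zero>\<^bsub>UU\<^esub> = \<zero>\<^bsub>?Q\<^esub>" "a \<odot>\<^bsub>UU\<^esub> z = cl (scal a) \<otimes>\<^bsub>?Q\<^esub> z" for a z
    by (simp_all add: U_def ring.defs module.defs)
  have hom: "cl \<in> ring_hom ring_of_type_algebra ?Q"
    using I.rcos_ring_hom by (simp add: U_class_def[abs_def])
  show "carrier UU = range cl" by (auto simp: eq FactRing_def A_RCOSETS_def' U_class_def)
  show m: "cl x \<otimes>\<^bsub>UU\<^esub> cl y = cl (x * y)" for x y
    using ring_hom_mult[OF hom, of x y] by (simp add: eq)
  show "cl x \<oplus>\<^bsub>UU\<^esub> cl y = cl (x + y)"
    using ring_hom_add[OF hom, of x y] by (simp add: eq)
  show "\<one>\<^bsub>UU\<^esub> = cl 1" using ring_hom_one[OF hom] by (simp add: eq)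
  show "\<zero>\<^bsub>UU\<^esub> = cl 0"
    using I.a_coset_add_zero[of I] I.a_subset by (simp add: eq FactRing_def U_class_def)
  show "a \<odot>\<^bsub>UU\<^esub> cl x = cl (scal a * x)" using m by (simp add: eq)
qed

lemma cl_closed [simp]: "cl x \<in> carrier UU"
  by (simp add: U_simps)

lemma U_cases: "u \<in> carrier UU \<Longrightarrow> (\<And>x. u = cl x \<Longrightarrow> P) \<Longrightarrow> P"
  by (auto simp: U_simps)

lemma k_algebra_U: "k_algebra UU"
proof -
  have "abelian_group UU"
  proof (rule abelian_groupI)
    fix x assume "x \<in> carrier UU"
    then obtain y where "x = cl y" by (rule U_cases)
    moreover have "cl (- y) \<oplus>\<^bsub>UU\<^esub> cl y = \<zero>\<^bsub>UU\<^esub>" by (simp add: U_simps)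
    ultimately show "\<exists>z\<in>carrier UU. z \<oplus>\<^bsub>UU\<^esub> x = \<zero>\<^bsub>UU\<^esub>" using cl_closed by blast
  qed (auto elim!: U_cases simp: U_simps(2-6) add_ac)
  moreover have "monoid UU"
    by (rule monoidI) (auto elim!: U_cases simp: U_simps(2-6) mult.assoc)
  moreover have "cl x \<otimes>\<^bsub>UU\<^esub> (a \<odot>\<^bsub>UU\<^esub> cl y) = a \<odot>\<^bsub>UU\<^esub> (cl x \<otimes>\<^bsub>UU\<^esub> cl y)" for x y a
    by (simp add: U_simps(2-6) scal_commute_left[of x])
  ultimately show ?thesis
    by (intro k_algebra.intro ringI k_algebra_axioms.intro)
      (auto elim!: U_cases simp: U_simps(2-5) U_simps(6)[of a "_ * _" for a] distrib_left distrib_right,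
       auto simp: U_simps distrib_left distrib_right scal_add mult.assoc)
qed

end

sublocale pre_nichols \<subseteq> U: k_algebra "U chi J"
  by (rule k_algebra_U)

context pre_nichols
begin

lemma cl_minus: "cl x \<ominus>\<^bsub>UU\<^esub> cl y = cl (x - y)"
proof -
  have "\<ominus>\<^bsub>UU\<^esub> cl y = cl (- y)" by (rule U.minus_equality) (simp_all add: U_simps)
  then show ?thesis by (simp add: a_minus_def U_simps)
qed

abbreviation "eE \<equiv> U_E chi J"
abbreviation "eF \<equiv> U_F chi J"
abbreviation "eK \<equiv> U_K chi J"
abbreviation "eKi \<equiv> U_Kinv chi J"

lemmas gen_defs = U_E_def U_F_def U_K_def U_Kinv_def

lemma gen_closed [simp]:
  "eE i \<in> carrier UU" "eF i \<in> carrier UU" "eK i \<in> carrier UU" "eKi i \<in> carrier UU"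
  by (simp_all add: gen_defs)

lemma cl_rel: "x - y \<in> U_rels chi \<Longrightarrow> cl x = cl y"
  by (simp add: cl_eq_iff I_rels)

lemma U_relsI:
  "gen (Kgen i) * gen (Kinvgen i) - 1 \<in> U_rels chi"
  "gen (Kinvgen i) * gen (Kgen i) - 1 \<in> U_rels chi"
  "gen (Kgen i) * gen (Kgen j) - gen (Kgen j) * gen (Kgen i) \<in> U_rels chi"
  "gen (Kgen i) * gen (Egen j) - scal (q i j) * gen (Egen j) * gen (Kgen i) \<in> U_rels chi"
  "gen (Kgen i) * gen (Fgen j) - scal (inverse (q i j)) * gen (Fgen j) * gen (Kgen i) \<in> U_rels chi"
  "gen (Egen i) * gen (Fgen j) - gen (Fgen j) * gen (Egen i) -
    (if i = j then gen (Kgen i) - gen (Kinvgen i) else 0) \<in> U_rels chi"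
  unfolding U_rels_def by blast+

lemma K_Kinv: "eK i \<otimes>\<^bsub>UU\<^esub> eKi i = \<one>\<^bsub>UU\<^esub>" "eKi i \<otimes>\<^bsub>UU\<^esub> eK i = \<one>\<^bsub>UU\<^esub>"
  using cl_rel[OF U_relsI(1)] cl_rel[OF U_relsI(2)] by (simp_all add: gen_defs U_simps)

lemma K_K: "eK i \<otimes>\<^bsub>UU\<^esub> eK j = eK j \<otimes>\<^bsub>UU\<^esub> eK i"
  using cl_rel[OF U_relsI(3)] by (simp add: gen_defs U_simps)

lemma K_E: "eK i \<otimes>\<^bsub>UU\<^esub> eE j = q i j \<odot>\<^bsub>UU\<^esub> (eE j \<otimes>\<^bsub>UU\<^esub> eK i)"
  using cl_rel[OF U_relsI(4)] by (simp add: gen_defs U_simps mult.assoc)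

lemma K_F: "eK i \<otimes>\<^bsub>UU\<^esub> eF j = inverse (q i j) \<odot>\<^bsub>UU\<^esub> (eF j \<otimes>\<^bsub>UU\<^esub> eK i)"
  using cl_rel[OF U_relsI(5)] by (simp add: gen_defs U_simps mult.assoc)

lemma E_F:
  "eE i \<otimes>\<^bsub>UU\<^esub> eF j = (eF j \<otimes>\<^bsub>UU\<^esub> eE i) \<oplus>\<^bsub>UU\<^esub> (if i = j then eK i \<ominus>\<^bsub>UU\<^esub> eKi i else \<zero>\<^bsub>UU\<^esub>)"
proof -
  have "cl (gen (Egen i) * gen (Fgen j)) = cl (gen (Fgen j) * gen (Egen i) +
      (if i = j then gen (Kgen i) - gen (Kinvgen i) else 0))"
    using U_relsI(6)[of i j] by (intro cl_rel) (simp add: diff_diff_eq)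
  then show ?thesis by (auto simp: gen_defs U_simps cl_minus)
qed

text \<open>One conjugation argument gives all the commutation rules of K_i^{-1} from those of
  K_i.\<close>

lemma inverse_commute:
  assumes "k \<in> carrier UU" "k' \<in> carrier UU" "x \<in> carrier UU" "k \<otimes>\<^bsub>UU\<^esub> k' = \<one>\<^bsub>UU\<^esub>" "k' \<otimes>\<^bsub>UU\<^esub> k = \<one>\<^bsub>UU\<^esub>"
    and "k \<otimes>\<^bsub>UU\<^esub> x = s \<odot>\<^bsub>UU\<^esub> (x \<otimes>\<^bsub>UU\<^esub> k)" "s \<noteq> 0"
  shows "k' \<otimes>\<^bsub>UU\<^esub> x = inverse s \<odot>\<^bsub>UU\<^esub> (x \<otimes>\<^bsub>UU\<^esub> k')"
proof -
  have "x \<otimes>\<^bsub>UU\<^esub> k' = k' \<otimes>\<^bsub>UU\<^esub> (k \<otimes>\<^bsub>UU\<^esub> x) \<otimes>\<^bsub>UU\<^esub> k'"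
    using assms(1-5) by (simp flip: U.m_assoc)
  also have "\<dots> = s \<odot>\<^bsub>UU\<^esub> (k' \<otimes>\<^bsub>UU\<^esub> x \<otimes>\<^bsub>UU\<^esub> (k \<otimes>\<^bsub>UU\<^esub> k'))"
    using assms(1-3) by (simp add: assms(6) U.smult_mult_left U.smult_mult_right U.m_assoc)
  finally show ?thesis using assms by (simp add: U.smult_smult)
qed

lemma Kinv_E: "eKi i \<otimes>\<^bsub>UU\<^esub> eE j = inverse (q i j) \<odot>\<^bsub>UU\<^esub> (eE j \<otimes>\<^bsub>UU\<^esub> eKi i)"
  by (rule inverse_commute[OF _ _ _ K_Kinv K_E]) simp_all

lemma Kinv_F: "eKi i \<otimes>\<^bsub>UU\<^esub> eF j = q i j \<odot>\<^bsub>UU\<^esub> (eF j \<otimes>\<^bsub>UU\<^esub> eKi i)"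
  using inverse_commute[OF _ _ _ K_Kinv K_F] by simp

lemma Kinv_K: "eKi i \<otimes>\<^bsub>UU\<^esub> eK j = eK j \<otimes>\<^bsub>UU\<^esub> eKi i"
  using inverse_commute[OF _ _ _ K_Kinv[of i], where x = "eK j" and s = 1] K_K by simp

lemma Kinv_Kinv: "eKi i \<otimes>\<^bsub>UU\<^esub> eKi j = eKi j \<otimes>\<^bsub>UU\<^esub> eKi i"
  using inverse_commute[OF _ _ _ K_Kinv[of i], where x = "eKi j" and s = 1] Kinv_K[of j i] by simp

subsection \<open>Monomials in the torus\<close>

text \<open>The degree and the torus element are tied by a relation, because torus elements arise as
  words in the \<open>eK i\<close> and \<open>eKi i\<close>. That the degree determines the element
  is \<open>Kmon_unique\<close>.\<close>

inductive Kmon :: "int ^ 'i \<Rightarrow> ('i U_gen list \<Rightarrow>\<^sub>0 'k) set \<Rightarrow> bool" where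
  Kmon_one: "Kmon 0 \<one>\<^bsub>UU\<^esub>"
| Kmon_K: "Kmon a t \<Longrightarrow> Kmon (a + \<alpha> i) (t \<otimes>\<^bsub>UU\<^esub> eK i)"
| Kmon_Kinv: "Kmon a t \<Longrightarrow> Kmon (a - \<alpha> i) (t \<otimes>\<^bsub>UU\<^esub> eKi i)"

lemma Kmon_closed: "Kmon a t \<Longrightarrow> t \<in> carrier UU"
  by (induction rule: Kmon.induct) auto

lemma Kmon_gens: "Kmon (\<alpha> i) (eK i)" "Kmon (- \<alpha> i) (eKi i)"
  using Kmon_K[OF Kmon_one, of i] Kmon_Kinv[OF Kmon_one, of i] by simp_all

lemma Kmon_rep: "Kmon a t \<Longrightarrow> \<exists>x. t = cl x \<and> (\<forall>f. rho x f = (\<lambda>b. f (b - a)))"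
proof (induction rule: Kmon.induct)
  case Kmon_one
  show ?case by (intro exI[of _ 1]) (simp add: U_simps)
next
  case (Kmon_K a t i)
  then obtain x where "t = cl x" "\<forall>f. rho x f = (\<lambda>b. f (b - a))" by blast
  then show ?case
    by (intro exI[of _ "x * gen (Kgen i)"]) (simp add: gen_defs U_simps rho_mult diff_diff_eq)
next
  case (Kmon_Kinv a t i)
  then obtain x where "t = cl x" "\<forall>f. rho x f = (\<lambda>b. f (b - a))" by blast
  then show ?case
    by (intro exI[of _ "x * gen (Kinvgen i)"])
      (simp add: gen_defs U_simps rho_mult algebra_simps)
qed

lemma Kmon_mult: "Kmon b s \<Longrightarrow> Kmon a t \<Longrightarrow> Kmon (a + b) (t \<otimes>\<^bsub>UU\<^esub> s)"
proof (induction rule: Kmon.induct)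
  case Kmon_one
  then show ?case by (simp add: Kmon_closed)
next
  case (Kmon_K b s i)
  then show ?case using Kmon.Kmon_K[of "a + b" "t \<otimes>\<^bsub>UU\<^esub> s" i]
    by (simp add: Kmon_closed U.m_assoc add.assoc)
next
  case (Kmon_Kinv b s i)
  then show ?case using Kmon.Kmon_Kinv[of "a + b" "t \<otimes>\<^bsub>UU\<^esub> s" i]
    by (simp add: Kmon_closed U.m_assoc add_diff_eq)
qed

lemma Kmon_commute_gens: "Kmon a t \<Longrightarrow> t \<otimes>\<^bsub>UU\<^esub> eK i = eK i \<otimes>\<^bsub>UU\<^esub> t \<and> t \<otimes>\<^bsub>UU\<^esub> eKi i = eKi i \<otimes>\<^bsub>UU\<^esub> t"
proof (induction rule: Kmon.induct)
  case (Kmon_K a t j)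
  then show ?case using Kmon_closed[OF Kmon_K(1)]
    by (simp add: U.m_assoc K_K[of j] Kinv_K[symmetric]) (simp flip: U.m_assoc)
next
  case (Kmon_Kinv a t j)
  then show ?case using Kmon_closed[OF Kmon_Kinv(1)]
    by (simp add: U.m_assoc Kinv_K[of j] Kinv_Kinv[of j]) (simp flip: U.m_assoc)
qed simp

lemma Kmon_E: "Kmon a t \<Longrightarrow> t \<otimes>\<^bsub>UU\<^esub> eE j = chi a (\<alpha> j) \<odot>\<^bsub>UU\<^esub> (eE j \<otimes>\<^bsub>UU\<^esub> t)"
proof (induction rule: Kmon.induct)
  case (Kmon_K a t i)
  note t = Kmon_closed[OF Kmon_K(1)]
  have "t \<otimes>\<^bsub>UU\<^esub> eK i \<otimes>\<^bsub>UU\<^esub> eE j = q i j \<odot>\<^bsub>UU\<^esub> ((t \<otimes>\<^bsub>UU\<^esub> eE j) \<otimes>\<^bsub>UU\<^esub> eK i)"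
    using t by (simp add: U.m_assoc K_E U.smult_mult_right)
  then show ?case using t
    by (simp add: Kmon_K.IH U.smult_mult_left U.smult_smult U.m_assoc chi_add_left qmat_def mult.commute)
next
  case (Kmon_Kinv a t i)
  note t = Kmon_closed[OF Kmon_Kinv(1)]
  have "t \<otimes>\<^bsub>UU\<^esub> eKi i \<otimes>\<^bsub>UU\<^esub> eE j = inverse (q i j) \<odot>\<^bsub>UU\<^esub> ((t \<otimes>\<^bsub>UU\<^esub> eE j) \<otimes>\<^bsub>UU\<^esub> eKi i)"
    using t by (simp add: U.m_assoc Kinv_E U.smult_mult_right)
  then show ?case using t
    by (simp add: Kmon_Kinv.IH U.smult_mult_left U.smult_smult U.m_assoc chi_diff_left qmat_def divide_inverse mult.commute)
qed simp

lemma Kmon_F: "Kmon a t \<Longrightarrow> t \<otimes>\<^bsub>UU\<^esub> eF j = inverse (chi a (\<alpha> j)) \<odot>\<^bsub>UU\<^esub> (eF j \<otimes>\<^bsub>UU\<^esub> t)"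
proof (induction rule: Kmon.induct)
  case (Kmon_K a t i)
  note t = Kmon_closed[OF Kmon_K(1)]
  have "t \<otimes>\<^bsub>UU\<^esub> eK i \<otimes>\<^bsub>UU\<^esub> eF j = inverse (q i j) \<odot>\<^bsub>UU\<^esub> ((t \<otimes>\<^bsub>UU\<^esub> eF j) \<otimes>\<^bsub>UU\<^esub> eK i)"
    using t by (simp add: U.m_assoc K_F U.smult_mult_right)
  then show ?case using t
    by (simp add: Kmon_K.IH U.smult_mult_left U.smult_smult U.m_assoc chi_add_left qmat_def mult.commute)
next
  case (Kmon_Kinv a t i)
  note t = Kmon_closed[OF Kmon_Kinv(1)]
  have "t \<otimes>\<^bsub>UU\<^esub> eKi i \<otimes>\<^bsub>UU\<^esub> eF j = q i j \<odot>\<^bsub>UU\<^esub> ((t \<otimes>\<^bsub>UU\<^esub> eF j) \<otimes>\<^bsub>UU\<^esub> eKi i)"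
    using t by (simp add: U.m_assoc Kinv_F U.smult_mult_right)
  then show ?case using t
    by (simp add: Kmon_Kinv.IH U.smult_mult_left U.smult_smult U.m_assoc chi_diff_left qmat_def divide_inverse mult.commute)
qed simp

text \<open>A torus monomial is determined by its degree: it equals a product in which the \<open>K\<^sub>i\<close>
  are sorted.\<close>

definition Kpow :: "'i \<Rightarrow> int \<Rightarrow> ('i U_gen list \<Rightarrow>\<^sub>0 'k) set"
  where "Kpow i z = (if 0 \<le> z then eK i [^]\<^bsub>UU\<^esub> nat z else eKi i [^]\<^bsub>UU\<^esub> nat (- z))"

definition Kprod :: "'i list \<Rightarrow> int ^ 'i \<Rightarrow> ('i U_gen list \<Rightarrow>\<^sub>0 'k) set"
  where "Kprod js a = foldr (\<lambda>i r. Kpow i (a $ i) \<otimes>\<^bsub>UU\<^esub> r) js \<one>\<^bsub>UU\<^esub>"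

lemma Kpow_closed [simp]: "Kpow i z \<in> carrier UU"
  by (simp add: Kpow_def del: pow_nat)

lemma Kprod_closed [simp]: "Kprod js a \<in> carrier UU"
  by (induction js) (simp_all add: Kprod_def)

lemma Kprod_Cons: "Kprod (j # js) a = Kpow j (a $ j) \<otimes>\<^bsub>UU\<^esub> Kprod js a"
  by (simp add: Kprod_def)

lemma Kpow_Suc: "Kpow i (z + 1) = Kpow i z \<otimes>\<^bsub>UU\<^esub> eK i"
proof (cases "0 \<le> z")
  case True
  then have "nat (z + 1) = Suc (nat z)" by simp
  then show ?thesis using True by (simp add: Kpow_def del: pow_nat)
next
  case False
  then have n: "nat (- z) = Suc (nat (- (z + 1)))" by simp
  have "Kpow i z \<otimes>\<^bsub>UU\<^esub> eK i = eKi i [^]\<^bsub>UU\<^esub> nat (- (z + 1))"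
    unfolding Kpow_def n using False by (simp add: U.m_assoc K_Kinv del: pow_nat)
  then show ?thesis using False by (auto simp: Kpow_def simp del: pow_nat)
qed

lemma Kpow_pred: "Kpow i (z - 1) = Kpow i z \<otimes>\<^bsub>UU\<^esub> eKi i"
  using Kpow_Suc[of i "z - 1"] by (simp add: U.m_assoc K_Kinv)

lemma Kmon_nat_pow: "\<exists>a. Kmon a (eK i [^]\<^bsub>UU\<^esub> (n::nat))" "\<exists>a. Kmon a (eKi i [^]\<^bsub>UU\<^esub> (n::nat))"
  by (induction n) (auto intro: Kmon.intros)

lemma Kmon_Kpow: "\<exists>a. Kmon a (Kpow i z)"
  using Kmon_nat_pow by (simp add: Kpow_def del: pow_nat)

lemma Kmon_Kprod: "\<exists>b. Kmon b (Kprod js a)"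
proof (induction js)
  case (Cons j js)
  then show ?case using Kmon_Kpow[of j "a $ j"] Kmon_mult unfolding Kprod_Cons by blast
qed (auto simp: Kprod_def intro: Kmon_one)

lemma Kprod_other: "i \<notin> set js \<Longrightarrow> Kprod js (a + axis i s) = Kprod js a"
  by (induction js) (auto simp: Kprod_Cons Kprod_def axis_def)

lemma Kprod_step:
  assumes "distinct js" "i \<in> set js"
  shows "Kprod js (a + \<alpha> i) = Kprod js a \<otimes>\<^bsub>UU\<^esub> eK i \<and> Kprod js (a + axis i (- 1)) = Kprod js a \<otimes>\<^bsub>UU\<^esub> eKi i"
  using assms
proof (induction js)
  case (Cons j js)
  show ?case
  proof (cases "i = j")
    case True
    obtain b where b: "Kmon b (Kprod js a)" using Kmon_Kprod by blast
    have "(a + \<alpha> j) $ j = a $ j + 1" "(a + axis j (- 1)) $ j = a $ j - 1" by (simp_all add: axis_def)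
    then show ?thesis
      using True Cons.prems Kmon_commute_gens[OF b, of j]
      by (simp add: Kprod_Cons Kprod_other Kpow_Suc Kpow_pred U.m_assoc)
  next
    case False
    then show ?thesis using Cons by (simp add: Kprod_Cons axis_def U.m_assoc)
  qed
qed simp

lemma Kmon_unique:
  assumes "Kmon a t" "Kmon a s" shows "t = s"
proof -
  obtain js where js: "distinct js" "set js = (UNIV :: 'i set)"
    using finite_distinct_list[OF finite[of "UNIV :: 'i set"]] by blast
  have one: "Kprod js (0 :: int ^ 'i) = \<one>\<^bsub>UU\<^esub>"
    by (induction js) (simp_all add: Kprod_def Kpow_def)
  have minus: "a - \<alpha> i = a + axis i (- 1)" for a and i :: 'i
    by (simp add: vec_eq_iff axis_def)
  have step: "Kprod js (a + \<alpha> i) = Kprod js a \<otimes>\<^bsub>UU\<^esub> eK i" "Kprod js (a - \<alpha> i) = Kprod js a \<otimes>\<^bsub>UU\<^esub> eKi i"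
    for a i unfolding minus using Kprod_step[OF js(1)] js(2) by blast+
  have "Kmon a t \<Longrightarrow> t = Kprod js a" for a t
    by (induction rule: Kmon.induct) (simp_all only: one step)
  then show ?thesis using assms by metis
qed

subsection \<open>Normal forms\<close>

abbreviation cF :: "('i list \<Rightarrow>\<^sub>0 'k) \<Rightarrow> ('i U_gen list \<Rightarrow>\<^sub>0 'k) set" where "cF x \<equiv> cl (iF x)"

lemma cF_Cons: "cF (gen i * x) = eF i \<otimes>\<^bsub>UU\<^esub> cF x"
  by (simp add: gen_defs U_simps map_gens_mult gen_def)

lemma cF_add: "cF (x + y) = cF x \<oplus>\<^bsub>UU\<^esub> cF y"
  by (simp add: U_simps map_gens_add)

lemma cF_scal: "cF (scal a * x) = a \<odot>\<^bsub>UU\<^esub> cF x"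
  by (simp add: U_simps map_gens_scal)

lemma cl_zero: "cl 0 = \<zero>\<^bsub>UU\<^esub>"
  by (simp add: U_simps)

lemma cl_one: "cl 1 = \<one>\<^bsub>UU\<^esub>"
  by (simp add: U_simps)

lemma cF_mult: "cF (x * y) = cF x \<otimes>\<^bsub>UU\<^esub> cF y"
  by (simp add: U_simps map_gens_mult)

lemma cF_gen: "cF (gen i) = eF i"
  by (simp add: gen_defs gen_def)

lemma free_gen_induct [case_names zero add scal one gen]:
  fixes x :: "'g list \<Rightarrow>\<^sub>0 'k"
  assumes "P 0" "\<And>x y. P x \<Longrightarrow> P y \<Longrightarrow> P (x + y)" "\<And>a x. P x \<Longrightarrow> P (scal a * x)" "P 1"
    and "\<And>i x. P x \<Longrightarrow> P (gen i * x)"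
  shows "P x"
proof (induction x rule: free_induct)
  case (single w a)
  have "P (Poly_Mapping.single w 1)"
  proof (induction w)
    case (Cons i w)
    then show ?case using assms(5)[of "Poly_Mapping.single w 1" i] by (simp add: gen_def)
  qed (use assms(4) in \<open>simp flip: one_eq_single\<close>)
  then show ?case using assms(3)[of "Poly_Mapping.single w 1" a] by simp
qed (use assms in auto)

lemma Kmon_cF:
  assumes "Kmon a t" shows "t \<otimes>\<^bsub>UU\<^esub> cF x = cF (chi_tw (- a) x) \<otimes>\<^bsub>UU\<^esub> t"
proof (induction x rule: free_gen_induct)
  note t = Kmon_closed[OF assms]
  have inv: "chi (- a) d = inverse (chi a d)" for d
    using chi_diff_left[of 0 a d] by (simp add: divide_inverse)
  case (gen i x)
  have "t \<otimes>\<^bsub>UU\<^esub> cF (gen i * x) = (t \<otimes>\<^bsub>UU\<^esub> eF i) \<otimes>\<^bsub>UU\<^esub> cF x"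
    using t by (simp add: cF_Cons U.m_assoc)
  also have "\<dots> = inverse (chi a (\<alpha> i)) \<odot>\<^bsub>UU\<^esub> (eF i \<otimes>\<^bsub>UU\<^esub> (t \<otimes>\<^bsub>UU\<^esub> cF x))"
    using t by (simp add: Kmon_F[OF assms] U.smult_mult_left U.m_assoc)
  also have "\<dots> = cF (chi_tw (- a) (gen i * x)) \<otimes>\<^bsub>UU\<^esub> t"
    using t unfolding gen
    by (simp add: chi_tw_def tw_mult tw_gen inv mult.assoc cF_scal cF_Cons U.smult_mult_left U.m_assoc)
  finally show ?case .
qed (use Kmon_closed[OF assms] in \<open>simp_all add: chi_tw_def tw_add tw_scal cF_add cF_scal cl_zero cl_one
    U.l_distr U.r_distr U.smult_mult_left U.smult_mult_right\<close>)

lemma cF_Kmon: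
  assumes "Kmon a t" shows "cF x \<otimes>\<^bsub>UU\<^esub> t = t \<otimes>\<^bsub>UU\<^esub> cF (chi_tw a x)"
  by (simp add: Kmon_cF[OF assms] chi_tw_chi_tw chi_tw_0)

text \<open>\<open>rho\<close> is defined on the free algebra, so evaluating a normal form on
  \<open>vac\<close> needs representatives there. The chosen one acts as a pure shift by a. The
  choice is meaningful once some torus element has degree a, which \<open>nf\<close> demands on its
  support.\<close>

definition Krep :: "int ^ 'i \<Rightarrow> ('i U_gen list \<Rightarrow>\<^sub>0 'k)"
  where "Krep a = (SOME x. Kmon a (cl x) \<and> (\<forall>f. rho x f = (\<lambda>b. f (b - a))))"

lemma Krep:
  assumes "Kmon a t" shows "cl (Krep a) = t" "rho (Krep a) f = (\<lambda>b. f (b - a))"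
proof -
  have "\<exists>x. Kmon a (cl x) \<and> (\<forall>f. rho x f = (\<lambda>b. f (b - a)))"
    using Kmon_rep[OF assms] assms by metis
  from someI_ex[OF this, folded Krep_def] show "cl (Krep a) = t" "rho (Krep a) f = (\<lambda>b. f (b - a))"
    using assms Kmon_unique by auto
qed

text \<open>\<open>nf y g\<close> means \<open>y = \<Sum>\<^sub>a K\<^sup>a F\<^bsub>g(a)\<^esub>\<close>.\<close>

definition nf :: "('i U_gen list \<Rightarrow>\<^sub>0 'k) set \<Rightarrow> (int ^ 'i \<Rightarrow> 'i list \<Rightarrow>\<^sub>0 'k) \<Rightarrow> bool"
  where "nf y g \<longleftrightarrow> (\<exists>S. finite S \<and> (\<forall>a\<in>S. \<exists>t. Kmon a t) \<and> (\<forall>a. a \<notin> S \<longrightarrow> g a = 0) \<and>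
    y = cl (\<Sum>a\<in>S. Krep a * iF (g a)))"

text \<open>\<open>vac\<close> sits in torus degree 0, where the twist is trivial. So F-words
  reproduce their coefficient, and the shift by a carries it to the place a without overlap.\<close>

lemma nf_rep:
  assumes "nf y g" shows "\<exists>x. y = cl x \<and> rho x vac = g"
proof -
  obtain S where S: "finite S" "\<forall>a\<in>S. \<exists>t. Kmon a t" "\<forall>a. a \<notin> S \<longrightarrow> g a = 0"
    "y = cl (\<Sum>a\<in>S. Krep a * iF (g a))" using assms by (auto simp: nf_def)
  have "rho (\<Sum>a\<in>S'. Krep a * iF (g a)) vac = (\<lambda>b. if b \<in> S' then g b else 0)" if "S' \<subseteq> S" for S'
    using finite_subset[OF that S(1)] that
  proof (induction S')
    case (insert a S')
    obtain t where "Kmon a t" using insert S(2) by blast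
    then have "rho (Krep a * iF (g a)) vac = (\<lambda>b. if b = a then g a else 0)"
      by (auto simp: rho_mult Krep(2) rho_iF vac_def chi_tw_0)
    then show ?case using insert by (auto simp: rho_add fun_eq_iff)
  qed simp
  from this[of S] have "rho (\<Sum>a\<in>S. Krep a * iF (g a)) vac = g" using S(3) by auto
  then show ?thesis using S(4) by blast
qed

lemma nf_unique:
  assumes "nf y g" "nf y g'" shows "g b - g' b \<in> J"
proof -
  obtain x x' where x: "y = cl x" "rho x vac = g" "y = cl x'" "rho x' vac = g'"
    using nf_rep[OF assms(1)] nf_rep[OF assms(2)] by blast
  then have "x - x' \<in> I" using cl_eq_iff by metis
  from U_ideal_rho_vac[OF this] show ?thesis using x by (simp add: rho_diff)
qed

lemma nf_zero:
  assumes "nf y g" "\<And>b. g b \<in> J" shows "y = \<zero>\<^bsub>UU\<^esub>"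
proof -
  obtain S where S: "finite S" "y = cl (\<Sum>a\<in>S. Krep a * iF (g a))" using assms by (auto simp: nf_def)
  interpret I: ideal I "ring_of_type_algebra :: ('i U_gen list \<Rightarrow>\<^sub>0 'k) ring" by (rule ideal_I)
  have "(\<Sum>a\<in>S. Krep a * iF (g a)) \<in> I"
    using S(1) additive_subgroup.zero_closed[OF ideal.axioms(1)[OF ideal_I]]
      additive_subgroup.a_closed[OF ideal.axioms(1)[OF ideal_I]] I.I_l_closed[OF I_iF[OF assms(2)]]
    by (induction S) auto
  then show ?thesis using S(2) by (simp add: U_simps cl_eq_iff)
qed

lemma nf_superset:
  assumes "finite T" "S \<subseteq> T" "\<forall>a. a \<notin> S \<longrightarrow> g a = 0"
  shows "(\<Sum>a\<in>S. Krep a * iF (g a)) = (\<Sum>a\<in>T. Krep a * iF (g a))"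
  by (rule sum.mono_neutral_left) (use assms in auto)

lemma nf_add:
  assumes "nf y g" "nf y' g'" shows "nf (y \<oplus>\<^bsub>UU\<^esub> y') (\<lambda>a. g a + g' a)"
proof -
  obtain S where S: "finite S" "\<forall>a\<in>S. \<exists>t. Kmon a t" "\<forall>a. a \<notin> S \<longrightarrow> g a = 0"
    "y = cl (\<Sum>a\<in>S. Krep a * iF (g a))" using assms by (auto simp: nf_def)
  obtain S' where S': "finite S'" "\<forall>a\<in>S'. \<exists>t. Kmon a t" "\<forall>a. a \<notin> S' \<longrightarrow> g' a = 0"
    "y' = cl (\<Sum>a\<in>S'. Krep a * iF (g' a))" using assms by (auto simp: nf_def)
  have "y \<oplus>\<^bsub>UU\<^esub> y' = cl (\<Sum>a\<in>S \<union> S'. Krep a * iF (g a + g' a))"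
    using nf_superset[of "S \<union> S'" S g] nf_superset[of "S \<union> S'" S' g'] S S'
    by (simp add: U_simps map_gens_add distrib_left sum.distrib)
  then show ?thesis unfolding nf_def using S S' by (intro exI[of _ "S \<union> S'"]) auto
qed

lemma nf_smult:
  assumes "nf y g" shows "nf (s \<odot>\<^bsub>UU\<^esub> y) (\<lambda>a. scal s * g a)"
proof -
  obtain S where S: "finite S" "\<forall>a\<in>S. \<exists>t. Kmon a t" "\<forall>a. a \<notin> S \<longrightarrow> g a = 0"
    "y = cl (\<Sum>a\<in>S. Krep a * iF (g a))" using assms by (auto simp: nf_def)
  have "s \<odot>\<^bsub>UU\<^esub> y = cl (\<Sum>a\<in>S. Krep a * iF (scal s * g a))"
    using S by (simp add: U_simps map_gens_scal sum_distrib_left scal_commute_left)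
  then show ?thesis unfolding nf_def using S by (intro exI[of _ S]) auto
qed

lemma nf_Kmon:
  assumes "Kmon a t" shows "nf (t \<otimes>\<^bsub>UU\<^esub> cF x) (\<lambda>b. if b = a then x else 0)"
  unfolding nf_def using assms Krep(1)[OF assms]
  by (intro exI[of _ "{a}"]) (auto simp flip: U_simps(2))

lemma nf_null: "nf \<zero>\<^bsub>UU\<^esub> (\<lambda>b. 0)"
  unfolding nf_def by (intro exI[of _ "{}"]) (simp add: U_simps)

text \<open>D bounds the torus degrees and V the coefficients. Later D is the set of degrees of
  height zero and V prescribes the lengths of words.\<close>

lemma nf_span:
  assumes "y \<in> alg_span UU {t \<otimes>\<^bsub>UU\<^esub> cF x | a t x. Kmon a t \<and> a \<in> D \<and> x \<in> V}"
    and "0 \<in> V" "\<And>x x'. x \<in> V \<Longrightarrow> x' \<in> V \<Longrightarrow> x + x' \<in> V" "\<And>s x. x \<in> V \<Longrightarrow> scal s * x \<in> V"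
  shows "\<exists>g. nf y g \<and> (\<forall>a. g a \<in> V) \<and> (\<forall>a. a \<notin> D \<longrightarrow> g a = 0)"
proof -
  have c: "{t \<otimes>\<^bsub>UU\<^esub> cF x | a t x. Kmon a t \<and> a \<in> D \<and> x \<in> V} \<subseteq> carrier UU"
    by (auto dest: Kmon_closed)
  show ?thesis
    using assms(1) c
  proof (induction rule: U.alg_span_induct)
    case zero
    then show ?case using nf_null assms(2) by blast
  next
    case (add x y)
    then obtain g g' where "nf x g \<and> (\<forall>a. g a \<in> V) \<and> (\<forall>a. a \<notin> D \<longrightarrow> g a = 0)"
      "nf y g' \<and> (\<forall>a. g' a \<in> V) \<and> (\<forall>a. a \<notin> D \<longrightarrow> g' a = 0)" by blast
    then show ?case using nf_add[of x g y g'] assms(3) by (intro exI[of _ "\<lambda>a. g a + g' a"]) auto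
  next
    case (smult s x)
    then obtain g where "nf x g \<and> (\<forall>a. g a \<in> V) \<and> (\<forall>a. a \<notin> D \<longrightarrow> g a = 0)" by blast
    then show ?case using nf_smult[of x g s] assms(4) by (intro exI[of _ "\<lambda>a. scal s * g a"]) auto
  next
    case (base y)
    then obtain a t x where y: "y = t \<otimes>\<^bsub>UU\<^esub> cF x" "Kmon a t" "a \<in> D" "x \<in> V" by blast
    show ?case unfolding y(1)
      by (rule exI[of _ "\<lambda>b. if b = a then x else 0"]) (use nf_Kmon[OF y(2), of x] y assms(2) in auto)
  qed
qed

text \<open>\<open>U_minus\<close> is therefore exactly the tensor algebra modulo J: no further
  relations among the F's appear in \<open>U\<close>.\<close>

lemma cF_eq_iff: "cF x = cF y \<longleftrightarrow> x - y \<in> J"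
proof
  assume "cF x = cF y"
  then show "x - y \<in> J"
    using nf_unique[of "cF x" _ "\<lambda>b. if b = 0 then y else 0" 0] nf_Kmon[OF Kmon_one, of x]
      nf_Kmon[OF Kmon_one, of y] by force
next
  assume "x - y \<in> J"
  then show "cF x = cF y" using I_iF by (simp add: cl_eq_iff flip: map_gens_diff)
qed

lemma U_minus_eq: "U_minus chi J = range cF"
proof
  have "U.subalgebra (range cF)"
  proof (rule U.subalgebraI, rule U.subspI)
    show "\<zero>\<^bsub>UU\<^esub> \<in> range cF" "\<one>\<^bsub>UU\<^esub> \<in> range cF" by (simp_all add: range_eqI[of _ _ 0] range_eqI[of _ _ 1] cl_zero cl_one)
    show "x \<oplus>\<^bsub>UU\<^esub> y \<in> range cF" "x \<otimes>\<^bsub>UU\<^esub> y \<in> range cF" if "x \<in> range cF" "y \<in> range cF" for x y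
      using that by (auto simp flip: cF_add cF_mult)
    show "a \<odot>\<^bsub>UU\<^esub> x \<in> range cF" if "x \<in> range cF" for a x
      using that by (auto simp flip: cF_scal)
  qed auto
  moreover have "range eF \<subseteq> range cF" by (auto simp flip: cF_gen)
  ultimately show "U_minus chi J \<subseteq> range cF"
    unfolding U_minus_def by (rule U.subalg_least)
  have s: "U.subalgebra (U_minus chi J)" unfolding U_minus_def by (rule U.subalgebra_subalg) auto
  note ss = U.subalgebraD[OF s] U.subspD[OF U.subalgebraD(1)[OF s]]
  have "cF x \<in> U_minus chi J" for x
    by (induction x rule: free_gen_induct)
      (use ss U.subalg_base[of _ "range eF"] in \<open>auto simp: cl_zero cF_add cF_scal cl_one cF_Cons U_minus_def\<close>)
  then show "range cF \<subseteq> U_minus chi J" by blast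
qed

text \<open>Moving F_j past K_i or K_i^{-1} gives q i j or its inverse, and E_i F_i adds K_i -
  K_i^{-1}. These are the recursions of \<open>dp\<close> and \<open>dm\<close>; with both torus
  factors on the left, \<open>dm\<close> appears untwisted.\<close>

lemma E_cF:
  "eE i \<otimes>\<^bsub>UU\<^esub> cF x = (cF x \<otimes>\<^bsub>UU\<^esub> eE i) \<oplus>\<^bsub>UU\<^esub>
    ((eK i \<otimes>\<^bsub>UU\<^esub> cF (dp i x)) \<ominus>\<^bsub>UU\<^esub> (eKi i \<otimes>\<^bsub>UU\<^esub> cF (dm i x)))"
proof (induction x rule: free_gen_induct)
  case (gen j x)
  have "eE i \<otimes>\<^bsub>UU\<^esub> cF (gen j * x) = (eE i \<otimes>\<^bsub>UU\<^esub> eF j) \<otimes>\<^bsub>UU\<^esub> cF x"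
    by (simp add: cF_Cons U.m_assoc)
  also have "\<dots> = (eF j \<otimes>\<^bsub>UU\<^esub> (eE i \<otimes>\<^bsub>UU\<^esub> cF x)) \<oplus>\<^bsub>UU\<^esub>
      (if i = j then (eK i \<otimes>\<^bsub>UU\<^esub> cF x) \<ominus>\<^bsub>UU\<^esub> (eKi i \<otimes>\<^bsub>UU\<^esub> cF x) else \<zero>\<^bsub>UU\<^esub>)"
    by (simp add: E_F U.l_distr U.m_assoc U.diff_distrib_left)
  also have "eF j \<otimes>\<^bsub>UU\<^esub> (eE i \<otimes>\<^bsub>UU\<^esub> cF x) = (cF (gen j * x) \<otimes>\<^bsub>UU\<^esub> eE i) \<oplus>\<^bsub>UU\<^esub>
      (((eF j \<otimes>\<^bsub>UU\<^esub> eK i) \<otimes>\<^bsub>UU\<^esub> cF (dp i x)) \<ominus>\<^bsub>UU\<^esub> ((eF j \<otimes>\<^bsub>UU\<^esub> eKi i) \<otimes>\<^bsub>UU\<^esub> cF (dm i x)))"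
    unfolding gen by (simp add: cF_Cons U.m_assoc U.r_distr U.diff_distrib_right)
  also have "eF j \<otimes>\<^bsub>UU\<^esub> eK i = q i j \<odot>\<^bsub>UU\<^esub> (eK i \<otimes>\<^bsub>UU\<^esub> eF j)"
    by (simp add: K_F U.smult_smult)
  also have "eF j \<otimes>\<^bsub>UU\<^esub> eKi i = inverse (q i j) \<odot>\<^bsub>UU\<^esub> (eKi i \<otimes>\<^bsub>UU\<^esub> eF j)"
    by (simp add: Kinv_F U.smult_smult)
  finally show ?case
    by (cases "i = j")
      (simp_all add: dp_gen dm_gen cF_add cF_scal cF_Cons cl_zero U.smult_mult_left U.smult_mult_right
        U.r_distr U.m_assoc U.minus_eq U.minus_add U.a_ac)
next
  case (add x y)
  have 4: "(a \<oplus>\<^bsub>UU\<^esub> b) \<oplus>\<^bsub>UU\<^esub> (a' \<oplus>\<^bsub>UU\<^esub> b') = (a \<oplus>\<^bsub>UU\<^esub> a') \<oplus>\<^bsub>UU\<^esub> (b \<oplus>\<^bsub>UU\<^esub> b')"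
    if "a \<in> carrier UU" "b \<in> carrier UU" "a' \<in> carrier UU" "b' \<in> carrier UU" for a b a' b'
    using that by (simp add: U.a_ac)
  show ?case
    by (simp add: cF_add U.r_distr add dp_add dm_add U.diff_diff_add U.l_distr 4)
next
  case (scal a x)
  show ?case
    by (simp add: cF_scal U.smult_mult_right scal U.smult_add dp_scal dm_scal U.smult_diff U.smult_mult_left)
qed (simp_all add: cl_zero cl_one U.minus_eq)

text \<open>The convention for the right skew derivation has K_i^{-1} on the right. Moving it across
  is the source of the twist of \<open>dm\<close>.\<close>

lemma E_cF_skew:
  "eE i \<otimes>\<^bsub>UU\<^esub> cF x \<ominus>\<^bsub>UU\<^esub> cF x \<otimes>\<^bsub>UU\<^esub> eE i =
    eK i \<otimes>\<^bsub>UU\<^esub> cF (dp i x) \<ominus>\<^bsub>UU\<^esub> cF (chi_tw (\<alpha> i) (dm i x)) \<otimes>\<^bsub>UU\<^esub> eKi i"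
proof -
  have "(x \<oplus>\<^bsub>UU\<^esub> y) \<ominus>\<^bsub>UU\<^esub> x = y" if "x \<in> carrier UU" "y \<in> carrier UU" for x y
    using that by (simp add: U.minus_eq U.a_comm[of x y] U.a_assoc U.r_neg)
  then show ?thesis using Kmon_cF[OF Kmon_gens(2), of i "dm i x"] by (simp add: E_cF)
qed

lemma linear_on_U_minus:
  assumes "\<And>x. f (cF x) = cF (d x)" "\<And>x y. d (x + y) = d x + d y" "\<And>a x. d (scal a * x) = scal a * d x"
  shows "linear_on UU (U_minus chi J) UU (U_minus chi J) f"
  unfolding linear_on_def U_minus_eq
  using assms by (auto simp flip: cF_add cF_scal)

text \<open>Once K_i^{-1} is moved to the left, the two terms sit in the torus degrees \<alpha>_i
  and -\<alpha>_i. These differ, since 1 and -1 are distinct integers, so the two coefficients are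
  determined separately modulo J.\<close>

lemma skew_derivations_unique:
  assumes "skew_derivations chi J i l r" shows "l (cF x) = cF (dp i x)" "r (cF x) = cF (chi_tw (\<alpha> i) (dm i x))"
proof -
  have sk: "linear_on UU (U_minus chi J) UU (U_minus chi J) l" "linear_on UU (U_minus chi J) UU (U_minus chi J) r"
    "eE i \<otimes>\<^bsub>UU\<^esub> cF x \<ominus>\<^bsub>UU\<^esub> cF x \<otimes>\<^bsub>UU\<^esub> eE i = eK i \<otimes>\<^bsub>UU\<^esub> l (cF x) \<ominus>\<^bsub>UU\<^esub> r (cF x) \<otimes>\<^bsub>UU\<^esub> eKi i"
    using assms by (auto simp: skew_derivations_def U_minus_eq)
  then have "l (cF x) \<in> range cF" "r (cF x) \<in> range cF"
    unfolding linear_on_def U_minus_eq by blast+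
  then obtain y z where yz: "l (cF x) = cF y" "r (cF x) = cF z" by blast
  have nf: "nf (eK i \<otimes>\<^bsub>UU\<^esub> cF u \<ominus>\<^bsub>UU\<^esub> cF v \<otimes>\<^bsub>UU\<^esub> eKi i)
      (\<lambda>b. (if b = \<alpha> i then u else 0) + scal (- 1) * (if b = - \<alpha> i then chi_tw (- \<alpha> i) v else 0))" for u v
  proof -
    have "eK i \<otimes>\<^bsub>UU\<^esub> cF u \<ominus>\<^bsub>UU\<^esub> cF v \<otimes>\<^bsub>UU\<^esub> eKi i =
      (eK i \<otimes>\<^bsub>UU\<^esub> cF u) \<oplus>\<^bsub>UU\<^esub> (- 1) \<odot>\<^bsub>UU\<^esub> (eKi i \<otimes>\<^bsub>UU\<^esub> cF (chi_tw (- \<alpha> i) v))"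
      by (simp add: cF_Kmon[OF Kmon_gens(2)] U.minus_one_smult U.minus_eq)
    then show ?thesis
      using nf_add[OF nf_Kmon[OF Kmon_gens(1)] nf_smult[OF nf_Kmon[OF Kmon_gens(2)]]] by simp
  qed
  have eq: "eK i \<otimes>\<^bsub>UU\<^esub> cF (dp i x) \<ominus>\<^bsub>UU\<^esub> cF (chi_tw (\<alpha> i) (dm i x)) \<otimes>\<^bsub>UU\<^esub> eKi i =
      eK i \<otimes>\<^bsub>UU\<^esub> cF y \<ominus>\<^bsub>UU\<^esub> cF z \<otimes>\<^bsub>UU\<^esub> eKi i"
    using sk(3) E_cF_skew yz by simp
  have "(\<alpha> i :: int ^ 'i) $ i \<noteq> (- \<alpha> i) $ i" by (simp add: axis_def)
  then have ne: "(\<alpha> i :: int ^ 'i) \<noteq> - \<alpha> i" "- \<alpha> i \<noteq> (\<alpha> i :: int ^ 'i)" by metis+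
  note u = nf_unique[OF nf[of "dp i x" "chi_tw (\<alpha> i) (dm i x)", unfolded eq] nf[of y z]]
  have "dp i x - y \<in> J" using u[of "\<alpha> i"] ne by simp
  then show "l (cF x) = cF (dp i x)" using cF_eq_iff[of "dp i x" y] yz by simp
  have "chi_tw (- \<alpha> i) z - chi_tw (- \<alpha> i) (chi_tw (\<alpha> i) (dm i x)) \<in> J"
    using u[of "- \<alpha> i"] ne by (simp add: scal_minus)
  then have "chi_tw (- \<alpha> i) (z - chi_tw (\<alpha> i) (dm i x)) \<in> J"
    by (simp add: chi_tw_def tw_diff)
  then show "r (cF x) = cF (chi_tw (\<alpha> i) (dm i x))" using cF_eq_iff yz by (simp add: J_chi_tw_iff)
qed

lemma dL_cF: "dL chi J i (cF x) = cF (dp i x)"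
proof -
  \<comment> \<open>\<open>x0\<close> picks a representative in the tensor algebra; the value of l
    or r does not depend on it, because the derivations and twists preserve J.\<close>
  define x0 where "x0 f = (SOME x. f = cF x)" for f
  have m: "cF x \<in> U_minus chi J" for x by (auto simp: U_minus_eq)
  have x0: "cF (x0 (cF x)) = cF x" for x unfolding x0_def by (metis (mono_tags) someI)
  define l where "l = restrict (\<lambda>f. cF (dp i (x0 f))) (U_minus chi J)"
  define r where "r = restrict (\<lambda>f. cF (chi_tw (\<alpha> i) (dm i (x0 f)))) (U_minus chi J)"
  have l: "l (cF x) = cF (dp i x)" for x
    using x0[of x] J_dp[of "x0 (cF x) - x"] by (simp add: l_def m cF_eq_iff dp_diff)
  have r: "r (cF x) = cF (chi_tw (\<alpha> i) (dm i x))" for x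
  proof -
    have "chi_tw (\<alpha> i) (dm i (x0 (cF x) - x)) \<in> J"
      using x0[of x] by (intro J_chi_tw J_dm) (simp add: cF_eq_iff)
    then show ?thesis by (simp add: r_def m cF_eq_iff dm_diff chi_tw_def tw_diff)
  qed
  have "linear_on UU (U_minus chi J) UU (U_minus chi J) l" "linear_on UU (U_minus chi J) UU (U_minus chi J) r"
    by (rule linear_on_U_minus, fact l, fact dp_add, fact dp_scal)
      (rule linear_on_U_minus, fact r, simp_all add: dm_add dm_scal chi_tw_def tw_add tw_scal)
  then have sk: "skew_derivations chi J i l r"
    unfolding skew_derivations_def using E_cF_skew l r by (simp add: U_minus_eq)
  have uniq: "(l', r') = (l, r)"
    if "l' \<in> extensional (U_minus chi J)" "r' \<in> extensional (U_minus chi J)" "skew_derivations chi J i l' r'"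
    for l' r'
  proof -
    have "l' f = l f \<and> r' f = r f" for f
    proof (cases "f \<in> U_minus chi J")
      case True
      then obtain y where "f = cF y" by (auto simp: U_minus_eq)
      then show ?thesis using skew_derivations_unique[OF that(3)] l r by simp
    next
      case False
      then show ?thesis using that by (simp add: extensional_def l_def r_def)
    qed
    then show ?thesis by auto
  qed
  have ext: "l \<in> extensional (U_minus chi J)" "r \<in> extensional (U_minus chi J)"
    by (simp_all add: l_def r_def)
  have "(THE (l, r). l \<in> extensional (U_minus chi J) \<and> r \<in> extensional (U_minus chi J) \<and>
      skew_derivations chi J i l r) = (l, r)"
  proof (rule the_equality)
    fix p assume "case p of (l, r) \<Rightarrow> l \<in> extensional (U_minus chi J) \<and>
      r \<in> extensional (U_minus chi J) \<and> skew_derivations chi J i l r"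
    then show "p = (l, r)" using uniq[of "fst p" "snd p"] by (simp add: case_prod_beta)
  qed (use sk ext in simp)
  then show ?thesis by (simp add: dL_def l)
qed

end

section \<open>The coideal subalgebra\<close>

context pre_nichols
begin

lemma chi_tw_scal: "chi_tw a (scal s * x) = scal s * chi_tw a x"
  by (simp only: chi_tw_def tw_scal)

text \<open>The derivation removes one letter j, and with it the factor chi a (\<alpha> j) that the
  twist had given to this letter. For a = \<alpha> i this is the constant q i j of the star
  product.\<close>

lemma dp_chi_tw: "dp j (chi_tw a x) = scal (chi a (\<alpha> j)) * chi_tw a (dp j x)"
proof (induction x rule: free_gen_induct)
  case (gen i x)
  have "dp j (chi_tw a (gen i * x)) = scal (chi a (\<alpha> i)) *
      (scal (q j i) * (gen i * dp j (chi_tw a x)) + (if j = i then chi_tw a x else 0))"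
    by (simp add: chi_tw_def tw_mult tw_gen mult.assoc dp_scal dp_gen)
  also have "\<dots> = scal (chi a (\<alpha> j)) * chi_tw a (dp j (gen i * x))"
    unfolding gen
    by (auto simp: dp_gen chi_tw_def tw_add tw_scal tw_mult tw_gen mult.assoc distrib_left
        scal_commute_left[of "gen i"] mult_ac)
  finally show ?case .
qed (simp_all add: chi_tw_def tw_add dp_add distrib_left tw_scal dp_scal mult.commute)

end

section \<open>The torus part \<open>H_theta\<close>, torus heights and the grading of
  \<open>HU\<close>\<close>

locale quantum_symmetric = pre_nichols chi J
  for chi :: "int ^ 'i::finite \<Rightarrow> int ^ 'i \<Rightarrow> 'k::field" and J +
  fixes \<tau> :: "'i \<Rightarrow> 'i" and c :: "'i \<Rightarrow> 'k"
  assumes tau_tau [simp]: "\<tau> (\<tau> i) = i"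
begin

abbreviation "Hth \<equiv> H_theta chi J \<tau>"
abbreviation "Pol \<equiv> U_poly chi J \<tau>"
abbreviation "Cpl \<equiv> U_poly_compl chi J \<tau>"
abbreviation "eB \<equiv> B_gen chi J \<tau> c"
abbreviation "Et \<equiv> (\<lambda>i. eE i \<otimes>\<^bsub>UU\<^esub> eKi i)"
abbreviation "KK \<equiv> (\<lambda>i. eK i \<otimes>\<^bsub>UU\<^esub> eKi (\<tau> i))"

text \<open>Inverses are included: the inverse of \<open>KK i\<close> is
  \<open>KK (\<tau> i)\<close>, because \<tau> is an involution.\<close>

inductive Hmon :: "int ^ 'i \<Rightarrow> ('i U_gen list \<Rightarrow>\<^sub>0 'k) set \<Rightarrow> bool" where
  Hmon_one: "Hmon 0 \<one>\<^bsub>UU\<^esub>"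
| Hmon_step: "Hmon a t \<Longrightarrow> Hmon (a + \<alpha> i - \<alpha> (\<tau> i)) (t \<otimes>\<^bsub>UU\<^esub> KK i)"

text \<open>The height vanishes on the degrees of \<open>H_theta\<close>, drops by one under
  K_i^{-1}, and is the length on degrees of words. It separates \<open>HU\<close> from
  \<open>U_poly_compl\<close>, and words of different lengths from each other.\<close>

definition ht :: "int ^ 'i \<Rightarrow> int"
  where "ht a = (\<Sum>i\<in>UNIV. a $ i)"

lemma ht_simps [simp]: "ht 0 = 0" "ht (a + b) = ht a + ht b" "ht (a - b) = ht a - ht b"
  "ht (- a) = - ht a" "ht (\<alpha> i) = 1"
  by (simp_all add: ht_def sum.distrib sum_subtractf sum_negf axis_def)

lemma ht_word_deg: "ht (word_deg w) = int (length w)"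
  by (induction w) simp_all

lemma Hmon_Kmon: "Hmon a t \<Longrightarrow> Kmon a t"
  by (induction rule: Hmon.induct)
    (auto intro: Kmon_one dest!: Kmon_K Kmon_Kinv simp: U.m_assoc[symmetric] Kmon_closed
      intro!: Kmon_Kinv[OF Kmon_K])

lemma Hmon_closed: "Hmon a t \<Longrightarrow> t \<in> carrier UU"
  using Hmon_Kmon Kmon_closed by blast

lemma Hmon_ht: "Hmon a t \<Longrightarrow> ht a = 0"
  by (induction rule: Hmon.induct) simp_all

lemma Hmon_mult: "Hmon b s \<Longrightarrow> Hmon a t \<Longrightarrow> Hmon (a + b) (t \<otimes>\<^bsub>UU\<^esub> s)"
proof (induction rule: Hmon.induct)
  case Hmon_one
  then show ?case by (simp add: Hmon_closed)
next
  case (Hmon_step b s i)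
  then show ?case using Hmon.Hmon_step[of "a + b" "t \<otimes>\<^bsub>UU\<^esub> s" i]
    by (simp add: Hmon_closed U.m_assoc algebra_simps)
qed

lemma KK_closed: "range KK \<subseteq> carrier UU"
  by auto

lemma subalgebra_Hth: "U.subalgebra Hth"
  unfolding H_theta_def by (rule U.subalgebra_subalg[OF KK_closed])

lemma KK_Hth: "KK i \<in> Hth"
  unfolding H_theta_def by (rule U.subalg_base) simp

lemma Hmon_Hth: "Hmon a t \<Longrightarrow> t \<in> Hth"
  by (induction rule: Hmon.induct) (auto intro: U.subalgebraD[OF subalgebra_Hth] KK_Hth)

lemma Hmon_set_closed: "{t. \<exists>a. Hmon a t} \<subseteq> carrier UU"
  using Hmon_closed by blast

lemma Hth_span: "Hth = alg_span UU {t. \<exists>a. Hmon a t}"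
proof
  have "U.subalgebra (alg_span UU {t. \<exists>a. Hmon a t})"
  proof (rule U.subalgebraI)
    show "\<one>\<^bsub>UU\<^esub> \<in> alg_span UU {t. \<exists>a. Hmon a t}"
      by (rule U.alg_span_base[OF Hmon_set_closed]) (use Hmon_one in blast)
    show "x \<otimes>\<^bsub>UU\<^esub> y \<in> alg_span UU {t. \<exists>a. Hmon a t}"
      if "x \<in> alg_span UU {t. \<exists>a. Hmon a t}" "y \<in> alg_span UU {t. \<exists>a. Hmon a t}" for x y
      by (rule U.alg_span_mult[OF Hmon_set_closed Hmon_set_closed U.subsp_alg_span[OF Hmon_set_closed] _ that])
        (use Hmon_mult in \<open>blast intro: U.alg_span_base[OF Hmon_set_closed]\<close>)
  qed (rule U.subsp_alg_span[OF Hmon_set_closed])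
  moreover have "KK i \<in> alg_span UU {t. \<exists>a. Hmon a t}" for i
    using Hmon_step[OF Hmon_one, of i] by (intro U.alg_span_base[OF Hmon_set_closed]) auto
  ultimately show "Hth \<subseteq> alg_span UU {t. \<exists>a. Hmon a t}"
    unfolding H_theta_def by (intro U.subalg_least) auto
  show "alg_span UU {t. \<exists>a. Hmon a t} \<subseteq> Hth"
    by (rule U.alg_span_least[OF U.subalgebraD(1)[OF subalgebra_Hth]]) (use Hmon_Hth in blast)
qed

end

sublocale quantum_symmetric \<subseteq> A: generated_algebra "U chi J" "H_theta chi J \<tau>" "U_F chi J"
  by unfold_locales (simp_all add: subalgebra_Hth)

context quantum_symmetric
begin

text \<open>The predicate on lengths lets one spanning set serve the graded pieces, the filtration
  and the whole algebra.\<close>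

definition HF :: "(nat \<Rightarrow> bool) \<Rightarrow> ('i U_gen list \<Rightarrow>\<^sub>0 'k) set set"
  where "HF p = {t \<otimes>\<^bsub>UU\<^esub> cF (Poly_Mapping.single w 1) | a t w. Hmon a t \<and> p (length w)}"

lemma HF_closed: "HF p \<subseteq> carrier UU"
  using Hmon_closed by (auto simp: HF_def)

lemma HF_I: "Hmon a t \<Longrightarrow> p (length w) \<Longrightarrow> t \<otimes>\<^bsub>UU\<^esub> cF (Poly_Mapping.single w 1) \<in> HF p"
  by (auto simp: HF_def)

text \<open>Torus factors scattered through a monomial are collected on the left. Passing a word w
  costs only the scalar chi b (word_deg w), so the length is unchanged.\<close>

lemma mons_HF: "A.mons m \<subseteq> alg_span UU (HF ((=) m))"
proof (induction m)
  case 0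
  have "t \<in> alg_span UU (HF ((=) 0))" if "Hmon a t" for a t
    using HF_I[OF that, of "(=) 0" "[]"] Hmon_closed[OF that]
    by (intro U.alg_span_base[OF HF_closed]) (simp add: cl_one flip: one_eq_single)
  then have "Hth \<subseteq> alg_span UU (HF ((=) 0))"
    unfolding Hth_span by (intro U.alg_span_least U.subsp_alg_span HF_closed) auto
  then show ?case by (simp only: monomials.simps(1))
next
  case (Suc m)
  let ?W = "alg_span UU (HF ((=) (Suc m)))"
  show ?case
  proof
    fix y assume "y \<in> A.mons (Suc m)"
    then obtain x j h where y: "y = x \<otimes>\<^bsub>UU\<^esub> eF j \<otimes>\<^bsub>UU\<^esub> h" "x \<in> A.mons m" "h \<in> Hth" by auto
    have "x \<otimes>\<^bsub>UU\<^esub> eF j \<in> ?W"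
    proof (rule U.alg_span_mult[OF HF_closed _ U.subsp_alg_span[OF HF_closed]])
      show "x \<in> alg_span UU (HF ((=) m))" using Suc y by blast
      show "eF j \<in> alg_span UU {eF j}" by (rule U.alg_span_base) auto
      fix s r assume "s \<in> HF ((=) m)" "r \<in> {eF j}"
      then obtain a t w where s: "s = t \<otimes>\<^bsub>UU\<^esub> cF (Poly_Mapping.single w 1)" "Hmon a t" "length w = m"
        and r: "r = eF j" by (auto simp: HF_def)
      have "s \<otimes>\<^bsub>UU\<^esub> r = t \<otimes>\<^bsub>UU\<^esub> cF (Poly_Mapping.single (w @ [j]) 1)"
      proof -
        have "cF (Poly_Mapping.single w 1) \<otimes>\<^bsub>UU\<^esub> eF j = cF (Poly_Mapping.single (w @ [j]) 1)"
          by (simp add: gen_defs U_simps gen_def)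
        then show ?thesis
          using Hmon_closed[OF s(2)] unfolding s(1) r by (simp add: U.m_assoc del: map_gens_single)
      qed
      then show "s \<otimes>\<^bsub>UU\<^esub> r \<in> ?W"
        using HF_I[OF s(2), of "(=) (Suc m)" "w @ [j]"] s(3) U.alg_span_base[OF HF_closed] by simp
    qed auto
    then show "y \<in> ?W"
      unfolding y(1) using y(3)[unfolded Hth_span]
    proof (rule U.alg_span_mult[OF HF_closed Hmon_set_closed U.subsp_alg_span[OF HF_closed], rotated 1])
      fix s r assume "s \<in> HF ((=) (Suc m))" "r \<in> {t. \<exists>a. Hmon a t}"
      then obtain a t w b where s: "s = t \<otimes>\<^bsub>UU\<^esub> cF (Poly_Mapping.single w 1)" "Hmon a t" "length w = Suc m"
        and r: "Hmon b r" by (auto simp: HF_def)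
      note cl = Hmon_closed[OF s(2)] Hmon_closed[OF r]
      have "s \<otimes>\<^bsub>UU\<^esub> r = (t \<otimes>\<^bsub>UU\<^esub> r) \<otimes>\<^bsub>UU\<^esub> cF (chi_tw b (Poly_Mapping.single w 1))"
        unfolding s(1) using cl by (simp add: U.m_assoc cF_Kmon[OF Hmon_Kmon[OF r]] del: map_gens_single)
      also have "chi_tw b (Poly_Mapping.single w 1) = scal (chi b (word_deg w)) * Poly_Mapping.single w 1"
        by (simp add: chi_tw_def prod_list_chi)
      also have "(t \<otimes>\<^bsub>UU\<^esub> r) \<otimes>\<^bsub>UU\<^esub> cF (scal (chi b (word_deg w)) * Poly_Mapping.single w 1) =
          chi b (word_deg w) \<odot>\<^bsub>UU\<^esub> ((t \<otimes>\<^bsub>UU\<^esub> r) \<otimes>\<^bsub>UU\<^esub> cF (Poly_Mapping.single w 1))"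
        unfolding cF_scal using cl by (simp add: U.smult_mult_right)
      finally show "s \<otimes>\<^bsub>UU\<^esub> r \<in> ?W"
        using HF_I[OF Hmon_mult[OF r s(2)], of "(=) (Suc m)" w] s(3)
          U.alg_span_base[OF HF_closed] U.subspD(4)[OF U.subsp_alg_span[OF HF_closed]] by simp
    qed
  qed
qed

lemma HF_mono: "(\<And>n. p n \<Longrightarrow> p' n) \<Longrightarrow> alg_span UU (HF p) \<subseteq> alg_span UU (HF p')"
  by (rule U.alg_span_mono[OF _ HF_closed]) (auto simp: HF_def)

lemma gdeg_HF: "A.gdeg m \<subseteq> alg_span UU (HF ((=) m))"
  unfolding graded_part_def
  by (intro U.alg_span_least U.subsp_alg_span[OF HF_closed] mons_HF)

lemma below_HF: "A.below m \<subseteq> alg_span UU (HF (\<lambda>n. n < m))"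
proof -
  have "A.mons r \<subseteq> alg_span UU (HF (\<lambda>n. n < m))" if "r < m" for r
    using mons_HF[of r] HF_mono[of "(=) r" "\<lambda>n. n < m"] that by blast
  then show ?thesis
    unfolding A.below_def by (intro U.alg_span_least U.subsp_alg_span[OF HF_closed]) blast
qed

lemma gen_alg_HF: "A.gen_alg \<subseteq> alg_span UU (HF (\<lambda>n. True))"
  using below_HF HF_mono[of _ "\<lambda>n. True"] by (fastforce simp: A.gen_alg_below)

lemma HU_eq: "HU chi J \<tau> = A.gen_alg"
proof
  have "U_minus chi J \<subseteq> A.gen_alg"
    unfolding U_minus_def using A.F_gen_alg by (intro U.subalg_least A.subalgebra_gen_alg) auto
  then show "HU chi J \<tau> \<subseteq> A.gen_alg"
    unfolding HU_def using A.H_gen_alg by (intro U.subalg_least A.subalgebra_gen_alg) auto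
  have "range eF \<subseteq> U_minus chi J"
    unfolding U_minus_def by (auto intro: U.subalg_base)
  moreover have "Hth \<union> U_minus chi J \<subseteq> carrier UU"
    using A.H_carrier by (auto simp: U_minus_eq)
  ultimately show "A.gen_alg \<subseteq> HU chi J \<tau>"
    unfolding HU_def by (intro U.subalg_mono) auto
qed

lemma U_minus_gen_alg: "U_minus chi J \<subseteq> A.gen_alg"
  unfolding U_minus_def using A.F_gen_alg by (intro U.subalg_least A.subalgebra_gen_alg) auto

lemma cF_gen_alg: "cF x \<in> A.gen_alg"
  using U_minus_gen_alg by (auto simp: U_minus_eq)

lemma HF_nf:
  assumes "y \<in> alg_span UU (HF p)"
  shows "\<exists>g. nf y g \<and> (\<forall>a w. Poly_Mapping.lookup (g a) w \<noteq> 0 \<longrightarrow> p (length w)) \<and> (\<forall>a. ht a \<noteq> 0 \<longrightarrow> g a = 0)"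
proof -
  let ?V = "{x. \<forall>w. Poly_Mapping.lookup x w \<noteq> 0 \<longrightarrow> p (length w)}"
  have "HF p \<subseteq> {t \<otimes>\<^bsub>UU\<^esub> cF x | a t x. Kmon a t \<and> a \<in> {a. ht a = 0} \<and> x \<in> ?V}"
  proof
    fix z assume "z \<in> HF p"
    then obtain a t w where z: "z = t \<otimes>\<^bsub>UU\<^esub> cF (Poly_Mapping.single w 1)" "Hmon a t" "p (length w)"
      by (auto simp: HF_def)
    have "Poly_Mapping.single w 1 \<in> ?V" using z(3) by (auto simp: lookup_single when_def)
    then show "z \<in> {t \<otimes>\<^bsub>UU\<^esub> cF x | a t x. Kmon a t \<and> a \<in> {a. ht a = 0} \<and> x \<in> ?V}"
      using z(1) Hmon_Kmon[OF z(2)] Hmon_ht[OF z(2)] by blast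
  qed
  moreover have "{t \<otimes>\<^bsub>UU\<^esub> cF x | a t x. Kmon a t \<and> a \<in> {a. ht a = 0} \<and> x \<in> ?V} \<subseteq> carrier UU"
    using Kmon_closed by auto
  ultimately have y: "y \<in> alg_span UU {t \<otimes>\<^bsub>UU\<^esub> cF x | a t x. Kmon a t \<and> a \<in> {a. ht a = 0} \<and> x \<in> ?V}"
    using assms U.alg_span_mono by blast
  have add: "x + x' \<in> ?V" if xV: "x \<in> ?V" "x' \<in> ?V" for x x' :: "'i list \<Rightarrow>\<^sub>0 'k"
  proof (rule CollectI, intro allI impI)
    fix w assume "Poly_Mapping.lookup (x + x') w \<noteq> 0"
    then have "Poly_Mapping.lookup x w \<noteq> 0 \<or> Poly_Mapping.lookup x' w \<noteq> 0"
      by (auto simp: lookup_add)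
    then show "p (length w)" using xV by blast
  qed
  have "\<exists>g. nf y g \<and> (\<forall>a. g a \<in> ?V) \<and> (\<forall>a. a \<notin> {a. ht a = 0} \<longrightarrow> g a = 0)"
    by (rule nf_span[OF y _ add]) simp_all
  then show ?thesis by simp
qed

text \<open>The element has one normal form with words of length m and another with shorter words,
  and their difference lies in J. Projecting it to words of length m, under which J is stable,
  recovers the first normal form, which therefore lies in J.\<close>

lemma graded_direct:
  assumes "y \<in> A.gdeg m" "y \<in> A.below m" shows "y = \<zero>\<^bsub>UU\<^esub>"
proof -
  obtain g where g: "nf y g" "\<And>a w. Poly_Mapping.lookup (g a) w \<noteq> 0 \<Longrightarrow> m = length w"
    using HF_nf[of y "(=) m"] gdeg_HF assms(1) by blast
  obtain g' where g': "nf y g'" "\<And>a w. Poly_Mapping.lookup (g' a) w \<noteq> 0 \<Longrightarrow> length w < m"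
    using HF_nf[of y "\<lambda>n. n < m"] below_HF assms(2) by blast
  have "g b \<in> J" for b
  proof -
    let ?p = "lin (\<lambda>w. Poly_Mapping.single w (if ht (word_deg w) = int m then 1 else 0)) (g b - g' b)"
    have "?p \<in> J"
      by (rule J_weight[OF nf_unique[OF g(1) g'(1)], of "\<lambda>d. if ht d = int m then 1 else 0"])
    moreover have "?p = g b"
    proof (rule poly_mapping_eqI)
      fix w
      have "Poly_Mapping.lookup ?p w =
          (if length w = m then Poly_Mapping.lookup (g b) w - Poly_Mapping.lookup (g' b) w else 0)"
        unfolding lookup_lin_diag by (simp add: ht_word_deg lookup_minus)
      then show "Poly_Mapping.lookup ?p w = Poly_Mapping.lookup (g b) w"
        using g(2)[of b w] g'(2)[of b w] by (auto split: if_splits)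
    qed
    ultimately show ?thesis by simp
  qed
  then show ?thesis using nf_zero[OF g(1)] by blast
qed

subsection \<open>The polynomial subalgebra\<close>

lemma U_poly_gens: "range eF \<union> range Et \<union> range eKi \<union> range KK \<subseteq> carrier UU"
  by auto

lemma subalgebra_Pol: "U.subalgebra Pol"
  unfolding U_poly_def by (rule U.subalgebra_subalg[OF U_poly_gens])

lemma Pol_gens: "eF i \<in> Pol" "Et i \<in> Pol" "eKi i \<in> Pol" "KK i \<in> Pol"
  unfolding U_poly_def by (auto intro!: U.subalg_base)

lemmas Pol_mult = U.subalgebraD(3)[OF subalgebra_Pol]
lemmas subsp_Pol = U.subalgebraD(1)[OF subalgebra_Pol]
lemmas Pol_closed = U.subsp_carrier[OF subsp_Pol]

lemma Hth_Pol: "Hth \<subseteq> Pol"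
  unfolding H_theta_def by (rule U.subalg_least[OF subalgebra_Pol]) (use Pol_gens in auto)

lemma gen_alg_Pol: "A.gen_alg \<subseteq> Pol"
  using Hth_Pol Pol_gens by (intro U.subalg_least[OF subalgebra_Pol]) auto

text \<open>Right factors are single generators here rather than elements of their span, so
  arguments about \<open>Cpl\<close> become case distinctions; \<open>Cpl_eq\<close> shows that the
  span is the same.\<close>

definition Cgen :: "('i U_gen list \<Rightarrow>\<^sub>0 'k) set set"
  where "Cgen = {x \<otimes>\<^bsub>UU\<^esub> y | x y. x \<in> Pol \<and> y \<in> range Et \<union> range eKi}"

lemma Cgen_I: "x \<in> Pol \<Longrightarrow> y \<in> range Et \<union> range eKi \<Longrightarrow> x \<otimes>\<^bsub>UU\<^esub> y \<in> Cgen"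
  unfolding Cgen_def by blast

lemma Cgen_closed: "Cgen \<subseteq> carrier UU"
  using Pol_closed by (auto simp: Cgen_def)

lemma Cpl_eq: "Cpl = alg_span UU Cgen"
proof
  have EK: "range Et \<union> range eKi \<subseteq> carrier UU" by auto
  have "x \<otimes>\<^bsub>UU\<^esub> y \<in> alg_span UU Cgen" if x: "x \<in> Pol" and y: "y \<in> alg_span UU (range Et \<union> range eKi)" for x y
  proof (rule U.alg_span_mult[OF _ EK U.subsp_alg_span[OF Cgen_closed] _ _ y])
    show xc: "{x} \<subseteq> carrier UU" using Pol_closed x by auto
    show "x \<in> alg_span UU {x}" by (rule U.alg_span_base[OF xc]) simp
    show "s \<otimes>\<^bsub>UU\<^esub> t \<in> alg_span UU Cgen" if "s \<in> {x}" "t \<in> range Et \<union> range eKi" for s t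
      by (rule U.alg_span_base[OF Cgen_closed]) (use that x in \<open>unfold Cgen_def, blast\<close>)
  qed
  then show "Cpl \<subseteq> alg_span UU Cgen"
    unfolding U_poly_compl_def by (intro U.alg_span_least U.subsp_alg_span[OF Cgen_closed]) auto
  have "{x \<otimes>\<^bsub>UU\<^esub> y | x y. x \<in> Pol \<and> y \<in> alg_span UU (range Et \<union> range eKi)} \<subseteq> carrier UU"
    using Pol_closed U.alg_span_carrier[OF EK] by auto
  moreover have "Cgen \<subseteq> {x \<otimes>\<^bsub>UU\<^esub> y | x y. x \<in> Pol \<and> y \<in> alg_span UU (range Et \<union> range eKi)}"
    using U.alg_span_base[OF EK] unfolding Cgen_def by blast
  ultimately show "alg_span UU Cgen \<subseteq> Cpl"
    unfolding U_poly_compl_def by (intro U.alg_span_mono)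
qed

lemma subsp_Cpl: "U.subsp Cpl"
  unfolding Cpl_eq by (rule U.subsp_alg_span[OF Cgen_closed])

lemma Cpl_I: "x \<in> Pol \<Longrightarrow> x \<otimes>\<^bsub>UU\<^esub> Et i \<in> Cpl" "x \<in> Pol \<Longrightarrow> x \<otimes>\<^bsub>UU\<^esub> eKi i \<in> Cpl"
  unfolding Cpl_eq
  by (rule U.alg_span_base[OF Cgen_closed Cgen_I[of x "Et i"]]; simp)
    (rule U.alg_span_base[OF Cgen_closed Cgen_I[of x "eKi i"]]; simp)

lemma Cpl_Pol: "Cpl \<subseteq> Pol"
  unfolding Cpl_eq by (rule U.alg_span_least[OF subsp_Pol]) (use Pol_gens Pol_mult in \<open>auto simp: Cgen_def\<close>)

lemma Pol_Cpl:
  assumes "x \<in> Pol" "y \<in> Cpl" shows "x \<otimes>\<^bsub>UU\<^esub> y \<in> Cpl"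
proof (rule U.alg_span_mult[OF _ Cgen_closed subsp_Cpl])
  show "{x} \<subseteq> carrier UU" using Pol_closed assms by auto
  then show "x \<in> alg_span UU {x}" by (auto intro: U.alg_span_base)
  show "y \<in> alg_span UU Cgen" using assms Cpl_eq by simp
  fix s t assume "s \<in> {x}" "t \<in> Cgen"
  then obtain p y where t: "t = p \<otimes>\<^bsub>UU\<^esub> y" "p \<in> Pol" "y \<in> range Et \<union> range eKi" "s = x"
    by (auto simp: Cgen_def)
  then have "s \<otimes>\<^bsub>UU\<^esub> t = (x \<otimes>\<^bsub>UU\<^esub> p) \<otimes>\<^bsub>UU\<^esub> y"
    using Pol_closed assms by (auto simp: U.m_assoc)
  then show "s \<otimes>\<^bsub>UU\<^esub> t \<in> Cpl" using t(3) Cpl_I[OF Pol_mult[OF assms(1) t(2)]] by auto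
qed

lemma Et_Hmon: "Hmon a t \<Longrightarrow> Et i \<otimes>\<^bsub>UU\<^esub> t = inverse (chi a (\<alpha> i)) \<odot>\<^bsub>UU\<^esub> (t \<otimes>\<^bsub>UU\<^esub> Et i)"
proof -
  assume "Hmon a t"
  note K = Hmon_Kmon[OF this]
  note t = Kmon_closed[OF K]
  have E: "eE i \<otimes>\<^bsub>UU\<^esub> t = inverse (chi a (\<alpha> i)) \<odot>\<^bsub>UU\<^esub> (t \<otimes>\<^bsub>UU\<^esub> eE i)"
    using t by (simp add: Kmon_E[OF K] U.smult_smult)
  have "Et i \<otimes>\<^bsub>UU\<^esub> t = (eE i \<otimes>\<^bsub>UU\<^esub> t) \<otimes>\<^bsub>UU\<^esub> eKi i"
    using t Kmon_commute_gens[OF K, of i] by (simp add: U.m_assoc)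
  then show ?thesis using t by (simp add: E U.smult_mult_left U.m_assoc)
qed

text \<open>Torus monomials commute with \<open>Et i\<close> and \<open>eKi i\<close> up to scalars,
  so h can be moved into the left factor, which stays in \<open>Pol\<close>.\<close>

lemma Cpl_Hth:
  assumes "y \<in> Cpl" "h \<in> Hth" shows "y \<otimes>\<^bsub>UU\<^esub> h \<in> Cpl"
proof (rule U.alg_span_mult[OF Cgen_closed Hmon_set_closed subsp_Cpl])
  show "y \<in> alg_span UU Cgen" "h \<in> alg_span UU {t. \<exists>a. Hmon a t}"
    using assms Cpl_eq Hth_span by auto
  fix s t assume "s \<in> Cgen" "t \<in> {t. \<exists>a. Hmon a t}"
  then obtain p z a where s: "s = p \<otimes>\<^bsub>UU\<^esub> z" "p \<in> Pol" "z \<in> range Et \<union> range eKi" "Hmon a t"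
    by (auto simp: Cgen_def)
  note t = Hmon_closed[OF s(4)]
  note p = Pol_closed[OF s(2)]
  have pt: "p \<otimes>\<^bsub>UU\<^esub> t \<in> Pol" using s Hmon_Hth Hth_Pol Pol_mult by blast
  from s(3) consider i where "z = Et i" | i where "z = eKi i" by blast
  then show "s \<otimes>\<^bsub>UU\<^esub> t \<in> Cpl"
  proof cases
    case (1 i)
    have "s \<otimes>\<^bsub>UU\<^esub> t = p \<otimes>\<^bsub>UU\<^esub> (Et i \<otimes>\<^bsub>UU\<^esub> t)" using p t unfolding s 1 by (simp add: U.m_assoc)
    also have "\<dots> = inverse (chi a (\<alpha> i)) \<odot>\<^bsub>UU\<^esub> ((p \<otimes>\<^bsub>UU\<^esub> t) \<otimes>\<^bsub>UU\<^esub> Et i)"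
      using p t unfolding Et_Hmon[OF s(4)] by (simp add: U.m_assoc U.smult_mult_right)
    finally show ?thesis using Cpl_I(1)[OF pt] U.subspD(4)[OF subsp_Cpl] by simp
  next
    case (2 i)
    have "s \<otimes>\<^bsub>UU\<^esub> t = (p \<otimes>\<^bsub>UU\<^esub> t) \<otimes>\<^bsub>UU\<^esub> eKi i"
      using p t Kmon_commute_gens[OF Hmon_Kmon[OF s(4)], of i] unfolding s 2 by (simp add: U.m_assoc)
    then show ?thesis using Cpl_I(2)[OF pt] by simp
  qed
qed

lemma K_Kinv_Hth: "j = i \<or> j = \<tau> i \<Longrightarrow> eK j \<otimes>\<^bsub>UU\<^esub> eKi i \<in> Hth"
  using KK_Hth[of j] U.subalgebraD(2)[OF subalgebra_Hth] by (auto simp: K_Kinv)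

text \<open>Inserting K_j^{-1} K_j writes the product as \<open>Et j\<close> times K_j K_i^{-1}, an
  element of \<open>H_theta\<close> in both cases. The case j = i concerns generators of
  \<open>Pol\<close>, the case j = \<open>\<tau> i\<close> the elements \<open>eB i\<close>; they
  are treated together from here on.\<close>

lemma E_Kinv_Cpl:
  assumes "j = i \<or> j = \<tau> i" shows "eE j \<otimes>\<^bsub>UU\<^esub> eKi i \<in> Cpl"
proof -
  have "eE j \<otimes>\<^bsub>UU\<^esub> eKi i = eE j \<otimes>\<^bsub>UU\<^esub> (eKi j \<otimes>\<^bsub>UU\<^esub> eK j) \<otimes>\<^bsub>UU\<^esub> eKi i" by (simp add: K_Kinv)
  also have "\<dots> = Et j \<otimes>\<^bsub>UU\<^esub> (eK j \<otimes>\<^bsub>UU\<^esub> eKi i)" by (simp add: U.m_assoc)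
  also have "\<dots> \<in> Cpl"
    using Cpl_Hth[OF _ K_Kinv_Hth[OF assms]] Cpl_I(1)[OF U.subalgebraD(2)[OF subalgebra_Pol], of j] by simp
  finally show ?thesis .
qed

text \<open>K_i^{-1} is moved to the right through x, then E_j through the twisted x. Of the three
  resulting terms, \<open>u1\<close> ends in E_j K_i^{-1} and \<open>u3\<close> in K_i^{-1}, so both
  lie in \<open>Cpl\<close>; what remains is \<open>u2\<close>, from the left derivation. The factor
  \<open>inverse (chi a (\<alpha> j))\<close> is the price of moving E_j past t, and
  \<open>q i j\<close> is what survives of the twist by K_i^{-1} after j is removed.\<close>

lemma E_Kinv_mult:
  assumes ij: "j = i \<or> j = \<tau> i" and t: "Hmon a t"
  shows "(eE j \<otimes>\<^bsub>UU\<^esub> eKi i) \<otimes>\<^bsub>UU\<^esub> (t \<otimes>\<^bsub>UU\<^esub> cF x) \<ominus>\<^bsub>UU\<^esub>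
    (inverse (chi a (\<alpha> j)) * q i j) \<odot>\<^bsub>UU\<^esub> ((t \<otimes>\<^bsub>UU\<^esub> (eK j \<otimes>\<^bsub>UU\<^esub> eKi i)) \<otimes>\<^bsub>UU\<^esub> cF (dp j x)) \<in> Cpl"
proof -
  let ?s = "inverse (chi a (\<alpha> j))" and ?x = "chi_tw (\<alpha> i) x"
  note K = Hmon_Kmon[OF t]
  note tc = Kmon_closed[OF K]
  have E: "eE j \<otimes>\<^bsub>UU\<^esub> t = ?s \<odot>\<^bsub>UU\<^esub> (t \<otimes>\<^bsub>UU\<^esub> eE j)"
    using tc by (simp add: Kmon_E[OF K] U.smult_smult)
  have tP: "t \<in> Pol" using Hmon_Hth[OF t] Hth_Pol by blast
  have cP: "cF y \<in> Pol" for y using cF_gen_alg gen_alg_Pol by blast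
  define u1 where "u1 = (t \<otimes>\<^bsub>UU\<^esub> cF ?x) \<otimes>\<^bsub>UU\<^esub> (eE j \<otimes>\<^bsub>UU\<^esub> eKi i)"
  define u2 where "u2 = (t \<otimes>\<^bsub>UU\<^esub> (eK j \<otimes>\<^bsub>UU\<^esub> eKi i)) \<otimes>\<^bsub>UU\<^esub> cF (dp j x)"
  define u3 where "u3 = (t \<otimes>\<^bsub>UU\<^esub> eKi j \<otimes>\<^bsub>UU\<^esub> cF (dm j ?x)) \<otimes>\<^bsub>UU\<^esub> eKi i"
  have c: "u1 \<in> carrier UU" "u2 \<in> carrier UU" "u3 \<in> carrier UU"
    using tc by (simp_all add: u1_def u2_def u3_def)
  have u1: "u1 \<in> Cpl" unfolding u1_def by (intro Pol_Cpl Pol_mult tP cP E_Kinv_Cpl ij)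
  have u3: "u3 \<in> Cpl" unfolding u3_def by (intro Cpl_I(2) Pol_mult tP cP Pol_gens)
  have "(t \<otimes>\<^bsub>UU\<^esub> eK j \<otimes>\<^bsub>UU\<^esub> cF (dp j ?x)) \<otimes>\<^bsub>UU\<^esub> eKi i =
      (t \<otimes>\<^bsub>UU\<^esub> (eK j \<otimes>\<^bsub>UU\<^esub> eKi i)) \<otimes>\<^bsub>UU\<^esub> cF (chi_tw (- \<alpha> i) (dp j ?x))"
    using tc by (simp add: U.m_assoc cF_Kmon[OF Kmon_gens(2)])
  also have "chi_tw (- \<alpha> i) (dp j ?x) = scal (q i j) * dp j x"
  proof -
    have "chi_tw (- \<alpha> i) (dp j ?x) = scal (q i j) * chi_tw (- \<alpha> i) (chi_tw (\<alpha> i) (dp j x))"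
      by (simp add: dp_chi_tw chi_alpha chi_tw_scal)
    then show ?thesis by (simp add: chi_tw_chi_tw chi_tw_0)
  qed
  finally have mid: "(t \<otimes>\<^bsub>UU\<^esub> eK j \<otimes>\<^bsub>UU\<^esub> cF (dp j ?x)) \<otimes>\<^bsub>UU\<^esub> eKi i = q i j \<odot>\<^bsub>UU\<^esub> u2"
    using tc by (simp add: u2_def cF_scal U.smult_mult_right)
  have "(eE j \<otimes>\<^bsub>UU\<^esub> eKi i) \<otimes>\<^bsub>UU\<^esub> (t \<otimes>\<^bsub>UU\<^esub> cF x) = (eE j \<otimes>\<^bsub>UU\<^esub> t) \<otimes>\<^bsub>UU\<^esub> (eKi i \<otimes>\<^bsub>UU\<^esub> cF x)"
  proof -
    have "eKi i \<otimes>\<^bsub>UU\<^esub> (t \<otimes>\<^bsub>UU\<^esub> cF x) = t \<otimes>\<^bsub>UU\<^esub> (eKi i \<otimes>\<^bsub>UU\<^esub> cF x)"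
      using tc Kmon_commute_gens[OF K, of i] by (simp flip: U.m_assoc)
    then show ?thesis using tc by (simp add: U.m_assoc)
  qed
  also have "eKi i \<otimes>\<^bsub>UU\<^esub> cF x = cF ?x \<otimes>\<^bsub>UU\<^esub> eKi i"
    using Kmon_cF[OF Kmon_gens(2)] by simp
  also have "(eE j \<otimes>\<^bsub>UU\<^esub> t) \<otimes>\<^bsub>UU\<^esub> (cF ?x \<otimes>\<^bsub>UU\<^esub> eKi i) =
      ?s \<odot>\<^bsub>UU\<^esub> ((t \<otimes>\<^bsub>UU\<^esub> (eE j \<otimes>\<^bsub>UU\<^esub> cF ?x)) \<otimes>\<^bsub>UU\<^esub> eKi i)"
    using tc by (simp add: E U.smult_mult_left U.m_assoc)
  also have "(t \<otimes>\<^bsub>UU\<^esub> (eE j \<otimes>\<^bsub>UU\<^esub> cF ?x)) \<otimes>\<^bsub>UU\<^esub> eKi i = u1 \<oplus>\<^bsub>UU\<^esub>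
      ((t \<otimes>\<^bsub>UU\<^esub> eK j \<otimes>\<^bsub>UU\<^esub> cF (dp j ?x)) \<otimes>\<^bsub>UU\<^esub> eKi i \<ominus>\<^bsub>UU\<^esub> u3)"
    using tc by (simp add: E_cF u1_def u3_def U.r_distr U.l_distr U.diff_distrib_left U.diff_distrib_right U.m_assoc)
  also have "\<dots> = u1 \<oplus>\<^bsub>UU\<^esub> (q i j \<odot>\<^bsub>UU\<^esub> u2 \<ominus>\<^bsub>UU\<^esub> u3)" by (simp only: mid)
  finally have "(eE j \<otimes>\<^bsub>UU\<^esub> eKi i) \<otimes>\<^bsub>UU\<^esub> (t \<otimes>\<^bsub>UU\<^esub> cF x) \<ominus>\<^bsub>UU\<^esub> (?s * q i j) \<odot>\<^bsub>UU\<^esub> u2 =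
      ?s \<odot>\<^bsub>UU\<^esub> (u1 \<oplus>\<^bsub>UU\<^esub> (q i j \<odot>\<^bsub>UU\<^esub> u2 \<ominus>\<^bsub>UU\<^esub> u3)) \<ominus>\<^bsub>UU\<^esub> ?s \<odot>\<^bsub>UU\<^esub> (q i j \<odot>\<^bsub>UU\<^esub> u2)"
    using c by (simp add: U.smult_smult)
  also have "\<dots> = ?s \<odot>\<^bsub>UU\<^esub> ((u1 \<oplus>\<^bsub>UU\<^esub> (q i j \<odot>\<^bsub>UU\<^esub> u2 \<ominus>\<^bsub>UU\<^esub> u3)) \<ominus>\<^bsub>UU\<^esub> q i j \<odot>\<^bsub>UU\<^esub> u2)"
    using c by (simp add: U.smult_diff)
  also have "(u1 \<oplus>\<^bsub>UU\<^esub> (q i j \<odot>\<^bsub>UU\<^esub> u2 \<ominus>\<^bsub>UU\<^esub> u3)) \<ominus>\<^bsub>UU\<^esub> q i j \<odot>\<^bsub>UU\<^esub> u2 = u1 \<ominus>\<^bsub>UU\<^esub> u3"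
  proof -
    have "(a \<oplus>\<^bsub>UU\<^esub> (b \<ominus>\<^bsub>UU\<^esub> d)) \<ominus>\<^bsub>UU\<^esub> b = a \<ominus>\<^bsub>UU\<^esub> d"
      if "a \<in> carrier UU" "b \<in> carrier UU" "d \<in> carrier UU" for a b d
    proof -
      have "(a \<oplus>\<^bsub>UU\<^esub> (b \<ominus>\<^bsub>UU\<^esub> d)) \<ominus>\<^bsub>UU\<^esub> b = (a \<ominus>\<^bsub>UU\<^esub> d) \<oplus>\<^bsub>UU\<^esub> (b \<ominus>\<^bsub>UU\<^esub> b)"
        using that by (simp add: U.minus_eq U.a_ac)
      then show ?thesis using that by (simp add: U.diff_eq_zero_iff[THEN iffD2])
    qed
    then show ?thesis using c by simp
  qed
  also have "?s \<odot>\<^bsub>UU\<^esub> (u1 \<ominus>\<^bsub>UU\<^esub> u3) \<in> Cpl"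
    using u1 u3 U.subsp_diff[OF subsp_Cpl] U.subspD(4)[OF subsp_Cpl] by simp
  finally show ?thesis by (simp add: u2_def)
qed

lemma HF_True: "alg_span UU (HF (\<lambda>n. True)) \<subseteq> W"
  if "U.subsp W" "\<And>a t x. Hmon a t \<Longrightarrow> t \<otimes>\<^bsub>UU\<^esub> cF x \<in> W"
  by (rule U.alg_span_least[OF that(1)]) (use that(2) in \<open>auto simp: HF_def simp del: map_gens_single\<close>)

text \<open>The zero multiple of b gives the statement the form of
  \<open>subsp_mult_congruence\<close>, so that it can be checked on the spanning set.\<close>

lemma E_Kinv_gen_alg:
  assumes ij: "j = i \<or> j = \<tau> i" and b: "b \<in> A.gen_alg"
  shows "\<exists>a\<in>A.gen_alg. (eE j \<otimes>\<^bsub>UU\<^esub> eKi i) \<otimes>\<^bsub>UU\<^esub> b \<ominus>\<^bsub>UU\<^esub> (\<zero>\<^bsub>UU\<^esub> \<otimes>\<^bsub>UU\<^esub> b \<oplus>\<^bsub>UU\<^esub> a) \<in> Cpl"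
proof -
  let ?V = "{b \<in> carrier UU. \<exists>a\<in>A.gen_alg.
    (eE j \<otimes>\<^bsub>UU\<^esub> eKi i) \<otimes>\<^bsub>UU\<^esub> b \<ominus>\<^bsub>UU\<^esub> (\<zero>\<^bsub>UU\<^esub> \<otimes>\<^bsub>UU\<^esub> b \<oplus>\<^bsub>UU\<^esub> a) \<in> Cpl}"
  have "alg_span UU (HF (\<lambda>n. True)) \<subseteq> ?V"
  proof (rule HF_True)
    fix a t x assume t: "Hmon a t"
    let ?a = "(inverse (chi a (\<alpha> j)) * q i j) \<odot>\<^bsub>UU\<^esub> ((t \<otimes>\<^bsub>UU\<^esub> (eK j \<otimes>\<^bsub>UU\<^esub> eKi i)) \<otimes>\<^bsub>UU\<^esub> cF (dp j x))"
    have "?a \<in> A.gen_alg"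
      using A.H_gen_alg cF_gen_alg U.subalgebraD(3)[OF subalgebra_Hth Hmon_Hth[OF t] K_Kinv_Hth[OF ij]]
      by (intro U.subspD(4)[OF A.subsp_gen_alg] A.gen_alg_mult[of "t \<otimes>\<^bsub>UU\<^esub> (eK j \<otimes>\<^bsub>UU\<^esub> eKi i)"]) auto
    then show "t \<otimes>\<^bsub>UU\<^esub> cF x \<in> ?V"
      using E_Kinv_mult[OF ij t, of x] Hmon_closed[OF t] A.gen_alg_carrier by auto
  qed (intro U.subsp_mult_congruence A.subsp_gen_alg subsp_Cpl, simp_all)
  then show ?thesis using gen_alg_HF b by blast
qed

lemma Kinv_gen_alg:
  assumes "b \<in> A.gen_alg" shows "eKi i \<otimes>\<^bsub>UU\<^esub> b \<in> Cpl"
proof -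
  have "alg_span UU (HF (\<lambda>n. True)) \<subseteq> {b \<in> carrier UU. eKi i \<otimes>\<^bsub>UU\<^esub> b \<in> Cpl}"
  proof (rule HF_True)
    show "U.subsp {b \<in> carrier UU. eKi i \<otimes>\<^bsub>UU\<^esub> b \<in> Cpl}"
      by (rule U.subspI) (auto simp: U.r_distr U.smult_mult_right intro: U.subspD[OF subsp_Cpl])
    fix a t x assume t: "Hmon a t"
    note tc = Hmon_closed[OF t]
    have "eKi i \<otimes>\<^bsub>UU\<^esub> (t \<otimes>\<^bsub>UU\<^esub> cF x) = t \<otimes>\<^bsub>UU\<^esub> (eKi i \<otimes>\<^bsub>UU\<^esub> cF x)"
      using tc Kmon_commute_gens[OF Hmon_Kmon[OF t], of i] by (simp flip: U.m_assoc)
    also have "\<dots> = (t \<otimes>\<^bsub>UU\<^esub> cF (chi_tw (\<alpha> i) x)) \<otimes>\<^bsub>UU\<^esub> eKi i"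
      using tc Kmon_cF[OF Kmon_gens(2), of i x] by (simp add: U.m_assoc)
    also have "\<dots> \<in> Cpl"
      using Hmon_Hth[OF t] Hth_Pol cF_gen_alg gen_alg_Pol by (intro Cpl_I Pol_mult) auto
    finally show "t \<otimes>\<^bsub>UU\<^esub> cF x \<in> {b \<in> carrier UU. eKi i \<otimes>\<^bsub>UU\<^esub> b \<in> Cpl}" using tc by simp
  qed
  then show ?thesis using assms gen_alg_HF by blast
qed

text \<open>The sum \<open>?W\<close> of \<open>HU\<close> and \<open>Cpl\<close> contains 1, so it
  suffices that left multiplication by the generators of \<open>Pol\<close> preserves it. On
  \<open>Cpl\<close> this is the left ideal property; on \<open>HU\<close> only \<open>Et i\<close>
  and \<open>eKi i\<close> leave the algebra, and their products have been reduced above.\<close>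

lemma Pol_decomp:
  assumes "x \<in> Pol" shows "\<exists>a\<in>A.gen_alg. x \<ominus>\<^bsub>UU\<^esub> a \<in> Cpl"
proof -
  let ?W = "{x \<in> carrier UU. \<exists>a\<in>A.gen_alg. x \<ominus>\<^bsub>UU\<^esub> a \<in> Cpl}"
  have WI: "x \<in> ?W" if "a \<in> A.gen_alg" "x \<ominus>\<^bsub>UU\<^esub> a \<in> Cpl" "x \<in> carrier UU" for x a
    using that by blast
  have W: "U.subsp ?W"
  proof (rule U.subspI)
    show "\<zero>\<^bsub>UU\<^esub> \<in> ?W"
      by (rule WI[of "\<zero>\<^bsub>UU\<^esub>"]) (use U.subspD(2)[OF subsp_Cpl] U.subspD(2)[OF A.subsp_gen_alg] in \<open>simp_all add: U.minus_eq\<close>)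
    show "x \<oplus>\<^bsub>UU\<^esub> y \<in> ?W" if xy: "x \<in> ?W" "y \<in> ?W" for x y
    proof -
      obtain a b where ab: "a \<in> A.gen_alg" "b \<in> A.gen_alg" "x \<ominus>\<^bsub>UU\<^esub> a \<in> Cpl" "y \<ominus>\<^bsub>UU\<^esub> b \<in> Cpl"
        using xy by blast
      have "x \<in> carrier UU" "y \<in> carrier UU" using xy by auto
      then show ?thesis
        using ab U.subspD(3)[OF subsp_Cpl] U.subspD(3)[OF A.subsp_gen_alg] A.gen_alg_carrier
        by (intro WI[of "a \<oplus>\<^bsub>UU\<^esub> b"]) (simp_all add: U.diff_diff_add)
    qed
    show "s \<odot>\<^bsub>UU\<^esub> x \<in> ?W" if x: "x \<in> ?W" for s x
    proof -
      obtain a where a: "a \<in> A.gen_alg" "x \<ominus>\<^bsub>UU\<^esub> a \<in> Cpl" using x by blast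
      have "x \<in> carrier UU" using x by auto
      then show ?thesis
        using a U.subspD(4)[OF subsp_Cpl] U.subspD(4)[OF A.subsp_gen_alg] A.gen_alg_carrier
        by (intro WI[of "s \<odot>\<^bsub>UU\<^esub> a"]) (simp_all flip: U.smult_diff)
    qed
  qed auto
  have gW: "a \<in> ?W" if "a \<in> A.gen_alg" for a
    by (rule WI[of a]) (use that U.subspD(2)[OF subsp_Cpl] A.gen_alg_carrier in \<open>simp_all add: U.minus_eq U.r_neg\<close>)
  have CW: "y \<in> ?W" if "y \<in> Cpl" for y
    by (rule WI[of "\<zero>\<^bsub>UU\<^esub>"])
      (use that U.subsp_carrier[OF subsp_Cpl] U.subspD(2)[OF A.subsp_gen_alg] in \<open>simp_all add: U.minus_eq\<close>)
  have gen: "s \<otimes>\<^bsub>UU\<^esub> a \<in> ?W" if s: "s \<in> range eF \<union> range Et \<union> range eKi \<union> range KK" and a: "a \<in> A.gen_alg" for s a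
  proof -
    consider "s \<in> A.gen_alg" | i where "s = eKi i" | i where "s = Et i"
      using s A.F_gen_alg A.H_gen_alg KK_Hth by blast
    then show ?thesis
    proof cases
      case 1
      then show ?thesis using a gW A.gen_alg_mult by blast
    next
      case (2 i)
      then show ?thesis using CW Kinv_gen_alg[OF a] by simp
    next
      case (3 i)
      obtain b where b: "b \<in> A.gen_alg" "Et i \<otimes>\<^bsub>UU\<^esub> a \<ominus>\<^bsub>UU\<^esub> (\<zero>\<^bsub>UU\<^esub> \<otimes>\<^bsub>UU\<^esub> a \<oplus>\<^bsub>UU\<^esub> b) \<in> Cpl"
        using E_Kinv_gen_alg[of i i a] a by auto
      then show ?thesis unfolding 3 using a A.gen_alg_carrier by (intro WI[of b]) simp_all
    qed
  qed
  have "s \<otimes>\<^bsub>UU\<^esub> w \<in> ?W" if s: "s \<in> range eF \<union> range Et \<union> range eKi \<union> range KK" and w: "w \<in> ?W" for s w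
  proof -
    obtain a where a: "a \<in> A.gen_alg" "w \<ominus>\<^bsub>UU\<^esub> a \<in> Cpl" "w \<in> carrier UU" using w by blast
    have sP: "s \<in> Pol" using s Pol_gens by auto
    have c: "s \<in> carrier UU" "a \<in> carrier UU" using sP Pol_closed a A.gen_alg_carrier by auto
    have "s \<otimes>\<^bsub>UU\<^esub> w = s \<otimes>\<^bsub>UU\<^esub> a \<oplus>\<^bsub>UU\<^esub> s \<otimes>\<^bsub>UU\<^esub> (w \<ominus>\<^bsub>UU\<^esub> a)"
    proof -
      have "w = a \<oplus>\<^bsub>UU\<^esub> (w \<ominus>\<^bsub>UU\<^esub> a)"
        using c a(3) by (simp add: U.minus_eq U.a_comm[of w] U.r_neg2)
      then show ?thesis using c a(3) by (metis U.minus_closed U.r_distr)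
    qed
    then show ?thesis
      using gen[OF s a(1)] CW[OF Pol_Cpl[OF sP a(2)]] U.subspD(3)[OF W] by simp
  qed
  from U.subalg_mult_stable[OF W U_poly_gens this assms[unfolded U_poly_def] gW[OF U.subalgebraD(2)[OF A.subalgebra_gen_alg]]]
  show ?thesis using Pol_closed[OF assms] by simp
qed

text \<open>On the Verma module, \<open>Pol\<close> does not raise the height of torus degrees and \<open>Cpl\<close> maps the
  generator to negative height, whereas the normal form of an element of \<open>H\<^sub>\<theta> \<ltimes> U\<^sup>-\<close> lives in height 0.\<close>

definition low :: "int \<Rightarrow> (int ^ 'i \<Rightarrow> 'i list \<Rightarrow>\<^sub>0 'k) \<Rightarrow> bool"
  where "low d f \<longleftrightarrow> (\<forall>b. d < ht b \<longrightarrow> f b \<in> J)"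

lemma low_act:
  assumes "low d f"
  shows "low (d + 1) (act (Kgen i) f)" "low (d - 1) (act (Kinvgen i) f)" "low d (act (Fgen i) f)"
    "low (d + 1) (act (Egen i) f)"
  using assms by (auto simp: low_def intro!: J_left J_diff J_dp J_dm)

text \<open>E_i alone may raise the height by one, but among the generators it occurs only together
  with K_i^{-1}, which lowers it by one. The bound holds for every d at once, so it survives
  composition.\<close>

lemma Pol_rep: "y \<in> Pol \<Longrightarrow> \<exists>x. y = cl x \<and> (\<forall>d f. low d f \<longrightarrow> low d (rho x f))"
proof -
  let ?W = "{y. \<exists>x. y = cl x \<and> (\<forall>d f. low d f \<longrightarrow> low d (rho x f))}"
  have WI: "cl x \<in> ?W" if "\<And>d f. low d f \<Longrightarrow> low d (rho x f)" for x using that by blast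
  have "U.subalgebra ?W"
  proof (rule U.subalgebraI, rule U.subspI)
    show "\<zero>\<^bsub>UU\<^esub> \<in> ?W" "\<one>\<^bsub>UU\<^esub> \<in> ?W"
      unfolding U_simps by (rule WI; simp add: low_def)+
    show "x \<oplus>\<^bsub>UU\<^esub> y \<in> ?W" if xy: "x \<in> ?W" "y \<in> ?W" for x y
    proof -
      obtain u v where "x = cl u" "y = cl v" "\<And>d f. low d f \<Longrightarrow> low d (rho u f)" "\<And>d f. low d f \<Longrightarrow> low d (rho v f)"
        using xy by blast
      then show ?thesis using WI[of "u + v"] by (simp add: U_simps rho_add low_def J_add)
    qed
    show "x \<otimes>\<^bsub>UU\<^esub> y \<in> ?W" if xy: "x \<in> ?W" "y \<in> ?W" for x y
    proof -
      obtain u v where "x = cl u" "y = cl v" "\<And>d f. low d f \<Longrightarrow> low d (rho u f)" "\<And>d f. low d f \<Longrightarrow> low d (rho v f)"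
        using xy by blast
      then show ?thesis using WI[of "u * v"] by (simp add: U_simps rho_mult)
    qed
    show "a \<odot>\<^bsub>UU\<^esub> x \<in> ?W" if x: "x \<in> ?W" for a x
    proof -
      obtain u where "x = cl u" "\<And>d f. low d f \<Longrightarrow> low d (rho u f)" using x by blast
      then show ?thesis using WI[of "scal a * u"] by (simp add: U_simps rho_scal low_def J_left)
    qed
  qed auto
  moreover have "eF i \<in> ?W" "eKi i \<in> ?W" "Et i \<in> ?W" "KK i \<in> ?W" for i
  proof -
    show "eF i \<in> ?W" "eKi i \<in> ?W"
      unfolding gen_defs using low_act(2,3) by (rule_tac [!] WI) (fastforce simp: low_def)+
    show "Et i \<in> ?W" "KK i \<in> ?W"
      unfolding gen_defs U_simps
      using low_act(4)[OF low_act(2)] low_act(1)[OF low_act(2)]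
      by (rule_tac [!] WI) (simp_all add: rho_mult del: act.simps)
  qed
  ultimately have "Pol \<subseteq> ?W" unfolding U_poly_def by (intro U.subalg_least) auto
  then show "y \<in> Pol \<Longrightarrow> ?thesis" by blast
qed

text \<open>E_i K_i^{-1} kills \<open>vac\<close>, up to a scalar because E_i does, and K_i^{-1}
  moves it to height -1. A further left factor from \<open>Pol\<close> does not raise this
  bound.\<close>

lemma Cpl_rep: "y \<in> Cpl \<Longrightarrow> \<exists>x. y = cl x \<and> low (- 1) (rho x vac)"
proof -
  let ?W = "{y. \<exists>x. y = cl x \<and> low (- 1) (rho x vac)}"
  have W: "U.subsp ?W"
  proof (rule U.subspI)
    show "\<zero>\<^bsub>UU\<^esub> \<in> ?W" unfolding U_simps by (auto simp: low_def intro!: exI[of _ 0])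
    show "x \<oplus>\<^bsub>UU\<^esub> y \<in> ?W" if xy: "x \<in> ?W" "y \<in> ?W" for x y
    proof -
      obtain u v where "x = cl u" "y = cl v" "low (- 1) (rho u vac)" "low (- 1) (rho v vac)"
        using xy by blast
      then show ?thesis by (auto simp: U_simps rho_add low_def J_add intro!: exI[of _ "u + v"])
    qed
    show "a \<odot>\<^bsub>UU\<^esub> x \<in> ?W" if x: "x \<in> ?W" for a x
    proof -
      obtain u where "x = cl u" "low (- 1) (rho u vac)" using x by blast
      then show ?thesis by (auto simp: U_simps rho_scal low_def J_left intro!: exI[of _ "scal a * u"])
    qed
  qed auto
  have "Cgen \<subseteq> ?W"
  proof
    fix s assume "s \<in> Cgen"
    then obtain p z where s: "s = p \<otimes>\<^bsub>UU\<^esub> z" "p \<in> Pol" "z \<in> range Et \<union> range eKi" by (auto simp: Cgen_def)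
    obtain x where x: "p = cl x" "\<And>d f. low d f \<Longrightarrow> low d (rho x f)" using Pol_rep[OF s(2)] by blast
    have "\<exists>y. z = cl y \<and> low (- 1) (rho y vac)"
    proof -
      from s(3) consider i where "z = Et i" | i where "z = eKi i" by blast
      then show ?thesis
      proof cases
        case (1 i)
        have "rho (gen (Egen i) * gen (Kinvgen i)) vac = (\<lambda>b. 0)"
          by (simp add: rho_mult act_EKinv act_E_vac del: act.simps)
        then show ?thesis unfolding 1
          by (intro exI[of _ "gen (Egen i) * gen (Kinvgen i)"]) (simp add: gen_defs U_simps low_def)
      next
        case (2 i)
        have "vac (b + \<alpha> i) = 0" if "- 1 < ht b" for b
        proof -
          have "ht (b + \<alpha> i) \<noteq> 0" using that by simp
          then have "b + \<alpha> i \<noteq> 0" by (metis ht_simps(1))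
          then show ?thesis by (simp add: vac_def)
        qed
        then show ?thesis unfolding 2
          by (intro exI[of _ "gen (Kinvgen i)"]) (simp add: gen_defs low_def)
      qed
    qed
    then obtain y where "z = cl y" "low (- 1) (rho y vac)" by blast
    then show "s \<in> ?W" unfolding s x(1) using x(2)
      by (auto simp: U_simps rho_mult intro!: exI[of _ "x * y"])
  qed
  then have "Cpl \<subseteq> ?W" unfolding Cpl_eq by (rule U.alg_span_least[OF W])
  then show "y \<in> Cpl \<Longrightarrow> ?thesis" by blast
qed

lemma gen_alg_Cpl_direct:
  assumes "y \<in> A.gen_alg" "y \<in> Cpl" shows "y = \<zero>\<^bsub>UU\<^esub>"
proof -
  obtain g where g: "nf y g" "\<And>a. ht a \<noteq> 0 \<Longrightarrow> g a = 0"
    using HF_nf[OF subsetD[OF gen_alg_HF assms(1)]] by blast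
  obtain x where x: "y = cl x" "rho x vac = g" using nf_rep[OF g(1)] by blast
  obtain x' where x': "y = cl x'" "low (- 1) (rho x' vac)" using Cpl_rep[OF assms(2)] by blast
  have "x - x' \<in> I" using x x' cl_eq_iff by metis
  from U_ideal_rho_vac[OF this] have d: "g b - rho x' vac b \<in> J" for b using x by (simp add: rho_diff)
  \<comment> \<open>At height zero the representative coming from \<open>Cpl\<close> is already
    J-valued; at all other heights g itself vanishes.\<close>
  have "g b \<in> J" for b
  proof (cases "ht b = 0")
    case True
    then have "rho x' vac b \<in> J" using x'(2) by (simp add: low_def)
    then show ?thesis using J_add[OF d[of b], of "rho x' vac b"] by simp
  qed (simp add: g(2))
  then show ?thesis using nf_zero[OF g(1)] by blast
qed

end

section \<open>The star product\<close>

context quantum_symmetric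
begin

lemma B_closed [simp]: "eB i \<in> carrier UU"
  by (simp add: B_gen_def)

lemma B_Pol: "eB i \<in> Pol"
  unfolding B_gen_def
  using E_Kinv_Cpl[of "\<tau> i" i] Cpl_Pol Pol_gens
  by (intro U.subspD(3,4)[OF subsp_Pol]) auto

lemma cF_below:
  assumes "\<And>w. Poly_Mapping.lookup x w \<noteq> 0 \<Longrightarrow> length w < l" shows "cF x \<in> A.below l"
proof -
  have mons: "cF (Poly_Mapping.single w 1) \<in> A.mons (length w)" for w
  proof (induction w)
    case Nil
    then show ?case using A.one_mons by (simp add: cl_one flip: one_eq_single)
  next
    case (Cons i w)
    have "cF (Poly_Mapping.single (i # w) 1) = eF i \<otimes>\<^bsub>UU\<^esub> cF (Poly_Mapping.single w 1)"
      using cF_Cons[of i "Poly_Mapping.single w 1"] by (simp add: gen_def)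
    then show ?case using A.mons_mult[OF A.F_mons Cons] by simp
  qed
  have "cF (\<Sum>w\<in>S. Poly_Mapping.single w (Poly_Mapping.lookup x w)) \<in> A.below l"
    if "finite S" "S \<subseteq> Poly_Mapping.keys x" for S
    using that
  proof (induction S)
    case empty
    then show ?case using U.subspD(2)[OF A.subsp_below] by (simp add: cl_zero)
  next
    case (insert w S)
    then have "cF (Poly_Mapping.single w 1) \<in> A.below l"
      using mons A.mons_below assms[of w] by (auto simp: in_keys_iff simp del: map_gens_single)
    moreover have "Poly_Mapping.single w (Poly_Mapping.lookup x w) =
        scal (Poly_Mapping.lookup x w) * Poly_Mapping.single w 1" by simp
    ultimately show ?case
      using insert U.subspD(3,4)[OF A.subsp_below]
      by (simp add: cF_add cF_scal del: map_gens_single scal_mult_single)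
  qed
  moreover have "(\<Sum>w\<in>Poly_Mapping.keys x. Poly_Mapping.single w (Poly_Mapping.lookup x w)) = x"
    by (rule poly_mapping_eqI) (auto simp: lookup_sum lookup_single when_def in_keys_iff)
  ultimately show ?thesis by (metis finite_keys order_refl)
qed

text \<open>The F-part cancels, so a congruence for \<open>eB i\<close> is \<open>c i\<close> times
  one for E_{\<tau> i} K_i^{-1}.\<close>

lemma B_mult:
  assumes "b \<in> carrier UU" "a \<in> carrier UU"
  shows "eB i \<otimes>\<^bsub>UU\<^esub> b \<ominus>\<^bsub>UU\<^esub> (eF i \<otimes>\<^bsub>UU\<^esub> b \<oplus>\<^bsub>UU\<^esub> c i \<odot>\<^bsub>UU\<^esub> a) =
    c i \<odot>\<^bsub>UU\<^esub> ((eE (\<tau> i) \<otimes>\<^bsub>UU\<^esub> eKi i) \<otimes>\<^bsub>UU\<^esub> b \<ominus>\<^bsub>UU\<^esub> a)"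
proof -
  have "eB i \<otimes>\<^bsub>UU\<^esub> b = eF i \<otimes>\<^bsub>UU\<^esub> b \<oplus>\<^bsub>UU\<^esub> c i \<odot>\<^bsub>UU\<^esub> ((eE (\<tau> i) \<otimes>\<^bsub>UU\<^esub> eKi i) \<otimes>\<^bsub>UU\<^esub> b)"
    using assms by (simp add: B_gen_def U.l_distr U.smult_mult_left)
  then have "eB i \<otimes>\<^bsub>UU\<^esub> b \<ominus>\<^bsub>UU\<^esub> (eF i \<otimes>\<^bsub>UU\<^esub> b \<oplus>\<^bsub>UU\<^esub> c i \<odot>\<^bsub>UU\<^esub> a) =
    (eF i \<otimes>\<^bsub>UU\<^esub> b \<ominus>\<^bsub>UU\<^esub> eF i \<otimes>\<^bsub>UU\<^esub> b) \<oplus>\<^bsub>UU\<^esub>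
      (c i \<odot>\<^bsub>UU\<^esub> ((eE (\<tau> i) \<otimes>\<^bsub>UU\<^esub> eKi i) \<otimes>\<^bsub>UU\<^esub> b) \<ominus>\<^bsub>UU\<^esub> c i \<odot>\<^bsub>UU\<^esub> a)"
    using assms by (simp add: U.diff_diff_add)
  also have "eF i \<otimes>\<^bsub>UU\<^esub> b \<ominus>\<^bsub>UU\<^esub> eF i \<otimes>\<^bsub>UU\<^esub> b = \<zero>\<^bsub>UU\<^esub>"
    using assms by (simp add: U.diff_eq_zero_iff)
  finally show ?thesis using assms by (simp add: U.smult_diff)
qed

text \<open>The correction is a torus multiple of \<open>dp (\<tau> i)\<close> applied to a word of
  length l, hence a combination of words that are shorter by one. This discharges the assumption
  \<open>lower\<close> of the deformation.\<close>

lemma B_lower: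
  assumes "b \<in> A.gdeg l"
  shows "\<exists>a\<in>A.below l. eB i \<otimes>\<^bsub>UU\<^esub> b \<ominus>\<^bsub>UU\<^esub> (eF i \<otimes>\<^bsub>UU\<^esub> b \<oplus>\<^bsub>UU\<^esub> a) \<in> Cpl"
proof -
  let ?V = "{b \<in> carrier UU. \<exists>a\<in>A.below l. eB i \<otimes>\<^bsub>UU\<^esub> b \<ominus>\<^bsub>UU\<^esub> (eF i \<otimes>\<^bsub>UU\<^esub> b \<oplus>\<^bsub>UU\<^esub> a) \<in> Cpl}"
  have "HF ((=) l) \<subseteq> ?V"
  proof
    fix y assume "y \<in> HF ((=) l)"
    then obtain a t w where y: "y = t \<otimes>\<^bsub>UU\<^esub> cF (Poly_Mapping.single w 1)" "Hmon a t" "length w = l"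
      by (auto simp: HF_def)
    let ?d = "dp (\<tau> i) (Poly_Mapping.single w 1)"
    let ?a = "(inverse (chi a (\<alpha> (\<tau> i))) * q i (\<tau> i)) \<odot>\<^bsub>UU\<^esub>
      ((t \<otimes>\<^bsub>UU\<^esub> (eK (\<tau> i) \<otimes>\<^bsub>UU\<^esub> eKi i)) \<otimes>\<^bsub>UU\<^esub> cF ?d)"
    have yc: "y \<in> carrier UU" using Hmon_closed[OF y(2)] by (simp add: y(1))
    have "length v < l" if "Poly_Mapping.lookup ?d v \<noteq> 0" for v
    proof -
      have "v \<in> Poly_Mapping.keys (skew_word (\<lambda>j. q (\<tau> i) j) (\<tau> i) w)"
        using that by (simp add: dp_def in_keys_iff)
      then show ?thesis using skew_word_length y(3) by fastforce
    qed
    then have "cF ?d \<in> A.below l" by (rule cF_below)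
    then have a: "?a \<in> A.below l"
      using A.H_below U.subalgebraD(3)[OF subalgebra_Hth Hmon_Hth[OF y(2)] K_Kinv_Hth[of "\<tau> i" i]]
        U.subspD(4)[OF A.subsp_below] by simp
    have "(eE (\<tau> i) \<otimes>\<^bsub>UU\<^esub> eKi i) \<otimes>\<^bsub>UU\<^esub> y \<ominus>\<^bsub>UU\<^esub> ?a \<in> Cpl"
      unfolding y(1) using E_Kinv_mult[of "\<tau> i" i a t "Poly_Mapping.single w 1"] y(2) by simp
    then have "eB i \<otimes>\<^bsub>UU\<^esub> y \<ominus>\<^bsub>UU\<^esub> (eF i \<otimes>\<^bsub>UU\<^esub> y \<oplus>\<^bsub>UU\<^esub> c i \<odot>\<^bsub>UU\<^esub> ?a) \<in> Cpl"
      using B_mult[OF yc A.below_carrier[OF a]] U.subspD(4)[OF subsp_Cpl] by simp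
    then show "y \<in> ?V" using yc U.subspD(4)[OF A.subsp_below a] by blast
  qed
  then have "alg_span UU (HF ((=) l)) \<subseteq> ?V"
    by (intro U.alg_span_least U.subsp_mult_congruence A.subsp_below subsp_Cpl) auto
  then show ?thesis using gdeg_HF assms by blast
qed

text \<open>The torus factor is placed on the right here, because uniqueness of the star product
  extends from \<open>U_minus\<close> by right multiplication with \<open>Hth\<close>.\<close>

lemma gen_alg_span: "A.gen_alg \<subseteq> alg_span UU {u \<otimes>\<^bsub>UU\<^esub> h | u h. u \<in> U_minus chi J \<and> h \<in> Hth}"
proof -
  let ?S = "{u \<otimes>\<^bsub>UU\<^esub> h | u h. u \<in> U_minus chi J \<and> h \<in> Hth}"
  have S: "?S \<subseteq> carrier UU" using A.H_carrier by (auto simp: U_minus_eq)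
  have "alg_span UU (HF (\<lambda>n. True)) \<subseteq> alg_span UU ?S"
  proof (rule HF_True[OF U.subsp_alg_span[OF S]])
    fix a t x assume t: "Hmon a t"
    have "cF (chi_tw (- a) x) \<otimes>\<^bsub>UU\<^esub> t \<in> ?S" using Hmon_Hth[OF t] by (auto simp: U_minus_eq)
    then show "t \<otimes>\<^bsub>UU\<^esub> cF x \<in> alg_span UU ?S"
      unfolding Kmon_cF[OF Hmon_Kmon[OF t]] by (rule U.alg_span_base[OF S])
  qed
  then show ?thesis using gen_alg_HF by blast
qed

lemma deformation_U: "deformation UU Hth eF eB Pol Cpl"
proof -
  interpret B: generated_algebra UU Hth eB
    by unfold_locales (simp_all add: subalgebra_Hth)
  show ?thesis
    by (unfold_locales)
      (fact subalgebra_Pol Hth_Pol Pol_gens B_Pol subsp_Cpl Pol_Cpl Cpl_Hth Pol_decomp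
        gen_alg_Cpl_direct graded_direct B_lower)+
qed

lemma star_product_theorem:
  assumes "is_phi chi J \<tau> c \<phi>"
    and "\<phi> \<in> alg_iso (gr_B chi J \<tau> c) (UU\<lparr>carrier := HU chi J \<tau>\<rparr>)"
  shows "\<exists>star. theta_star chi J \<tau> c star \<and>
    (\<forall>star'. theta_star chi J \<tau> c star' \<longrightarrow>
      (\<forall>a\<in>HU chi J \<tau>. \<forall>b\<in>HU chi J \<tau>. star' a b = star a b)) \<and>
    psi chi J \<tau> \<in> alg_iso (UU\<lparr>carrier := B chi J \<tau> c\<rparr>)
      (UU\<lparr>carrier := HU chi J \<tau>, monoid.mult := star\<rparr>)"
proof -
  interpret D: deformation UU Hth eF eB Pol Cpl by (rule deformation_U)
  have B: "B chi J \<tau> c = D.G.gen_alg" by (simp add: B_def)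
  have fil: "B_fil chi J \<tau> c = filtered_part UU Hth (range eB)" by (simp add: B_fil_def)
  interpret D: pbw_deformation UU Hth eF eB Pol Cpl \<phi>
    by unfold_locales (use assms in \<open>simp_all add: is_phi_def gr_B_def B fil HU_eq\<close>)
  have deg: "HU_deg chi J \<tau> = A.gdeg" by (simp add: HU_deg_def fun_eq_iff)
  have psi: "psi chi J \<tau> = D.proj" by (simp add: fun_eq_iff psi_def D.proj_def HU_eq)
  have formula: "D.star (eF i) u = (eF i \<otimes>\<^bsub>UU\<^esub> u) \<oplus>\<^bsub>UU\<^esub>
      (c i * q i (\<tau> i)) \<odot>\<^bsub>UU\<^esub> (eK (\<tau> i) \<otimes>\<^bsub>UU\<^esub> eKi i \<otimes>\<^bsub>UU\<^esub> dL chi J (\<tau> i) u)" if um: "u \<in> U_minus chi J" for i u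
  proof -
    obtain x where u: "u = cF x" using um by (auto simp: U_minus_eq)
    let ?a = "q i (\<tau> i) \<odot>\<^bsub>UU\<^esub> ((eK (\<tau> i) \<otimes>\<^bsub>UU\<^esub> eKi i) \<otimes>\<^bsub>UU\<^esub> cF (dp (\<tau> i) x))"
    have "(eE (\<tau> i) \<otimes>\<^bsub>UU\<^esub> eKi i) \<otimes>\<^bsub>UU\<^esub> u \<ominus>\<^bsub>UU\<^esub> ?a \<in> Cpl"
      \<comment> \<open>The trivial torus monomial has degree 0, where chi is 1; the constant
        therefore reduces to q i (\<tau> i).\<close>
      using E_Kinv_mult[of "\<tau> i" i 0 "\<one>\<^bsub>UU\<^esub>" x] Hmon_one by (simp add: u)
    then have "eB i \<otimes>\<^bsub>UU\<^esub> u \<ominus>\<^bsub>UU\<^esub> (eF i \<otimes>\<^bsub>UU\<^esub> u \<oplus>\<^bsub>UU\<^esub> c i \<odot>\<^bsub>UU\<^esub> ?a) \<in> Cpl"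
      using B_mult[of u ?a i] U.subspD(4)[OF subsp_Cpl] by (simp add: u)
    moreover have "eF i \<otimes>\<^bsub>UU\<^esub> u \<oplus>\<^bsub>UU\<^esub> c i \<odot>\<^bsub>UU\<^esub> ?a \<in> A.gen_alg"
      using A.F_gen_alg cF_gen_alg A.H_gen_alg K_Kinv_Hth[of "\<tau> i" i] unfolding u
      by (intro U.subspD(3,4)[OF A.subsp_gen_alg] A.gen_alg_mult[of "eK (\<tau> i) \<otimes>\<^bsub>UU\<^esub> eKi i"] A.gen_alg_mult[of "eF i"]) auto
    ultimately have "D.proj (eB i \<otimes>\<^bsub>UU\<^esub> u) = eF i \<otimes>\<^bsub>UU\<^esub> u \<oplus>\<^bsub>UU\<^esub> c i \<odot>\<^bsub>UU\<^esub> ?a"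
      by (intro D.proj_eqI) (simp_all add: u)
    then show ?thesis
      using D.star_gen[of u i] U_minus_gen_alg um by (auto simp: u dL_cF U.smult_smult)
  qed
  have theta: "theta_star chi J \<tau> c D.star"
    unfolding theta_star_def HU_eq deg
    using D.star_product_star D.zero_equivariant_star formula by blast
  have unique: "star' a b = D.star a b"
    if "theta_star chi J \<tau> c star'" "a \<in> A.gen_alg" "b \<in> A.gen_alg" for star' a b
  proof (rule A.star_product_unique[OF _ _ D.star_product_star D.zero_equivariant_star U_minus_gen_alg gen_alg_span])
    show "star_product UU A.gen_alg A.gdeg star'" "zero_equivariant UU A.gen_alg A.gdeg star'"
      "\<And>i u. u \<in> U_minus chi J \<Longrightarrow> star' (eF i) u = D.star (eF i) u"
      using that(1) formula unfolding theta_star_def HU_eq deg by simp_all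
  qed (use that in auto)
  show ?thesis
    using theta unique D.proj_alg_iso unfolding HU_eq B psi by blast
qed

end

theorem theoremD:
  fixes chi :: "int ^ 'i::finite \<Rightarrow> int ^ 'i \<Rightarrow> 'k::field"
    and J :: "('i list \<Rightarrow>\<^sub>0 'k) set"
    and \<tau> :: "'i \<Rightarrow> 'i"
    and c :: "'i \<Rightarrow> 'k"
    and \<phi> :: "(nat \<Rightarrow> ('i U_gen list \<Rightarrow>\<^sub>0 'k) set set) \<Rightarrow> ('i U_gen list \<Rightarrow>\<^sub>0 'k) set"
  assumes "bicharacter chi"
    and "\<forall>i j. qmat chi i j = qmat chi j i"
    and "biideal chi J"
    and "graded_subset J"
    and "\<forall>x\<in>J. \<forall>w\<in>Poly_Mapping.keys x. 2 \<le> length w"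
    and "bij \<tau>"
    and "\<tau> \<circ> \<tau> = id"
    and "\<forall>i j. qmat chi (\<tau> i) (\<tau> j) = qmat chi i j"
    and "map_gens \<tau> ` J = J"
    and "is_phi chi J \<tau> c \<phi>"
    and "\<phi> \<in> alg_iso (gr_B chi J \<tau> c) (U chi J\<lparr>carrier := HU chi J \<tau>\<rparr>)"
  shows "\<exists>star. theta_star chi J \<tau> c star \<and>
    (\<forall>star'. theta_star chi J \<tau> c star' \<longrightarrow>
      (\<forall>a\<in>HU chi J \<tau>. \<forall>b\<in>HU chi J \<tau>. star' a b = star a b)) \<and>
    psi chi J \<tau> \<in> alg_iso (U chi J\<lparr>carrier := B chi J \<tau> c\<rparr>)
      (U chi J\<lparr>carrier := HU chi J \<tau>, monoid.mult := star\<rparr>)"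
proof -
  have "\<tau> (\<tau> i) = i" for i
    using assms(7) by (simp add: fun_eq_iff)
  then interpret quantum_symmetric chi J \<tau> c
    using assms(1-5) by unfold_locales auto
  show ?thesis by (rule star_product_theorem[OF assms(10,11)])
qed

end
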